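(* Let $n\ge p$, and let $X$ ($m\times p$) and $S$ ($p\times p$) be independent with $X\sim \mathcal N_{m\times p}(\Theta, I_m\otimes\Sigma)$ and $S\sim\mathcal W_p(n,\Sigma)$. Assume $m\ge p$. For positive constants $\alpha,\beta$ let $\widehat\Sigma_0=n^{-1}S$ and $$\widehat\Theta^{G}=X-\alpha X\{I_p+\beta S^{-1}X^\top X\}^{-1},\qquad \widehat\Sigma^{G2}=\widehat\Sigma_0-\alpha\widehat\Sigma_0(I_p+\beta S^{-1}X^\top X)^{-1}.$$ If $\alpha<1$ and $$(n+p+1)\alpha+\frac{m\alpha\beta}{2(1-\alpha)}\le 2(m-p-1)\beta+2\frac mn\beta,$$ then the estimator $(\widehat\Theta^G,\widehat\Sigma^{G2})$ of $(\Theta,\Sigma)$ dominates $(X,\widehat\Sigma_0)$ relative to the Kullback-Leibler divergence.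
   Context: $\mathcal N_{m\times p}(\Theta,I_m\otimes\Sigma)$ is the distribution of an $m\times p$ matrix with mean $\Theta$ and independent normal rows with covariance $\Sigma$ ($p\times p$ positive definite), with density $\phi(\cdot\mid\Theta,\Sigma)$; $\mathcal W_p(n,\Sigma)$ is the Wishart distribution with $n$ degrees of freedom and scale $\Sigma$. Both $\Theta$ and $\Sigma$ are unknown. The Kullback-Leibler loss of $(\widehat\Theta,\widehat\Sigma)$ is $$D_{KL}=\int\log\frac{\phi(Y\mid\widehat\Theta,\widehat\Sigma)}{\phi(Y\mid\Theta,\Sigma)}\,\phi(Y\mid\widehat\Theta,\widehat\Sigma)\,dY=\frac m2\{\mathrm{tr}(\widehat\Sigma\Sigma^{-1})-\log|\widehat\Sigma\Sigma^{-1}|-p\}+\frac12\mathrm{tr}\{(\widehat\Theta-\Theta)\Sigma^{-1}(\widehat\Theta-\Theta)^\top\},$$ and the risk is its expectation over $(X,S)$. One estimator dominates another if its risk is at most that of the other for all $(\Theta,\Sigma)$ with strict inequality for some $(\Theta,\Sigma)$. *)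

theory Defs
  imports "HOL-Probability.Probability"
begin

text \<open>
  An $m \times p$ matrix has type \<open>real^'p^'m\<close>, with $m$ = \<open>CARD('m)\<close> and
  $p$ = \<open>CARD('p)\<close>; its $i$-th row is \<open>Y $ i\<close>.
\<close>

definition pos_def_matrix :: "real^'p^'p \<Rightarrow> bool" where
  "pos_def_matrix A \<longleftrightarrow> transpose A = A \<and> (\<forall>x. x \<noteq> 0 \<longrightarrow> 0 < x \<bullet> (A *v x))"

definition matrix_normal_density ::
    "real^'p^'m \<Rightarrow> real^'p^'p \<Rightarrow> real^'p^'m \<Rightarrow> real" where
  "matrix_normal_density \<Theta> \<Sigma> Y =
     (2 * pi) powr (- (real CARD('m) * real CARD('p) / 2)) *
     det \<Sigma> powr (- (real CARD('m) / 2)) *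
     exp (- (1 / 2) * trace ((Y - \<Theta>) ** matrix_inv \<Sigma> ** transpose (Y - \<Theta>)))"

definition matrix_normal ::
    "real^'p^'m \<Rightarrow> real^'p^'p \<Rightarrow> (real^'p^'m) measure" where
  "matrix_normal \<Theta> \<Sigma> = density lborel (\<lambda>Y. ennreal (matrix_normal_density \<Theta> \<Sigma> Y))"

text \<open>
  The Wishart distribution with $n$ = \<open>CARD('n)\<close> degrees of freedom: the law of
  $Z^\top Z$, where the $n$ rows of $Z$ are independent and $N_p(0, \Sigma)$ distributed.
\<close>

definition wishart :: "'n::finite itself \<Rightarrow> real^'p^'p \<Rightarrow> (real^'p^'p) measure" where
  "wishart _ \<Sigma> = distr (matrix_normal (0 :: real^'p^'n) \<Sigma>) borel (\<lambda>Z. transpose Z ** Z)"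

text \<open>
  The argument order follows the paper's loss, in which the expectation is taken under
  the estimated density. Integrals are over all of $\mathbb{R}^{m \times p}$.
\<close>

definition kl_loss ::
    "(real^'p^'m) \<times> (real^'p^'p) \<Rightarrow> real^'p^'m \<Rightarrow> real^'p^'p \<Rightarrow> real" where
  "kl_loss est \<Theta> \<Sigma> = (case est of (\<Theta>h, \<Sigma>h) \<Rightarrow>
     LINT Y|lborel. ln (matrix_normal_density \<Theta>h \<Sigma>h Y / matrix_normal_density \<Theta> \<Sigma> Y)
                      * matrix_normal_density \<Theta>h \<Sigma>h Y)"

text \<open>
  An estimator is a function of the observation \<open>(X, S)\<close>. Independence of \<open>X\<close> and \<open>S\<close> is
  expressed by the product measure. The loss is nonnegative whenever \<open>\<Sigma>\<close> and its estimate
  are positive definite, so its expectation is taken as a Lebesgue integral with values in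
  $[0, \infty]$; this way an infinite risk is not confused with risk 0.
\<close>

definition kl_risk ::
    "'n::finite itself \<Rightarrow> (real^'p^'m \<Rightarrow> real^'p^'p \<Rightarrow> (real^'p^'m) \<times> (real^'p^'p)) \<Rightarrow>
     real^'p^'m \<Rightarrow> real^'p^'p \<Rightarrow> ennreal" where
  "kl_risk n \<delta> \<Theta> \<Sigma> =
     (\<integral>\<^sup>+ (X, S). ennreal (kl_loss (\<delta> X S) \<Theta> \<Sigma>) \<partial>(matrix_normal \<Theta> \<Sigma> \<Otimes>\<^sub>M wishart n \<Sigma>))"

definition kl_dominates ::
    "'n::finite itself \<Rightarrow> (real^'p^'m \<Rightarrow> real^'p^'p \<Rightarrow> (real^'p^'m) \<times> (real^'p^'p)) \<Rightarrow>
     (real^'p^'m \<Rightarrow> real^'p^'p \<Rightarrow> (real^'p^'m) \<times> (real^'p^'p)) \<Rightarrow> bool" where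
  "kl_dominates n \<delta> \<delta>' \<longleftrightarrow>
     (\<forall>\<Theta> \<Sigma>. pos_def_matrix \<Sigma> \<longrightarrow> kl_risk n \<delta> \<Theta> \<Sigma> \<le> kl_risk n \<delta>' \<Theta> \<Sigma>) \<and>
     (\<exists>\<Theta> \<Sigma>. pos_def_matrix \<Sigma> \<and> kl_risk n \<delta> \<Theta> \<Sigma> < kl_risk n \<delta>' \<Theta> \<Sigma>)"

text \<open>
  \<open>S\<close> is invertible almost surely when $n \ge p$; the value of \<open>matrix_inv S\<close> on the
  remaining null set is immaterial.
\<close>

definition shrink_factor :: "real \<Rightarrow> real^'p^'m \<Rightarrow> real^'p^'p \<Rightarrow> real^'p^'p" where
  "shrink_factor \<beta> X S = matrix_inv (mat 1 + \<beta> *\<^sub>R (matrix_inv S ** (transpose X ** X)))"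

definition Theta_G :: "real \<Rightarrow> real \<Rightarrow> real^'p^'m \<Rightarrow> real^'p^'p \<Rightarrow> real^'p^'m" where
  "Theta_G \<alpha> \<beta> X S = X - \<alpha> *\<^sub>R (X ** shrink_factor \<beta> X S)"

definition Sigma_0 :: "nat \<Rightarrow> real^'p^'p \<Rightarrow> real^'p^'p" where
  "Sigma_0 n S = inverse (real n) *\<^sub>R S"

definition Sigma_G2 ::
    "nat \<Rightarrow> real \<Rightarrow> real \<Rightarrow> real^'p^'m \<Rightarrow> real^'p^'p \<Rightarrow> real^'p^'p" where
  "Sigma_G2 n \<alpha> \<beta> X S = Sigma_0 n S - \<alpha> *\<^sub>R (Sigma_0 n S ** shrink_factor \<beta> X S)"

end

theory Submission
  imports Defs "HOL-Computational_Algebra.Fundamental_Theorem_Algebra"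
begin

text \<open>
  Write \<open>S = Z\<^sup>T Z\<close> with an \<open>n \<times> p\<close> normal matrix \<open>Z\<close>, \<open>T = X\<^sup>T X\<close>, \<open>A = S + \<beta> T\<close>, \<open>R = A\<^sup>-\<^sup>1 S\<close>
  and \<open>Q = I - R = \<beta> A\<^sup>-\<^sup>1 T\<close>. The new estimators are \<open>X - \<alpha> X R\<close> and \<open>n\<^sup>-\<^sup>1 S (I - \<alpha> R)\<close>, and
  twice the difference of the losses is
    \<open>m (- (\<alpha>/n) tr (\<Sigma>\<^sup>-\<^sup>1 S R) - log |I - \<alpha> R|)
       - 2 \<alpha> tr ((X - \<Theta>) \<Sigma>\<^sup>-\<^sup>1 (X R)\<^sup>T) + \<alpha>\<^sup>2 tr (X R \<Sigma>\<^sup>-\<^sup>1 (X R)\<^sup>T)\<close>.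
  Each term with an unknown parameter is an inner product \<open>(Y - E Y) \<Sigma>\<^sup>-\<^sup>1 \<bullet> G Y\<close>, where \<open>Y\<close> is one
  of \<open>X\<close>, \<open>Z\<close> and the other one is held fixed; for the last term this uses \<open>\<beta> A\<^sup>-\<^sup>1 T = I - R\<close>,
  which turns a quadratic form in \<open>X\<close> into one in \<open>Z\<close> (\<open>quadratic_X_R\<close>). Stein's identity
  (\<open>matrix_normal_stein\<close>) replaces such a term by the divergence of \<open>G\<close>, computed in \<open>stein_ridge\<close>
  and \<open>stein_ridge_square\<close>. The fields need no exceptional set: the matrix that is held fixed
  has full column rank almost surely, because \<open>m, n \<ge> p\<close>, and this alone keeps \<open>A\<close> invertible
  while the other matrix varies. After this step no unknown parameter is left, and
  the difference of the risks is half the expectation of \<open>risk_kernel\<close>, a function of the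
  eigenvalues \<open>r\<^sub>i\<close> of \<open>R\<close>, which lie in \<open>(0, 1]\<close>.

  This function is negative at every sample (\<open>risk_kernel_eigenvalues_negative\<close>), so that the
  new estimator is strictly better for every \<open>(\<Theta>, \<Sigma>)\<close>. The logarithm is handled by
  \<open>- log (1 - \<alpha> r) \<le> \<alpha> r + \<alpha> \<lambda> r\<^sup>2\<close> with \<open>\<lambda> = (1 - \<alpha>)\<^sup>-\<^sup>1\<^sup>/\<^sup>2 - 1\<close>. The usual bound, with
  \<open>\<alpha> / (2 (1 - \<alpha>)) = \<lambda> (\<lambda> + 2) / 2\<close> in place of \<open>\<lambda>\<close>, would be too weak for eigenvalues near \<open>1\<close> when
  \<open>m\<close> is large compared with \<open>n\<close>. The assumption on \<open>\<alpha>, \<beta>\<close> then enters twice: it absorbs the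
  term \<open>\<alpha>\<^sup>2\<close>, and it gives \<open>m \<lambda> < 2 (m - p + 1)\<close>, which decides the sign.

  Comparing expectations requires that both losses are integrable, hence that
  \<open>E |log |S|| < \<infinity>\<close>; for \<open>n = p\<close> the density of \<open>S\<close> is unbounded near the singular matrices. Translating
  \<open>Z\<close> by \<open>t J\<close> with \<open>J\<^sup>T J = I\<close> makes \<open>|S|\<close> a monic polynomial in \<open>t\<close>, and for any monic
  polynomial \<open>q\<close> the negative part of \<open>log |q|\<close> has an integral bounded by a multiple of the degree;
  averaging over \<open>t \<in> [0, 1]\<close> gives the claim (\<open>nn_integral_neg_log_det_gram\<close>), and with it that
  \<open>S\<close> is almost surely invertible.
\<close>

section \<open>Matrix algebra\<close>

lemma bounded_bilinear_matrix_mult: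
  "bounded_bilinear ((**) :: real^'n^'m \<Rightarrow> real^'p^'n \<Rightarrow> real^'p^'m)"
proof -
  have "bilinear ((**) :: real^'n^'m \<Rightarrow> real^'p^'n \<Rightarrow> real^'p^'m)"
    unfolding bilinear_def
    by (auto intro!: linearI
        simp: matrix_matrix_mult_def vec_eq_iff sum.distrib algebra_simps sum_distrib_left)
  then show ?thesis by (simp add: bilinear_conv_bounded_bilinear)
qed

text \<open>
  The rules come in the order: sums, differences, negation, scalar factors, each on the left
  and on the right. Several proofs select them by position.
\<close>

lemmas matrix_mult_bilinear =
  bounded_bilinear.add_left[OF bounded_bilinear_matrix_mult]
  bounded_bilinear.add_right[OF bounded_bilinear_matrix_mult]
  bounded_bilinear.diff_left[OF bounded_bilinear_matrix_mult]
  bounded_bilinear.diff_right[OF bounded_bilinear_matrix_mult]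
  bounded_bilinear.minus_left[OF bounded_bilinear_matrix_mult]
  bounded_bilinear.minus_right[OF bounded_bilinear_matrix_mult]
  bounded_bilinear.scaleR_left[OF bounded_bilinear_matrix_mult]
  bounded_bilinear.scaleR_right[OF bounded_bilinear_matrix_mult]

lemma transpose_plus: "transpose (A + B :: real^'n^'m) = transpose A + transpose B"
  by (simp add: transpose_def vec_eq_iff)

lemma bounded_linear_transpose: "bounded_linear (transpose :: real^'n^'m \<Rightarrow> real^'m^'n)"
  by (intro linear_conv_bounded_linear[THEN iffD1] linearI)
     (simp_all add: transpose_plus transpose_scalar)

lemma bounded_linear_trace: "bounded_linear (trace :: real^'n^'n \<Rightarrow> real)"
  by (intro linear_conv_bounded_linear[THEN iffD1] linearI)
     (simp_all add: trace_def sum.distrib sum_distrib_left)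

lemmas trace_linear =
  linear_add[OF bounded_linear.linear[OF bounded_linear_trace]]
  linear_diff[OF bounded_linear.linear[OF bounded_linear_trace]]
  linear_cmul[OF bounded_linear.linear[OF bounded_linear_trace]]

lemmas continuous_on_matrix [continuous_intros] =
  bounded_bilinear.continuous_on[OF bounded_bilinear_matrix_mult]
  bounded_linear.continuous_on[OF bounded_linear_transpose]
  bounded_linear.continuous_on[OF bounded_linear_trace]

text \<open>
  The Frobenius inner product is the inner product of the type \<open>real^'p^'m\<close>, so that all
  traces that occur in the loss can be treated as inner products of matrices.
\<close>

lemma inner_matrix_eq_trace: "(A :: real^'p^'m) \<bullet> B = trace (transpose A ** B)"
  unfolding inner_vec_def trace_def matrix_matrix_mult_def transpose_def
  by (simp, subst sum.swap, simp)

lemma inner_matrix_mult_right: "((A :: real^'n^'m) ** (B :: real^'p^'n)) \<bullet> C = A \<bullet> (C ** transpose B)"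
proof -
  have "trace (transpose B ** (transpose A ** C)) = trace ((transpose A ** C) ** transpose B)"
    by (rule trace_mul_sym)
  then show ?thesis by (simp add: inner_matrix_eq_trace matrix_transpose_mul matrix_mul_assoc)
qed

lemma matrix_inv_left: "invertible (A::real^'n^'n) \<Longrightarrow> matrix_inv A ** A = mat 1"
  and matrix_inv_right: "invertible (A::real^'n^'n) \<Longrightarrow> A ** matrix_inv A = mat 1"
  unfolding invertible_def matrix_inv_def by (metis (mono_tags, lifting) someI_ex)+

lemma matrix_inv_eqI: "(A::real^'n^'n) ** B = mat 1 \<Longrightarrow> matrix_inv A = B"
  by (metis invertible_right_inverse matrix_inv_left matrix_mul_assoc matrix_mul_lid matrix_mul_rid)

lemma invertible_imp_kernel_trivial:
  assumes "invertible (A :: real^'n^'n)" "x \<noteq> 0" shows "A *v x \<noteq> 0"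
  using matrix_inv_left[OF assms(1)] assms(2)
  by (metis matrix_vector_mul_assoc matrix_vector_mul_lid matrix_vector_mult_0_right)

lemma pos_def_matrix_symmetric: "pos_def_matrix A \<Longrightarrow> transpose A = A"
  by (simp add: pos_def_matrix_def)

lemma pos_def_matrix_add_semidef:
  assumes "pos_def_matrix A" "transpose B = B" "\<And>x. 0 \<le> x \<bullet> (B *v x)"
  shows "pos_def_matrix (A + B)"
  using assms
  by (auto simp: pos_def_matrix_def transpose_plus matrix_vector_mult_add_rdistrib inner_add_right add_pos_nonneg)

lemma pos_def_matrix_scaleR: "pos_def_matrix A \<Longrightarrow> 0 < c \<Longrightarrow> pos_def_matrix (c *\<^sub>R A)"
  by (auto simp: pos_def_matrix_def transpose_scalar scaleR_matrix_vector_assoc[symmetric])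

lemma inner_congruence:
  fixes B :: "real^'p^'n" and M :: "real^'n^'n"
  shows "x \<bullet> ((transpose B ** M ** B) *v y) = (B *v x) \<bullet> (M *v (B *v y))"
proof -
  have "x \<bullet> (transpose B *v w) = (B *v x) \<bullet> w" for w
    using dot_lmul_matrix[of w B x] by (simp add: inner_commute)
  then show ?thesis by (simp only: matrix_vector_mul_assoc[symmetric])
qed

abbreviation gram :: "real^'p^'n \<Rightarrow> real^'p^'p" where
  "gram Z \<equiv> transpose Z ** Z"

lemma inner_gram: "x \<bullet> (gram Z *v x) = (norm ((Z::real^'p^'n) *v x))\<^sup>2"
  using inner_congruence[of x Z "mat 1" x] by (simp add: power2_norm_eq_inner)

lemma inner_gram_nonneg: "0 \<le> x \<bullet> (gram Z *v (x::real^'p))" for Z :: "real^'p^'n"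
  by (simp only: inner_gram zero_le_power2)

lemma transpose_gram: "transpose (gram Z) = gram (Z::real^'p^'n)"
  by (simp add: matrix_transpose_mul)

lemma pos_def_matrix_invertible: 
  assumes "pos_def_matrix A" shows "invertible A"
proof -
  have "\<And>x. A *v x = 0 \<Longrightarrow> x = 0" using assms unfolding pos_def_matrix_def by (metis inner_zero_right less_irrefl)
  then show ?thesis using matrix_left_invertible_ker invertible_left_inverse by blast
qed

lemma pos_def_matrix_gram:
  assumes "invertible (gram Z)" shows "pos_def_matrix (transpose Z ** (Z::real^'p^'n))"
proof -
  have "x \<noteq> 0 \<Longrightarrow> Z *v x \<noteq> 0" for x
    using invertible_imp_kernel_trivial[OF assms]
    by (metis matrix_vector_mul_assoc matrix_vector_mult_0_right)
  then show ?thesis unfolding pos_def_matrix_def transpose_gram inner_gram by auto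
qed

lemma pos_def_matrix_congruence:
  fixes A C :: "real^'p^'p"
  assumes "pos_def_matrix A" "invertible C"
  shows "pos_def_matrix (transpose C ** A ** C)"
proof -
  have 1: "x \<bullet> ((transpose C ** A ** C) *v x) = (C *v x) \<bullet> (A *v (C *v x))" for x
    by (rule inner_congruence)
  have "x \<noteq> 0 \<Longrightarrow> C *v x \<noteq> 0" for x
    by (rule invertible_imp_kernel_trivial[OF assms(2)])
  then show ?thesis using assms(1)
    unfolding pos_def_matrix_def 1 by (auto simp: matrix_transpose_mul matrix_mul_assoc)
qed

section \<open>Simultaneous diagonalization\<close>

definition diagonal :: "real^'p \<Rightarrow> real^'p^'p" where
  "diagonal r = (\<chi> i j. if i = j then r $ i else 0)"

lemma quadratic_nonneg_imp_zero:
  fixes b c :: real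
  assumes "\<And>t. 0 \<le> 2 * t * b + t\<^sup>2 * c"
  shows "b = 0"
proof (rule ccontr)
  assume b: "b \<noteq> 0"
  define k where "k = \<bar>c\<bar> + 1"
  have k: "0 < k" "c \<le> k" by (auto simp: k_def)
  define t where "t = - b / k"
  have "2 * t * b + t\<^sup>2 * c \<le> 2 * t * b + t\<^sup>2 * k"
    using k by (intro add_left_mono mult_left_mono) auto
  also have "\<dots> = - b\<^sup>2 / k"
    unfolding t_def power2_eq_square using k by (simp add: field_simps)
  also have "\<dots> < 0" using b k by (simp add: divide_neg_pos)
  finally show False using assms[of t] by simp
qed

lemma symmetric_matrix_inner: "transpose A = A \<Longrightarrow> x \<bullet> (A *v y) = (A *v x) \<bullet> (y::real^'p)"
  by (metis dot_lmul_matrix transpose_matrix_vector)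

text \<open>
  A maximizer of the Rayleigh quotient of \<open>S\<close> relative to \<open>A\<close>, over the \<open>A\<close>-orthogonal
  complement of the eigenvectors found so far, is a further eigenvector: the first variation
  vanishes in the directions of the complement because the maximum is attained, and in the
  directions of the old eigenvectors by \<open>A\<close>-orthogonality.
\<close>

lemma exists_generalized_eigenvector:
  fixes A S :: "real^'p^'p"
  assumes A: "pos_def_matrix A" and S: "transpose S = S"
    and I: "finite I" "card I < CARD('p)"
    and eig: "\<And>i. i \<in> I \<Longrightarrow> S *v v i = r i *\<^sub>R (A *v v i)"
    and orth: "\<And>i j. i \<in> I \<Longrightarrow> j \<in> I \<Longrightarrow> v i \<bullet> (A *v v j) = (if i = j then 1 else 0)"
  shows "\<exists>x c. S *v x = c *\<^sub>R (A *v x) \<and> x \<bullet> (A *v x) = 1 \<and> (\<forall>i\<in>I. x \<bullet> (A *v v i) = 0)"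
proof -
  note At = pos_def_matrix_symmetric[OF A]
  have Apos: "x \<noteq> 0 \<Longrightarrow> 0 < x \<bullet> (A *v x)" for x using A by (simp add: pos_def_matrix_def)
  define V where "V = {x. \<forall>i\<in>I. x \<bullet> (A *v v i) = 0}"
  have Vsub: "subspace V" unfolding V_def subspace_def by (auto simp: inner_add_left)
  have "dim ((\<lambda>i. A *v v i) ` I) \<le> card ((\<lambda>i. A *v v i) ` I)" using I by (intro dim_le_card') auto
  also have "\<dots> \<le> card I" using I card_image_le by blast
  also have "\<dots> < DIM(real^'p)" using I by simp
  finally obtain x1 where x1: "x1 \<noteq> 0" "\<And>y. y \<in> span ((\<lambda>i. A *v v i) ` I) \<Longrightarrow> orthogonal x1 y"
    using orthogonal_to_subspace_exists by blast
  have x1V: "x1 \<in> V" unfolding V_def using x1(2) by (auto simp: orthogonal_def span_base)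
  define K where "K = V \<inter> sphere 0 1"
  have "compact K" unfolding K_def
    using closed_subspace[OF Vsub] compact_sphere by (simp add: closed_Int_compact)
  moreover have "(1 / norm x1) *\<^sub>R x1 \<in> K" unfolding K_def
    using x1(1) x1V Vsub subspace_scale by (auto simp: subspace_scale)
  then have "K \<noteq> {}" by auto
  moreover have "continuous_on K (\<lambda>x. (x \<bullet> (S *v x)) / (x \<bullet> (A *v x)))"
  proof (intro continuous_intros linear_continuous_on linear_linear[THEN iffD1] ballI)
    fix x assume "x \<in> K"
    then have "x \<noteq> 0" by (auto simp: K_def)
    then show "x \<bullet> (A *v x) \<noteq> 0" using Apos[of x] by simp
  qed
  ultimately have "\<exists>x\<in>K. \<forall>y\<in>K. (y \<bullet> (S *v y)) / (y \<bullet> (A *v y)) \<le> (x \<bullet> (S *v x)) / (x \<bullet> (A *v x))"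
    by (rule continuous_attains_sup)
  then obtain x0 where x0: "x0 \<in> K"
    and max: "\<And>y. y \<in> K \<Longrightarrow> (y \<bullet> (S *v y)) / (y \<bullet> (A *v y)) \<le> (x0 \<bullet> (S *v x0)) / (x0 \<bullet> (A *v x0))"
    by blast
  define c where "c = (x0 \<bullet> (S *v x0)) / (x0 \<bullet> (A *v x0))"
  have x0n: "x0 \<noteq> 0" "x0 \<in> V" using x0 unfolding K_def by auto
  have le: "y \<bullet> (S *v y) \<le> c * (y \<bullet> (A *v y))" if "y \<in> V" for y
  proof (cases "y = 0")
    case False
    let ?y = "(1 / norm y) *\<^sub>R y"
    have "?y \<in> K" unfolding K_def using False that Vsub by (auto simp: subspace_scale)
    from max[OF this] have "(y \<bullet> (S *v y)) / (y \<bullet> (A *v y)) \<le> c"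
      using False by (simp add: c_def matrix_vector_mult_scaleR)
    then show ?thesis using Apos[OF False] by (simp add: divide_le_eq)
  qed simp
  have eq0: "x0 \<bullet> (S *v x0) = c * (x0 \<bullet> (A *v x0))" unfolding c_def using Apos[OF x0n(1)] by simp
  have zV: "y \<bullet> (c *\<^sub>R (A *v x0) - S *v x0) = 0" if y: "y \<in> V" for y
  proof (rule quadratic_nonneg_imp_zero)
    fix t :: real
    have "x0 + t *\<^sub>R y \<in> V" using x0n y Vsub by (simp add: subspace_add subspace_scale)
    \<comment> \<open>The form \<open>c A - S\<close> is nonnegative on \<open>V\<close> and vanishes at \<open>x0\<close>; expand it at \<open>x0 + t y\<close>.\<close>
    from le[OF this] show "0 \<le> 2 * t * (y \<bullet> (c *\<^sub>R (A *v x0) - S *v x0)) + t\<^sup>2 * (c * (y \<bullet> (A *v y)) - y \<bullet> (S *v y))"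
      using eq0 symmetric_matrix_inner[OF S, of x0 y] symmetric_matrix_inner[OF At, of x0 y]
      by (simp add: matrix_vector_right_distrib matrix_vector_mult_scaleR inner_add_left inner_add_right
        inner_diff_right power2_eq_square algebra_simps inner_commute)
  qed
  have zI: "v i \<bullet> (c *\<^sub>R (A *v x0) - S *v x0) = 0" if i: "i \<in> I" for i
  proof -
    have "x0 \<bullet> (A *v v i) = 0" using x0n i by (auto simp: V_def)
    moreover have "v i \<bullet> (A *v x0) = x0 \<bullet> (A *v v i)"
      using symmetric_matrix_inner[OF At] by (metis inner_commute)
    moreover have "v i \<bullet> (S *v x0) = x0 \<bullet> (S *v v i)"
      using symmetric_matrix_inner[OF S] by (metis inner_commute)
    ultimately show ?thesis by (simp add: inner_diff_right eig[OF i])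
  qed
  have "y \<bullet> (c *\<^sub>R (A *v x0) - S *v x0) = 0" for y
  proof -
    \<comment> \<open>Split \<open>y\<close> into its \<open>A\<close>-orthogonal projection \<open>z\<close> to the old eigenvectors and a rest in \<open>V\<close>.\<close>
    define z where "z = (\<Sum>i\<in>I. (y \<bullet> (A *v v i)) *\<^sub>R v i)"
    have "z \<bullet> (A *v v i) = y \<bullet> (A *v v i)" if "i \<in> I" for i
    proof -
      have "z \<bullet> (A *v v i) = (\<Sum>k\<in>I. (y \<bullet> (A *v v k)) * (v k \<bullet> (A *v v i)))"
        by (simp add: z_def inner_sum_left)
      also have "\<dots> = (\<Sum>k\<in>I. if k = i then y \<bullet> (A *v v k) else 0)"
        by (rule sum.cong) (use orth that in auto)
      also have "\<dots> = y \<bullet> (A *v v i)" using I(1) that by simp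
      finally show ?thesis .
    qed
    then have "y - z \<in> V" by (simp add: V_def inner_diff_left)
    then have "(y - z) \<bullet> (c *\<^sub>R (A *v x0) - S *v x0) = 0" by (rule zV)
    moreover have "z \<bullet> (c *\<^sub>R (A *v x0) - S *v x0) = 0"
      unfolding z_def inner_sum_left using zI by (simp del: inner_diff_right)
    ultimately show ?thesis by (simp add: inner_diff_left)
  qed
  then have e0: "S *v x0 = c *\<^sub>R (A *v x0)" by (metis eq_iff_diff_eq_0 inner_eq_zero_iff)
  define s where "s = 1 / sqrt (x0 \<bullet> (A *v x0))"
  have s2: "s * (s * (x0 \<bullet> (A *v x0))) = 1" unfolding s_def using Apos[OF x0n(1)] by simp
  have "S *v (s *\<^sub>R x0) = c *\<^sub>R (A *v (s *\<^sub>R x0))" by (simp add: matrix_vector_mult_scaleR e0)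
  moreover have "(s *\<^sub>R x0) \<bullet> (A *v (s *\<^sub>R x0)) = 1" using s2 by (simp add: matrix_vector_mult_scaleR)
  moreover have "\<forall>i\<in>I. (s *\<^sub>R x0) \<bullet> (A *v v i) = 0" using x0n(2) by (simp add: V_def)
  ultimately show ?thesis by blast
qed

text \<open>
  The columns of \<open>B\<^sup>-\<^sup>1\<close> are an \<open>A\<close>-orthonormal basis of generalized eigenvectors, obtained one
  at a time. With \<open>A\<close> the identity this is the spectral theorem; in general it diagonalizes
  two forms by the same congruence, which is what makes \<open>A\<^sup>-\<^sup>1 S\<close> similar to a diagonal matrix.
\<close>

lemma simultaneous_diagonalization:
  fixes A S :: "real^'p^'p"
  assumes A: "pos_def_matrix A" and S: "transpose S = S"
  obtains B :: "real^'p^'p" and r where "invertible B" "A = transpose B ** B" "S = transpose B ** diagonal r ** B"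
proof -
  note At = pos_def_matrix_symmetric[OF A]
  have "\<exists>v r. (\<forall>i\<in>I. S *v v i = r i *\<^sub>R (A *v v i)) \<and>
      (\<forall>i\<in>I. \<forall>j\<in>I. v i \<bullet> (A *v v j) = (if i = j then 1 else 0))" if "finite I" for I :: "'p set"
    using that
  proof (induction I)
    case empty
    then show ?case by auto
  next
    case (insert k I)
    then obtain v r where e: "\<And>i. i \<in> I \<Longrightarrow> S *v v i = r i *\<^sub>R (A *v v i)"
      and o: "\<And>i j. i \<in> I \<Longrightarrow> j \<in> I \<Longrightarrow> v i \<bullet> (A *v v j) = (if i = j then 1 else 0)" by blast
    have "I \<noteq> UNIV" using insert by auto
    then have "card I < CARD('p)" by (metis finite psubset_card_mono top.not_eq_extremum)
    from exists_generalized_eigenvector[OF A S insert(1) this e o] obtain x c where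
      x: "S *v x = c *\<^sub>R (A *v x)" "x \<bullet> (A *v x) = 1" "\<forall>i\<in>I. x \<bullet> (A *v v i) = 0" by blast
    have x': "\<forall>i\<in>I. v i \<bullet> (A *v x) = 0" using x(3) symmetric_matrix_inner[OF At] by (metis inner_commute)
    show ?case
      by (rule exI[of _ "v(k := x)"], rule exI[of _ "r(k := c)"])
        (use insert(2) e o x x' in \<open>auto\<close>)
  qed
  from this[of UNIV, OF finite] obtain v :: "'p \<Rightarrow> real^'p" and r where vr: "(\<forall>i\<in>UNIV. S *v v i = r i *\<^sub>R (A *v v i)) \<and>
    (\<forall>i\<in>UNIV. \<forall>j\<in>UNIV. v i \<bullet> (A *v v j) = (if i = j then 1 else 0))" by (elim exE)
  have e: "S *v v i = r i *\<^sub>R (A *v v i)" for i using conjunct1[OF vr] by (rule bspec) simp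
  have o: "v i \<bullet> (A *v v j) = (if i = j then 1 else 0)" for i j
    using bspec[OF bspec[OF conjunct2[OF vr], OF UNIV_I], OF UNIV_I] .
  define C :: "real^'p^'p" where "C = (\<chi> i j. v j $ i)"
  have Cc: "(C :: real^'p^'p) *v axis j 1 = v j" for j
    unfolding C_def matrix_vector_mult_basis by (simp add: column_def vec_eq_iff)
  have ent: "(transpose C ** M ** C) $ i $ j = v i \<bullet> (M *v v j)" for M i j
  proof -
    have "(transpose C ** M ** C) $ i $ j = axis i 1 \<bullet> ((transpose C ** M ** C) *v axis j 1)"
      by (simp add: inner_axis' matrix_vector_mult_basis column_def)
    also have "\<dots> = v i \<bullet> (M *v v j)"
      by (simp only: inner_congruence Cc)
    finally show ?thesis .
  qed
  have CA: "transpose C ** A ** C = mat 1" by (simp add: vec_eq_iff ent o mat_def)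
  have CS: "transpose C ** S ** C = diagonal (\<chi> i. r i)"
    by (simp add: vec_eq_iff ent e o diagonal_def)
  have Ci: "invertible C" using CA invertible_left_inverse by blast
  define B where "B = matrix_inv C"
  have BC: "B ** C = mat 1" "C ** B = mat 1"
    unfolding B_def using matrix_inv_left[OF Ci] matrix_inv_right[OF Ci] .
  have BCt: "transpose B ** transpose C = mat 1" by (metis BC(2) matrix_transpose_mul transpose_mat)
  have recover: "M = transpose B ** (transpose C ** M ** C) ** B" for M
    by (simp add: matrix_mul_assoc BCt) (simp add: matrix_mul_assoc[symmetric] BC)
  show thesis
  proof (rule that[of B "\<chi> i. r i"])
    show "invertible B" using BC invertible_left_inverse by blast
    show "A = transpose B ** B" using recover[of A] by (simp add: CA)
    show "S = transpose B ** diagonal (\<chi> i. r i) ** B" using recover[of S] by (simp add: CS)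
  qed
qed

lemma sum_if_eq_mult: "(\<Sum>k\<in>UNIV. (if i = k then c else 0) * f k) = c * (f i :: real)" for i :: "'p::finite"
proof -
  have "(\<Sum>k\<in>UNIV. (if i = k then c else 0) * f k) = (\<Sum>k\<in>UNIV. if k = i then c * f i else 0)"
    by (rule sum.cong) auto
  then show ?thesis by simp
qed

lemma diagonal_mult: "diagonal a ** diagonal b = diagonal (\<chi> i. a $ i * b $ i)"
  by (simp add: diagonal_def matrix_matrix_mult_def vec_eq_iff sum_if_eq_mult)

lemma diagonal_mult_vector: "diagonal r *v x = (\<chi> i. r $ i * x $ i)"
  by (simp add: diagonal_def matrix_vector_mult_def vec_eq_iff sum_if_eq_mult)

lemma trace_diagonal: "trace (diagonal a) = (\<Sum>i\<in>UNIV. a $ i)"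
  by (simp add: trace_def diagonal_def)

lemma det_diagonal_eq: "det (diagonal a) = (\<Prod>i\<in>UNIV. a $ i)"
  by (subst det_diagonal) (auto simp: diagonal_def)

lemma diagonal_one: "diagonal (\<chi> i. 1) = mat 1"
  by (simp add: diagonal_def mat_def vec_eq_iff)

lemma diagonal_diff: "diagonal a - diagonal b = diagonal (a - b)"
  by (auto simp: diagonal_def vec_eq_iff)

lemma inner_diagonal_congruence:
  fixes B :: "real^'p^'p"
  shows "x \<bullet> ((transpose B ** diagonal r ** B) *v x) = (\<Sum>i\<in>UNIV. r $ i * ((B *v x) $ i)\<^sup>2)"
proof -
  have "x \<bullet> ((transpose B ** diagonal r ** B) *v x) = (B *v x) \<bullet> (diagonal r *v (B *v x))"
    by (rule inner_congruence)
  also note diagonal_mult_vector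
  finally show ?thesis by (simp add: inner_vec_def power2_eq_square algebra_simps)
qed

text \<open>
  The vector is the \<open>i\<close>-th column of \<open>B\<^sup>-\<^sup>1\<close>; testing with it reads off the sign of a diagonal
  entry from the sign of the quadratic form.
\<close>

lemma quadratic_form_diagonal_coeff:
  fixes B :: "real^'p^'p"
  assumes "invertible B"
  obtains x where "x \<noteq> 0" "x \<bullet> ((transpose B ** diagonal r ** B) *v x) = r $ i"
proof
  let ?x = "matrix_inv B *v axis i 1"
  have Bx: "B *v ?x = axis i 1" by (simp add: matrix_vector_mul_assoc matrix_inv_right[OF assms])
  have "axis i (1::real) \<noteq> 0" by (simp add: axis_eq_0_iff)
  then show "?x \<noteq> 0" using Bx by (metis matrix_vector_mult_0_right)
  show "?x \<bullet> ((transpose B ** diagonal r ** B) *v ?x) = r $ i"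
    unfolding inner_diagonal_congruence Bx
    using sum_if_eq_mult[of i 1 "\<lambda>k. r $ k"] by (simp add: axis_def if_distrib[of "\<lambda>x. x\<^sup>2"] mult.commute eq_commute[of i] cong: if_cong)
qed

lemma pos_def_matrix_diagonal:
  fixes B :: "real^'p^'p"
  assumes "invertible B"
  shows "pos_def_matrix (transpose B ** diagonal r ** B) \<longleftrightarrow> (\<forall>i. 0 < r $ i)"
proof
  assume "pos_def_matrix (transpose B ** diagonal r ** B)"
  then have pos: "x \<noteq> 0 \<Longrightarrow> 0 < x \<bullet> ((transpose B ** diagonal r ** B) *v x)" for x
    by (simp add: pos_def_matrix_def)
  show "\<forall>i. 0 < r $ i"
  proof
    fix i
    obtain x where "x \<noteq> 0" "x \<bullet> ((transpose B ** diagonal r ** B) *v x) = r $ i"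
      by (rule quadratic_form_diagonal_coeff[OF assms])
    then show "0 < r $ i" using pos[of x] by simp
  qed
next
  assume r: "\<forall>i. 0 < r $ i"
  have "transpose (diagonal r) = diagonal r" by (auto simp: diagonal_def transpose_def vec_eq_iff)
  then have "transpose (transpose B ** diagonal r ** B) = transpose B ** diagonal r ** B"
    by (simp add: matrix_transpose_mul matrix_mul_assoc)
  moreover have "0 < x \<bullet> ((transpose B ** diagonal r ** B) *v x)" if "x \<noteq> 0" for x
  proof -
    have "B *v x \<noteq> 0" by (rule invertible_imp_kernel_trivial[OF assms that])
    then obtain i where "(B *v x) $ i \<noteq> 0" by (auto simp: vec_eq_iff)
    then show ?thesis unfolding inner_diagonal_congruence
      by (intro sum_pos2[of UNIV i]) (use r in \<open>auto simp: less_imp_le\<close>)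
  qed
  ultimately show "pos_def_matrix (transpose B ** diagonal r ** B)" by (simp add: pos_def_matrix_def)
qed

text \<open>
  Diagonalizing \<open>S\<close> relative to \<open>S + P\<close> diagonalizes \<open>P\<close> as well, with the complementary
  entries. That \<open>P\<close> is positive semidefinite is what bounds the eigenvalues by \<open>1\<close>.
\<close>

lemma pencil_diagonalization:
  fixes S P :: "real^'p^'p"
  assumes S: "pos_def_matrix S" and P: "transpose P = P" "\<And>x. 0 \<le> x \<bullet> (P *v x)"
  obtains B :: "real^'p^'p" and r where "invertible B" "S + P = transpose B ** B"
    "S = transpose B ** diagonal r ** B" "P = transpose B ** diagonal (\<chi> i. 1 - r $ i) ** B"
    "\<And>i. 0 < r $ i" "\<And>i. r $ i \<le> 1"
proof -
  have "pos_def_matrix (S + P)" using assms by (intro pos_def_matrix_add_semidef)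
  from simultaneous_diagonalization[OF this pos_def_matrix_symmetric[OF S]]
  obtain B :: "real^'p^'p" and r where B: "invertible B" "S + P = transpose B ** B" "S = transpose B ** diagonal r ** B" by blast
  have "P = transpose B ** B - transpose B ** diagonal r ** B" unfolding B(2)[symmetric] B(3)[symmetric] by simp
  also have "\<dots> = transpose B ** (diagonal (\<chi> i. 1) - diagonal r) ** B"
    by (simp add: matrix_mult_bilinear diagonal_one)
  also have "diagonal (\<chi> i. 1) - diagonal r = diagonal (\<chi> i. 1 - r $ i)"
    by (simp add: diagonal_diff) (simp add: minus_vec_def)
  finally have PB: "P = transpose B ** diagonal (\<chi> i. 1 - r $ i) ** B" .
  have r1: "r $ i \<le> 1" for i
  proof -
    obtain x where "x \<bullet> (P *v x) = (\<chi> i. 1 - r $ i) $ i" unfolding PB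
      by (rule quadratic_form_diagonal_coeff[OF B(1)])
    then show ?thesis using P(2)[of x] by simp
  qed
  have r0: "0 < r $ i" for i using S unfolding B(3) pos_def_matrix_diagonal[OF B(1)] by blast
  show thesis by (rule that[OF B PB r0 r1])
qed

lemma matrix_inv_gram:
  fixes B :: "real^'p^'p"
  assumes "invertible B"
  shows "matrix_inv (gram B) = matrix_inv B ** transpose (matrix_inv B)"
proof (rule matrix_inv_eqI)
  have "transpose B ** B ** (matrix_inv B ** transpose (matrix_inv B))
      = transpose B ** (B ** matrix_inv B) ** transpose (matrix_inv B)" by (simp add: matrix_mul_assoc)
  also have "\<dots> = transpose (matrix_inv B ** B)" by (simp add: matrix_inv_right[OF assms] matrix_transpose_mul)
  finally show "transpose B ** B ** (matrix_inv B ** transpose (matrix_inv B)) = mat 1"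
    by (simp add: matrix_inv_left[OF assms])
qed

lemma matrix_inv_gram_mult_diagonal:
  fixes B :: "real^'p^'p"
  assumes "invertible B"
  shows "matrix_inv (gram B) ** (transpose B ** diagonal r ** B) = matrix_inv B ** diagonal r ** B"
proof -
  have "transpose (matrix_inv B) ** transpose B = mat 1"
    by (metis matrix_inv_right[OF assms] matrix_transpose_mul transpose_mat)
  moreover have "matrix_inv (gram B) ** (transpose B ** diagonal r ** B) =
    matrix_inv B ** (transpose (matrix_inv B) ** transpose B) ** diagonal r ** B"
    unfolding matrix_inv_gram[OF assms] by (simp add: matrix_mul_assoc)
  ultimately show ?thesis by simp
qed

lemma similar_diagonal_mult:
  fixes B :: "real^'p^'p"
  assumes "invertible B"
  shows "(matrix_inv B ** diagonal a ** B) ** (matrix_inv B ** diagonal b ** B)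
    = matrix_inv B ** diagonal (\<chi> i. a $ i * b $ i) ** B"
proof -
  have "(matrix_inv B ** diagonal a ** B) ** (matrix_inv B ** diagonal b ** B)
    = matrix_inv B ** diagonal a ** (B ** matrix_inv B) ** diagonal b ** B" by (simp add: matrix_mul_assoc)
  then show ?thesis by (simp add: matrix_inv_right[OF assms] matrix_mul_assoc[symmetric] diagonal_mult)
qed

lemma trace_similar_diagonal:
  fixes B :: "real^'p^'p"
  assumes "invertible B"
  shows "trace (matrix_inv B ** diagonal a ** B) = (\<Sum>i\<in>UNIV. a $ i)"
  using trace_mul_sym[of "matrix_inv B ** diagonal a" B]
  by (simp add: matrix_mul_assoc matrix_inv_right[OF assms] trace_diagonal)

section \<open>Regularity of the matrix inverse\<close>

lemma continuous_on_det:
  fixes M :: "'a::topological_space \<Rightarrow> real^'p^'p"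
  assumes "\<And>i j. continuous_on T (\<lambda>x. M x $ i $ j)"
  shows "continuous_on T (\<lambda>x. det (M x))"
  unfolding det_def by (intro continuous_intros assms)

lemma matrix_inv_cramer:
  fixes A :: "real^'p^'p"
  assumes "invertible A"
  shows "matrix_inv A = (\<chi> k l. det (\<chi> i j. if j = k then axis l 1 $ i else A $ i $ j) / det A)"
proof -
  have d: "det A \<noteq> 0" using assms by (simp add: invertible_det_nz)
  have "A *v (matrix_inv A *v axis l 1) = axis l 1" for l
    by (simp add: matrix_vector_mul_assoc matrix_inv_right[OF assms])
  then have "matrix_inv A *v axis l 1 = (\<chi> k. det (\<chi> i j. if j = k then axis l 1 $ i else A $ i $ j) / det A)" for l
    using cramer[OF d] by blast
  then have "column l (matrix_inv A) = (\<chi> k. det (\<chi> i j. if j = k then axis l 1 $ i else A $ i $ j) / det A)" for l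
    by (simp add: matrix_vector_mult_basis)
  then show ?thesis by (simp add: column_def vec_eq_iff)
qed

lemma continuous_on_matrix_inv:
  fixes M :: "'a::topological_space \<Rightarrow> real^'p^'p"
  assumes M: "continuous_on T M" and inv: "\<And>x. x \<in> T \<Longrightarrow> invertible (M x)"
  shows "continuous_on T (\<lambda>x. matrix_inv (M x))"
proof -
  have entries: "continuous_on T (\<lambda>x. M x $ i $ j)" for i j by (intro continuous_intros M)
  have "continuous_on T (\<lambda>x. det (\<chi> i j. if j = k then axis l 1 $ i else M x $ i $ j))" for k l :: 'p
  proof (rule continuous_on_det)
    show "continuous_on T (\<lambda>x. (\<chi> i j. if j = k then axis l 1 $ i else M x $ i $ j) $ a $ b)" for a b
      using entries by (cases "b = k") simp_all
  qed
  moreover have "continuous_on T (\<lambda>x. det (M x))" by (rule continuous_on_det[OF entries])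
  ultimately have "continuous_on T (\<lambda>x. (\<chi> k l. det (\<chi> i j. if j = k then axis l 1 $ i else M x $ i $ j) / det (M x)))"
    using inv by (intro continuous_on_vec_lambda continuous_on_divide) (auto simp: invertible_det_nz)
  then show ?thesis
    by (rule continuous_on_eq) (simp add: matrix_inv_cramer[OF inv])
qed

text \<open>
  The value of \<open>matrix_inv\<close> on singular matrices is a choice from the empty predicate, hence
  one constant. This makes \<open>matrix_inv\<close> Borel measurable on the whole space.
\<close>

lemma matrix_inv_singular:
  fixes A B :: "real^'p^'p"
  assumes "\<not> invertible A" "\<not> invertible B" shows "matrix_inv A = matrix_inv B"
proof -
  have "(\<lambda>C. A ** C = mat 1 \<and> C ** A = mat 1) = (\<lambda>C. B ** C = mat 1 \<and> C ** B = mat 1)"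
    using assms unfolding invertible_def by (intro ext) blast
  then show ?thesis unfolding matrix_inv_def by simp
qed

lemma open_invertible: "open {A :: real^'p^'p. invertible A}"
proof -
  have "continuous_on UNIV (det :: real^'p^'p \<Rightarrow> real)" by (intro continuous_on_det continuous_intros)
  then show ?thesis unfolding invertible_det_nz
    by (intro open_Collect_neq) (auto intro: continuous_intros)
qed

lemma borel_measurable_det [measurable]: "(det :: real^'p^'p \<Rightarrow> real) \<in> borel_measurable borel"
  by (intro borel_measurable_continuous_onI continuous_on_det continuous_intros)

lemma borel_measurable_matrix_inv [measurable]:
  "(matrix_inv :: real^'p^'p \<Rightarrow> real^'p^'p) \<in> borel_measurable borel"
proof -
  have "(matrix_inv :: real^'p^'p \<Rightarrow> real^'p^'p) = (\<lambda>A. if A \<in> {A. invertible A} then matrix_inv A else matrix_inv 0)"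
  proof (intro ext)
    fix A :: "real^'p^'p"
    have "\<not> invertible (0 :: real^'p^'p)" by (auto simp: invertible_def vec_eq_iff mat_def)
    then show "matrix_inv A = (if A \<in> {A. invertible A} then matrix_inv A else matrix_inv 0)"
      using matrix_inv_singular[of A 0] by simp
  qed
  also have "\<dots> \<in> borel_measurable borel"
    by (rule borel_measurable_continuous_on_if[OF borel_open[OF open_invertible]
          continuous_on_matrix_inv[OF continuous_on_id] continuous_on_const]) simp
  finally show ?thesis .
qed

lemma borel_measurable_matrix_mult [measurable]:
  fixes f :: "'a \<Rightarrow> real^'n^'m" and g :: "'a \<Rightarrow> real^'p^'n"
  assumes [measurable]: "f \<in> borel_measurable M" "g \<in> borel_measurable M"
  shows "(\<lambda>x. f x ** g x) \<in> borel_measurable M"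
  using assms by (rule borel_measurable_continuous_Pair) (intro continuous_intros)

lemma borel_measurable_transpose [measurable]:
  "(transpose :: real^'n^'m \<Rightarrow> real^'m^'n) \<in> borel_measurable borel"
  by (intro borel_measurable_continuous_onI continuous_intros)

lemma borel_measurable_trace [measurable]:
  "(trace :: real^'n^'n \<Rightarrow> real) \<in> borel_measurable borel"
  by (intro borel_measurable_continuous_onI continuous_intros)

lemma has_vector_derivative_quotientI:
  fixes f :: "real \<Rightarrow> 'a::real_normed_vector"
  assumes "((\<lambda>s. (1 / (s - t)) *\<^sub>R (f s - f t)) \<longlongrightarrow> D) (at t)"
  shows "(f has_vector_derivative D) (at t)"
proof -
  have "((\<lambda>s. norm ((1 / (s - t)) *\<^sub>R (f s - f t) - D)) \<longlongrightarrow> 0) (at t)"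
    using assms by (simp add: tendsto_norm_zero_iff Lim_null[symmetric])
  moreover have "\<forall>\<^sub>F s in at t. norm ((1 / (s - t)) *\<^sub>R (f s - f t) - D) = norm ((f s - f t) - (s - t) *\<^sub>R D) / norm (s - t)"
  proof (rule eventually_at_filter[THEN iffD2], rule always_eventually, intro allI impI)
    fix s assume "s \<noteq> t"
    then have "(1 / (s - t)) *\<^sub>R (f s - f t) - D = (1 / (s - t)) *\<^sub>R ((f s - f t) - (s - t) *\<^sub>R D)"
      by (simp add: scaleR_diff_right)
    then show "norm ((1 / (s - t)) *\<^sub>R (f s - f t) - D) = norm ((f s - f t) - (s - t) *\<^sub>R D) / norm (s - t)"
      by simp
  qed
  ultimately have "((\<lambda>s. norm ((f s - f t) - (s - t) *\<^sub>R D) / norm (s - t)) \<longlongrightarrow> 0) (at t)"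
    by (rule Lim_transform_eventually)
  then show ?thesis unfolding has_vector_derivative_def has_derivative_iff_norm
    by (simp add: bounded_linear_scaleR_left)
qed

lemma matrix_inv_diff:
  fixes A B :: "real^'p^'p"
  assumes "invertible A" "invertible B"
  shows "matrix_inv A - matrix_inv B = - (matrix_inv A ** (A - B) ** matrix_inv B)"
proof -
  have "matrix_inv A ** (A - B) ** matrix_inv B = (matrix_inv A ** A) ** matrix_inv B - matrix_inv A ** (B ** matrix_inv B)"
    by (simp add: matrix_mult_bilinear matrix_mul_assoc)
  then show ?thesis by (simp add: matrix_inv_left[OF assms(1)] matrix_inv_right[OF assms(2)])
qed

text \<open>
  From \<open>M(s)\<^sup>-\<^sup>1 - M(t)\<^sup>-\<^sup>1 = - M(s)\<^sup>-\<^sup>1 (M(s) - M(t)) M(t)\<^sup>-\<^sup>1\<close> and the continuity of the inverse.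
\<close>

lemma has_vector_derivative_matrix_inv:
  fixes M :: "real \<Rightarrow> real^'p^'p"
  assumes der: "(M has_vector_derivative D) (at t)" and cont: "continuous_on UNIV M"
    and inv: "\<And>s. invertible (M s)"
  shows "((\<lambda>s. matrix_inv (M s)) has_vector_derivative - (matrix_inv (M t) ** D ** matrix_inv (M t))) (at t)"
proof (rule has_vector_derivative_quotientI)
  have "continuous_on UNIV (\<lambda>s. matrix_inv (M s))" by (intro continuous_on_matrix_inv cont inv)
  then have c: "((\<lambda>s. matrix_inv (M s)) \<longlongrightarrow> matrix_inv (M t)) (at t)"
    by (simp add: continuous_on_eq_continuous_at isCont_def)
  have q: "((\<lambda>s. (1 / (s - t)) *\<^sub>R (M s - M t)) \<longlongrightarrow> D) (at t)"
  proof -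
    have "((\<lambda>s. norm ((M s - M t) - (s - t) *\<^sub>R D) / norm (s - t)) \<longlongrightarrow> 0) (at t)"
      using der unfolding has_vector_derivative_def has_derivative_iff_norm by simp
    moreover have "\<forall>\<^sub>F s in at t. norm ((M s - M t) - (s - t) *\<^sub>R D) / norm (s - t) = norm ((1 / (s - t)) *\<^sub>R (M s - M t) - D)"
    proof (rule eventually_at_filter[THEN iffD2], rule always_eventually, intro allI impI)
      fix s assume "s \<noteq> t"
      then have "(1 / (s - t)) *\<^sub>R (M s - M t) - D = (1 / (s - t)) *\<^sub>R ((M s - M t) - (s - t) *\<^sub>R D)"
        by (simp add: scaleR_diff_right)
      then show "norm ((M s - M t) - (s - t) *\<^sub>R D) / norm (s - t) = norm ((1 / (s - t)) *\<^sub>R (M s - M t) - D)"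
        by simp
    qed
    ultimately have "((\<lambda>s. norm ((1 / (s - t)) *\<^sub>R (M s - M t) - D)) \<longlongrightarrow> 0) (at t)"
      by (rule Lim_transform_eventually)
    then show ?thesis by (simp add: tendsto_norm_zero_iff Lim_null[symmetric])
  qed
  have "((\<lambda>s. - (matrix_inv (M s) ** ((1 / (s - t)) *\<^sub>R (M s - M t)) ** matrix_inv (M t))) \<longlongrightarrow>
    - (matrix_inv (M t) ** D ** matrix_inv (M t))) (at t)"
    by (intro tendsto_intros bounded_bilinear.tendsto[OF bounded_bilinear_matrix_mult] c q)
  then show "((\<lambda>s. (1 / (s - t)) *\<^sub>R (matrix_inv (M s) - matrix_inv (M t))) \<longlongrightarrow>
    - (matrix_inv (M t) ** D ** matrix_inv (M t))) (at t)"
    by (simp only: matrix_inv_diff[OF inv inv] scaleR_minus_right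
        bounded_bilinear.scaleR_left[OF bounded_bilinear_matrix_mult]
        bounded_bilinear.scaleR_right[OF bounded_bilinear_matrix_mult])
qed

lemma power2_norm_matrix: "(norm (A :: real^'p^'m))\<^sup>2 = (\<Sum>i\<in>UNIV. \<Sum>j\<in>UNIV. (A $ i $ j)\<^sup>2)"
  by (simp only: power2_norm_eq_inner inner_vec_def) (simp add: power2_eq_square)

lemma norm_transpose: "norm (transpose (A :: real^'p^'m)) = norm A"
proof -
  have "(norm (transpose A))\<^sup>2 = (norm A)\<^sup>2"
    unfolding power2_norm_matrix by (subst sum.swap) (simp add: transpose_def)
  then show ?thesis by simp
qed

lemma norm_matrix_mult_le: "norm ((A :: real^'n^'m) ** (B :: real^'p^'n)) \<le> norm A * norm B"
proof (rule power2_le_imp_le)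
  have col: "(norm (column j B))\<^sup>2 = (\<Sum>i\<in>UNIV. (B $ i $ j)\<^sup>2)" for j
    by (simp only: power2_norm_eq_inner inner_vec_def) (simp add: column_def power2_eq_square)
  have "(norm (A ** B))\<^sup>2 = (\<Sum>i\<in>UNIV. \<Sum>j\<in>UNIV. (A $ i \<bullet> column j B)\<^sup>2)"
    unfolding power2_norm_matrix by (simp add: matrix_matrix_mult_def inner_vec_def column_def)
  also have "\<dots> \<le> (\<Sum>i\<in>UNIV. \<Sum>j\<in>UNIV. (norm (A $ i))\<^sup>2 * (norm (column j B))\<^sup>2)"
    by (intro sum_mono) (metis Cauchy_Schwarz_ineq power2_norm_eq_inner)
  also have "\<dots> = (\<Sum>i\<in>UNIV. (norm (A $ i))\<^sup>2) * (\<Sum>j\<in>UNIV. (norm (column j B))\<^sup>2)"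
    by (rule sum_product[symmetric])
  also have "(\<Sum>i\<in>UNIV. (norm (A $ i))\<^sup>2) = (norm A)\<^sup>2"
    by (simp add: power2_norm_eq_inner inner_vec_def)
  also have "(\<Sum>j\<in>UNIV. (norm (column j B))\<^sup>2) = (norm B)\<^sup>2"
    unfolding power2_norm_matrix col by (rule sum.swap)
  finally show "(norm (A ** B))\<^sup>2 \<le> (norm A * norm B)\<^sup>2" by (simp add: power_mult_distrib)
qed simp

lemma pos_def_matrix_coercive:
  fixes A :: "real^'p^'p"
  assumes "pos_def_matrix A"
  obtains c where "0 < c" "\<And>x. c * (norm x)\<^sup>2 \<le> x \<bullet> (A *v x)"
proof -
  let ?f = "\<lambda>x::real^'p. x \<bullet> (A *v x)"
  have "continuous_on (sphere 0 1) ?f"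
    by (intro continuous_intros linear_continuous_on linear_linear[THEN iffD1])
  moreover have "sphere (0::real^'p) 1 \<noteq> {}" by simp
  ultimately have "\<exists>x\<in>sphere 0 1. \<forall>y\<in>sphere 0 1. ?f x \<le> ?f y"
    by (intro continuous_attains_inf) auto
  then obtain x0 :: "real^'p" where x0: "x0 \<in> sphere 0 1" "\<And>y. y \<in> sphere 0 1 \<Longrightarrow> ?f x0 \<le> ?f y" by blast
  have "x0 \<noteq> 0" using x0(1) by auto
  then have "0 < ?f x0" using assms by (simp add: pos_def_matrix_def)
  moreover have "?f x0 * (norm x)\<^sup>2 \<le> ?f x" for x
  proof (cases "x = 0")
    case False
    let ?y = "(1 / norm x) *\<^sub>R x"
    have "?f x0 \<le> ?f ?y" using False by (intro x0(2)) auto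
    also have "?f ?y = ?f x / (norm x)\<^sup>2" by (simp add: matrix_vector_mult_scaleR power2_eq_square)
    finally show ?thesis using False by (simp add: le_divide_eq)
  qed simp
  ultimately show thesis by (rule that)
qed

lemma norm_matrix_le_entries: "norm (A :: real^'p^'m) \<le> (\<Sum>i\<in>UNIV. \<Sum>j\<in>UNIV. \<bar>A $ i $ j\<bar>)"
proof -
  have "norm A \<le> (\<Sum>i\<in>UNIV. norm (A $ i))" unfolding norm_vec_def by (rule L2_set_le_sum) auto
  also have "\<dots> \<le> (\<Sum>i\<in>UNIV. \<Sum>j\<in>UNIV. \<bar>A $ i $ j\<bar>)" by (intro sum_mono norm_le_l1_cart)
  finally show ?thesis .
qed

text \<open>
  If \<open>x\<close> is the \<open>j\<close>-th column of \<open>(S + P)\<^sup>-\<^sup>1\<close>, then \<open>c |x|\<^sup>2 \<le> x \<bullet> (S + P) x = x\<^sub>j \<le> |x|\<close>, where \<open>c\<close>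
  is a lower bound of the form \<open>P\<close> alone. The bound is uniform in \<open>S\<close>, so the fields below and their derivatives grow at most
  quadratically.
\<close>

lemma norm_matrix_inv_bounded:
  fixes P :: "real^'p^'p"
  assumes "pos_def_matrix P"
  obtains C where "0 \<le> C"
    "\<And>S. transpose S = S \<Longrightarrow> (\<And>x. 0 \<le> x \<bullet> (S *v x)) \<Longrightarrow> norm (matrix_inv (S + P)) \<le> C"
proof -
  obtain c where c: "0 < c" "\<And>x. c * (norm x)\<^sup>2 \<le> x \<bullet> (P *v x)" by (rule pos_def_matrix_coercive[OF assms]) blast
  show thesis
  proof (rule that[of "\<Sum>i\<in>(UNIV::'p set). \<Sum>j\<in>(UNIV::'p set). 1 / c"])
    show "0 \<le> (\<Sum>i\<in>(UNIV::'p set). \<Sum>j\<in>(UNIV::'p set). 1 / c)" using c by (intro sum_nonneg) auto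
    fix S :: "real^'p^'p" assume S: "transpose S = S" "\<And>x. 0 \<le> x \<bullet> (S *v x)"
    have "pos_def_matrix (P + S)" by (intro pos_def_matrix_add_semidef assms S)
    then have inv: "invertible (S + P)" by (simp add: pos_def_matrix_invertible add.commute)
    have "\<bar>matrix_inv (S + P) $ i $ j\<bar> \<le> 1 / c" for i j
    proof -
      define x where "x = matrix_inv (S + P) *v axis j 1"
      have "c * (norm x)\<^sup>2 \<le> x \<bullet> (P *v x)" by (rule c)
      also have "\<dots> \<le> x \<bullet> ((S + P) *v x)" using S(2)[of x] by (simp add: matrix_vector_mult_add_rdistrib inner_add_right)
      also have "(S + P) *v x = axis j 1" unfolding x_def by (simp add: matrix_vector_mul_assoc matrix_inv_right[OF inv])
      also have "x \<bullet> axis j 1 \<le> norm x" using norm_cauchy_schwarz[of x "axis j 1"] by simp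
      finally have "c * norm x * norm x \<le> norm x" by (simp add: power2_eq_square)
      then have "norm x \<le> 1 / c" using c(1) by (cases "x = 0") (auto simp: field_simps)
      moreover have "matrix_inv (S + P) $ i $ j = x $ i" unfolding x_def by (simp add: matrix_vector_mult_basis column_def)
      ultimately show ?thesis using component_le_norm_cart[of x i] by simp
    qed
    then show "norm (matrix_inv (S + P)) \<le> (\<Sum>i\<in>(UNIV::'p set). \<Sum>j\<in>(UNIV::'p set). 1 / c)"
      by (intro order_trans[OF norm_matrix_le_entries] sum_mono)
  qed
qed

section \<open>Divergence of matrix fields\<close>

lemma sum_Basis_matrix:
  fixes f :: "real^'p^'m \<Rightarrow> real"
  shows
  "(\<Sum>b\<in>Basis. f (b :: real^'p^'m)) = (\<Sum>i\<in>UNIV. \<Sum>j\<in>UNIV. f (axis i (axis j 1)))"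
proof -
  have B1: "(\<Sum>b\<in>Basis. g (b :: real^'p)) = (\<Sum>j\<in>UNIV. g (axis j 1))" for g :: "real^'p \<Rightarrow> real"
  proof -
    have B: "(Basis :: (real^'p) set) = range (\<lambda>j. axis j 1)" by (auto simp: Basis_vec_def)
    have I: "inj (\<lambda>j. axis j 1 :: real^'p)" by (auto simp: inj_def axis_eq_axis)
    show ?thesis unfolding B by (simp add: sum.reindex[OF I])
  qed
  have B: "(Basis :: (real^'p^'m) set) = (\<lambda>(i, u). axis i u) ` (UNIV \<times> Basis)"
    by (auto simp: Basis_vec_def)
  have I: "inj_on (\<lambda>(i, u). axis i u :: real^'p^'m) (UNIV \<times> Basis)"
    by (auto simp: inj_on_def axis_eq_axis)
  have "(\<Sum>b\<in>Basis. f (b :: real^'p^'m)) = (\<Sum>x\<in>UNIV \<times> Basis. f ((\<lambda>(i, u). axis i u) x))"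
    unfolding B by (rule sum.reindex_cong[OF I refl refl])
  also have "\<dots> = (\<Sum>i\<in>UNIV. \<Sum>u\<in>Basis. f (axis i u))"
    by (simp add: sum.cartesian_product case_prod_unfold)
  finally show ?thesis by (simp add: B1)
qed

text \<open>
  Summed over all matrix units, in \<open>sum_Basis_sandwich\<close> and
  \<open>sum_Basis_sandwich_transpose\<close>, this contains every divergence that is needed, since the derivative of a product in the direction \<open>b\<close> is a sum of terms
  \<open>U b V\<close> and \<open>U b\<^sup>T V\<close>.
\<close>

lemma matrix_unit_sandwich:
  fixes U :: "real^'m^'a" and V :: "real^'b^'p"
  shows "(U ** axis i (axis j 1) ** V) $ k $ l = U $ k $ i * V $ j $ l"
proof -
  have entry: "axis i (axis j (1::real)) $ d $ c = (if i = d then (if j = c then 1 else 0) else 0)" for d c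
    by (auto simp: axis_def)
  have 1: "(U ** axis i (axis j 1)) $ k $ c = U $ k $ i * (if j = c then 1 else 0)" for c
  proof -
    have "(U ** axis i (axis j 1)) $ k $ c = (\<Sum>d\<in>UNIV. (if i = d then (if j = c then 1 else 0) else 0) * U $ k $ d)"
      unfolding matrix_matrix_mult_def by (simp add: entry mult.commute)
    then show ?thesis unfolding sum_if_eq_mult by simp
  qed
  have "(U ** axis i (axis j 1) ** V) $ k $ l = (\<Sum>c\<in>UNIV. (if j = c then U $ k $ i else 0) * V $ c $ l)"
    unfolding matrix_matrix_mult_def[of "U ** axis i (axis j 1)"] by (simp add: 1) (auto intro!: sum.cong)
  then show ?thesis by (simp add: sum_if_eq_mult)
qed

lemma inner_matrix_unit: "(A :: real^'p^'m) \<bullet> axis i (axis j 1) = A $ i $ j"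
  by (simp add: inner_axis)

lemma transpose_matrix_unit: "transpose (axis i (axis j 1) :: real^'p^'m) = axis j (axis i 1)"
  by (auto simp: transpose_def axis_def vec_eq_iff)

lemma sum_Basis_sandwich:
  fixes U :: "real^'m^'m" and V :: "real^'p^'p"
  shows "(\<Sum>b\<in>Basis. (U ** b ** V) \<bullet> (b :: real^'p^'m)) = trace U * trace V"
  unfolding sum_Basis_matrix inner_matrix_unit matrix_unit_sandwich
  by (simp add: trace_def sum_product)

lemma sum_Basis_sandwich_transpose:
  fixes U V :: "real^'p^'m"
  shows "(\<Sum>b\<in>Basis. (U ** transpose b ** V) \<bullet> (b :: real^'p^'m)) = U \<bullet> V"
  unfolding sum_Basis_matrix transpose_matrix_unit inner_matrix_unit matrix_unit_sandwich
  by (simp add: inner_vec_def)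

section \<open>Gaussian integrals and integration by parts\<close>

lemma has_bochner_integral_gauss_real:
  fixes c :: real assumes "0 < c"
  shows "has_bochner_integral lborel (\<lambda>x. exp (- c * x\<^sup>2)) (sqrt (pi / c))"
proof -
  have "has_bochner_integral lborel (\<lambda>x. sqrt (pi / c) * normal_density 0 (sqrt (1 / (2 * c))) x) (sqrt (pi / c) * 1)"
    using assms by (intro has_bochner_integral_mult_right) (simp add: has_bochner_integral_iff)
  moreover have "sqrt (pi / c) * normal_density 0 (sqrt (1 / (2 * c))) x = exp (- c * x\<^sup>2)" for x
  proof -
    have "(sqrt (1 / (2 * c)))\<^sup>2 = 1 / (2 * c)" using assms by (intro real_sqrt_pow2) auto
    then have "normal_density 0 (sqrt (1 / (2 * c))) x = 1 / sqrt (pi / c) * exp (- c * x\<^sup>2)"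
      using assms by (simp add: normal_density_def)
    then show ?thesis using assms by simp
  qed
  ultimately show ?thesis by simp
qed

lemma nn_integral_gauss:
  assumes "0 < c"
  shows "(\<integral>\<^sup>+x. ennreal (exp (- c * (norm (x::'a::euclidean_space))\<^sup>2)) \<partial>lborel) = ennreal (sqrt (pi / c) ^ DIM('a))"
proof -
  have "exp (- c * (norm x)\<^sup>2) = (\<Prod>b\<in>Basis. exp (- c * (x \<bullet> b)\<^sup>2))" for x :: 'a
    by (subst power2_norm_eq_inner, subst euclidean_inner)
      (simp add: exp_sum[symmetric] power2_eq_square sum_distrib_left sum_negf)
  then have "(\<integral>\<^sup>+x. ennreal (exp (- c * (norm (x::'a))\<^sup>2)) \<partial>lborel)
    = (\<integral>\<^sup>+x. (\<Prod>b\<in>Basis. ennreal (exp (- c * ((x::'a) \<bullet> b)\<^sup>2))) \<partial>lborel)"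
    by (simp add: prod_ennreal)
  also have "\<dots> = (\<Prod>b\<in>(Basis::'a set). (\<integral>\<^sup>+x. ennreal (exp (- c * x\<^sup>2)) \<partial>lborel))"
    by (rule nn_integral_lborel_prod) auto
  also have "(\<integral>\<^sup>+x. ennreal (exp (- c * x\<^sup>2)) \<partial>lborel) = ennreal (sqrt (pi / c))"
    using has_bochner_integral_gauss_real[OF assms] by (subst nn_integral_eq_integral) (auto simp: has_bochner_integral_iff)
  finally show ?thesis using assms by (simp add: ennreal_power)
qed

lemma has_bochner_integral_gauss:
  assumes "0 < c"
  shows "has_bochner_integral lborel (\<lambda>x::'a::euclidean_space. exp (- c * (norm x)\<^sup>2)) (sqrt (pi / c) ^ DIM('a))"
  using nn_integral_gauss[OF assms, where 'a='a] assms by (intro has_bochner_integral_nn_integral) auto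

lemma square_le_exp:
  fixes u k :: real assumes "0 \<le> u" "0 < k"
  shows "(1 + u)\<^sup>2 \<le> 4 / k\<^sup>2 * exp k * exp (k * u)"
proof -
  have "k * (1 + u) / 2 \<le> exp (k * (1 + u) / 2)" using exp_ge_add_one_self[of "k * (1 + u) / 2"] by linarith
  then have "(k * (1 + u) / 2)\<^sup>2 \<le> (exp (k * (1 + u) / 2))\<^sup>2" using assms by (intro power_mono) auto
  also have "\<dots> = exp k * exp (k * u)" by (simp add: exp_double[symmetric] exp_add[symmetric] algebra_simps)
  finally show ?thesis using assms by (simp add: field_simps power2_eq_square)
qed

lemma integrable_polynomial_gauss:
  fixes f :: "'a::euclidean_space \<Rightarrow> real"
  assumes [measurable]: "f \<in> borel_measurable borel" and c: "0 < c"
    and bound: "\<And>x. \<bar>f x\<bar> \<le> C * (1 + (norm x)\<^sup>2)\<^sup>2 * exp (- c * (norm x)\<^sup>2)"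
  shows "integrable lborel f"
proof (rule Bochner_Integration.integrable_bound)
  let ?k = "c / 2"
  let ?D = "\<bar>C\<bar> * (4 / ?k\<^sup>2 * exp ?k)"
  show "integrable lborel (\<lambda>x::'a. ?D * exp (- ?k * (norm x)\<^sup>2))"
    using has_bochner_integral_gauss[of ?k, where 'a='a] c
    by (intro integrable_mult_right) (simp add: has_bochner_integral_iff)
  show "AE x in lborel. norm (f x) \<le> norm (?D * exp (- ?k * (norm x)\<^sup>2))"
  proof (intro AE_I2)
    fix x :: 'a
    have "\<bar>f x\<bar> \<le> \<bar>C\<bar> * (1 + (norm x)\<^sup>2)\<^sup>2 * exp (- c * (norm x)\<^sup>2)"
      by (rule order_trans[OF bound]) (intro mult_right_mono, auto)
    also have "\<dots> \<le> \<bar>C\<bar> * (4 / ?k\<^sup>2 * exp ?k * exp (?k * (norm x)\<^sup>2)) * exp (- c * (norm x)\<^sup>2)"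
      using c by (intro mult_right_mono mult_left_mono square_le_exp) auto
    also have "\<dots> = ?D * (exp (?k * (norm x)\<^sup>2) * exp (- c * (norm x)\<^sup>2))" by (simp only: mult_ac)
    also have "exp (?k * (norm x)\<^sup>2) * exp (- c * (norm x)\<^sup>2) = exp (- ?k * (norm x)\<^sup>2)"
      by (simp add: exp_add[symmetric])
    finally show "norm (f x) \<le> norm (?D * exp (- ?k * (norm x)\<^sup>2))" by (simp add: abs_mult)
  qed
qed simp

text \<open>
  The fundamental theorem of calculus in \<open>s\<close> and Fubini's theorem. It serves twice: for
  translations of the argument, where it yields integration by parts, and for a homotopy
  between two quadratic forms, where it yields the normalizing constant. In both cases no
  dominating function for difference quotients is needed.
\<close>

lemma integral_increment:
  fixes h h' :: "real \<Rightarrow> 'a::euclidean_space \<Rightarrow> real"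
  assumes [measurable]: "(\<lambda>(s, y). h' s y) \<in> borel_measurable (lborel \<Otimes>\<^sub>M lborel)"
    and der: "\<And>s y. 0 \<le> s \<Longrightarrow> s \<le> 1 \<Longrightarrow> ((\<lambda>s. h s y) has_real_derivative h' s y) (at s)"
    and cont: "\<And>y. continuous_on {0..1} (\<lambda>s. h' s y)"
    and int: "\<And>s. s \<in> {0..1} \<Longrightarrow> integrable lborel (h' s)"
    and bound: "\<And>s. s \<in> {0..1} \<Longrightarrow> (LINT y|lborel. \<bar>h' s y\<bar>) \<le> K"
  shows "(LINT y|lborel. h 1 y - h 0 y) = (LINT s|lborel. indicator {0..1} s * (LINT y|lborel. h' s y))"
proof -
  let ?f = "\<lambda>(s, y). indicator {0..1} s * h' s y :: real"
  have f_meas [measurable]: "?f \<in> borel_measurable (lborel \<Otimes>\<^sub>M lborel)" by measurable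
  have [measurable]: "(\<lambda>s. LINT y|lborel. \<bar>?f (s, y)\<bar>) \<in> borel_measurable lborel"
    by (rule lborel.borel_measurable_lebesgue_integral) measurable
  have "integrable (lborel \<Otimes>\<^sub>M lborel) ?f"
  proof (rule lborel_pair.Fubini_integrable[OF f_meas])
    show "AE s in lborel. integrable lborel (\<lambda>y. ?f (s, y))"
      by (intro AE_I2) (use int in \<open>auto simp: indicator_def\<close>)
    show "integrable lborel (\<lambda>s. LINT y|lborel. norm (?f (s, y)))"
    proof (rule Bochner_Integration.integrable_bound)
      show "integrable lborel (\<lambda>s::real. indicator {0..1} s * K)" by simp
      show "AE s in lborel. norm (LINT y|lborel. norm (?f (s, y))) \<le> norm (indicator {0..1} s * K :: real)"
      proof (intro AE_I2)
        fix s :: real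
        show "norm (LINT y|lborel. norm (?f (s, y))) \<le> norm (indicator {0..1} s * K :: real)"
        proof (cases "s \<in> {0..1}")
          case True
          have "0 \<le> (LINT y|lborel. \<bar>h' s y\<bar>)" by (rule Bochner_Integration.integral_nonneg) auto
          then show ?thesis using True bound[OF True] by (simp add: abs_mult)
        qed simp
      qed
    qed (use \<open>(\<lambda>s. LINT y|lborel. \<bar>?f (s, y)\<bar>) \<in> borel_measurable lborel\<close> in simp)
  qed
  then have "(LINT y|lborel. LINT s|lborel. ?f (s, y)) = (LINT s|lborel. LINT y|lborel. ?f (s, y))"
    by (simp add: lborel_pair.Fubini_integral case_prod_unfold)
  moreover have "(LINT s|lborel. ?f (s, y)) = h 1 y - h 0 y" for y
  proof -
    have "(LINT s|lborel. h' s y * indicator {0..1} s) = h 1 y - h 0 y"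
      using integral_FTC_Icc[of 0 1 "\<lambda>s. h s y" "\<lambda>s. h' s y"] der cont
      by (simp add: has_real_derivative_iff_has_vector_derivative has_vector_derivative_at_within mult.commute)
    then show ?thesis by (simp add: mult.commute)
  qed
  ultimately show ?thesis by simp
qed

lemma integral_translation:
  fixes F :: "'a::euclidean_space \<Rightarrow> real"
  assumes [measurable]: "F \<in> borel_measurable borel"
  shows "(LINT x|lborel. F (x + a)) = (LINT x|lborel. F x)"
    and "integrable lborel (\<lambda>x. F (x + a)) \<longleftrightarrow> integrable lborel F"
proof -
  have "(LINT x|distr lborel borel ((+) a). F x) = (LINT x|lborel. F (a + x))"
    by (rule integral_distr) auto
  then show "(LINT x|lborel. F (x + a)) = (LINT x|lborel. F x)" by (simp add: lborel_distr_plus add.commute)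
  have "integrable (distr lborel borel ((+) a)) F \<longleftrightarrow> integrable lborel (\<lambda>x. F (a + x))"
    by (rule integrable_distr_eq) auto
  then show "integrable lborel (\<lambda>x. F (x + a)) \<longleftrightarrow> integrable lborel F" by (simp add: lborel_distr_plus add.commute)
qed

text \<open>
  The integral of \<open>F (x + s b)\<close> does not depend on \<open>s\<close>, and the integral of the derivative with
  respect to \<open>s\<close> does not either; so the latter is zero.
\<close>

lemma integral_directional_derivative:
  fixes F F' :: "'a::euclidean_space \<Rightarrow> real"
  assumes F: "integrable lborel F" and F': "integrable lborel F'" and cont: "continuous_on UNIV F'"
    and der: "\<And>x. ((\<lambda>t. F (x + t *\<^sub>R b)) has_real_derivative F' x) (at 0)"
  shows "(LINT x|lborel. F' x) = 0"
proof -
  have [measurable]: "F \<in> borel_measurable borel" "F' \<in> borel_measurable borel"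
    using F F' by (auto dest: borel_measurable_integrable)
  have "(LINT x|lborel. F (x + 1 *\<^sub>R b) - F (x + 0 *\<^sub>R b))
    = (LINT s|lborel. indicator {0..1} s * (LINT x|lborel. F' (x + s *\<^sub>R b)))"
  proof (rule integral_increment)
    show "((\<lambda>s. F (y + s *\<^sub>R b)) has_real_derivative F' (y + s *\<^sub>R b)) (at s)" for s y
    proof -
      have "((\<lambda>t. F ((y + s *\<^sub>R b) + t *\<^sub>R b)) has_real_derivative F' (y + s *\<^sub>R b)) (at 0)" by (rule der)
      then have "((\<lambda>t. F (y + (t + s) *\<^sub>R b)) has_real_derivative F' (y + s *\<^sub>R b)) (at 0)"
        by (simp add: algebra_simps)
      then show ?thesis using DERIV_shift[of "\<lambda>t. F (y + t *\<^sub>R b)" _ 0 s] by simp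
    qed
    show "continuous_on {0..1} (\<lambda>s. F' (y + s *\<^sub>R b))" for y
      by (intro continuous_on_compose2[OF cont] continuous_intros) auto
    show "integrable lborel (\<lambda>x. F' (x + s *\<^sub>R b))" for s using F' by (simp add: integral_translation)
    show "(LINT y|lborel. \<bar>F' (y + s *\<^sub>R b)\<bar>) \<le> (LINT y|lborel. \<bar>F' y\<bar>)" for s
      using integral_translation(1)[of "\<lambda>y. \<bar>F' y\<bar>"] by simp
  qed measurable
  also have "(LINT x|lborel. F (x + 1 *\<^sub>R b) - F (x + 0 *\<^sub>R b)) = 0"
    using F by (simp add: integral_translation)
  finally show ?thesis by (simp add: integral_translation)
qed

lemma norm_diff_le_quadratic:
  fixes M Y :: "'a::real_normed_vector"
  shows "norm (Y - M) \<le> (1 + norm M) * (1 + (norm Y)\<^sup>2)"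
proof -
  have "2 * norm Y \<le> (norm Y)\<^sup>2 + 1" using sum_squares_bound[of "norm Y" 1] by simp
  then have "norm Y \<le> 1 + (norm Y)\<^sup>2" using norm_ge_zero[of Y] by linarith
  moreover have "0 \<le> norm M * (norm Y)\<^sup>2" by simp
  moreover have "norm (Y - M) \<le> norm Y + norm M" by (rule norm_triangle_ineq4)
  ultimately have "norm (Y - M) \<le> (1 + (norm Y)\<^sup>2) + norm M + norm M * (norm Y)\<^sup>2" by linarith
  then show ?thesis by (simp add: algebra_simps)
qed

text \<open>
  The density of a matrix normal distribution with mean \<open>M\<close> and row precision matrix \<open>A\<close>,
  up to its constant factor.
\<close>

abbreviation gauss_weight :: "real^'p^'m \<Rightarrow> real^'p^'p \<Rightarrow> real^'p^'m \<Rightarrow> real" where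
  "gauss_weight M A Y \<equiv> exp (- (((Y - M) ** A) \<bullet> (Y - M)) / 2)"

lemma norm_diff_mult_le:
  fixes Y M :: "real^'p^'m" and A :: "real^'p^'p"
  shows "norm ((Y - M) ** A) \<le> (1 + norm M) * norm A * (1 + (norm Y)\<^sup>2)"
proof -
  have "norm ((Y - M) ** A) \<le> norm (Y - M) * norm A" by (rule norm_matrix_mult_le)
  also have "\<dots> \<le> (1 + norm M) * (1 + (norm Y)\<^sup>2) * norm A"
    by (intro mult_right_mono norm_diff_le_quadratic) auto
  finally show ?thesis by (simp add: mult_ac)
qed

lemma matrix_quadratic_coercive:
  fixes Y :: "real^'p^'m" and A :: "real^'p^'p"
  assumes "\<And>x. k * (norm x)\<^sup>2 \<le> x \<bullet> (A *v x)"
  shows "k * (norm Y)\<^sup>2 \<le> (Y ** A) \<bullet> Y"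
proof -
  have "(Y ** A) \<bullet> Y = (\<Sum>i\<in>UNIV. (Y ** A) $ i \<bullet> Y $ i)" by (simp add: inner_vec_def)
  also have "\<dots> = (\<Sum>i\<in>UNIV. Y $ i \<bullet> (A *v Y $ i))"
    by (rule sum.cong) (auto simp: dot_lmul_matrix[symmetric] matrix_matrix_mult_def vector_matrix_mult_def mult.commute)
  also have "\<dots> \<ge> (\<Sum>i\<in>UNIV. k * (norm (Y $ i))\<^sup>2)" by (intro sum_mono assms)
  also have "(\<Sum>i\<in>UNIV. k * (norm (Y $ i))\<^sup>2) = k * (norm Y)\<^sup>2"
    by (simp add: norm_vec_def L2_set_def sum_nonneg sum_distrib_left)
  finally show ?thesis .
qed

lemma gauss_weight_decay:
  fixes M :: "real^'p^'m" and A :: "real^'p^'p"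
  assumes A: "pos_def_matrix A"
  obtains c C where "0 < c" "\<And>Y. gauss_weight M A Y \<le> C * exp (- c * (norm Y)\<^sup>2)"
proof -
  obtain k where k: "0 < k" "\<And>x. k * (norm x)\<^sup>2 \<le> x \<bullet> (A *v x)"
    by (rule pos_def_matrix_coercive[OF A]) blast
  note coer = matrix_quadratic_coercive[OF k(2)]
  show thesis
  proof (rule that[of "k / 4" "exp (k / 2 * (norm M)\<^sup>2)"])
    show "0 < k / 4" using k by simp
    fix Y :: "real^'p^'m"
    have "(norm Y)\<^sup>2 \<le> (norm (Y - M) + norm M)\<^sup>2"
      using norm_triangle_sub[of Y M] by (intro power_mono) (auto simp: add.commute)
    also have "\<dots> \<le> 2 * (norm (Y - M))\<^sup>2 + 2 * (norm M)\<^sup>2"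
      using sum_squares_bound[of "norm (Y - M)" "norm M"] by (simp add: power2_sum)
    finally have "k * (norm Y)\<^sup>2 \<le> k * (2 * (norm (Y - M))\<^sup>2 + 2 * (norm M)\<^sup>2)" using k by (intro mult_left_mono) auto
    moreover define Q where "Q = ((Y - M) ** A) \<bullet> (Y - M)"
    moreover have "k * (norm (Y - M))\<^sup>2 \<le> Q" unfolding Q_def by (rule coer)
    ultimately have "- Q / 2 \<le> k / 2 * (norm M)\<^sup>2 + - (k / 4) * (norm Y)\<^sup>2"
      by (simp add: distrib_left)
    then show "gauss_weight M A Y \<le> exp (k / 2 * (norm M)\<^sup>2) * exp (- (k / 4) * (norm Y)\<^sup>2)"
      by (simp add: exp_add[symmetric] Q_def)
  qed
qed

lemma integrable_polynomial_mult_gauss: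
  fixes M :: "real^'p^'m" and A :: "real^'p^'p" and f :: "real^'p^'m \<Rightarrow> real"
  assumes A: "pos_def_matrix A" and [measurable]: "f \<in> borel_measurable borel"
    and f: "\<And>Y. \<bar>f Y\<bar> \<le> C * (1 + (norm Y)\<^sup>2)\<^sup>2"
  shows "integrable lborel (\<lambda>Y. f Y * gauss_weight M A Y)"
proof -
  obtain c D where cD: "0 < c" "\<And>Y. gauss_weight M A Y \<le> D * exp (- c * (norm Y)\<^sup>2)"
    by (rule gauss_weight_decay[OF A, of M]) blast
  show ?thesis
  proof (rule integrable_polynomial_gauss[OF _ cD(1)])
    fix Y :: "real^'p^'m"
    have "0 \<le> C * (1 + (norm Y)\<^sup>2)\<^sup>2" using f[of Y] by linarith
    then have "\<bar>f Y\<bar> * gauss_weight M A Y \<le> (C * (1 + (norm Y)\<^sup>2)\<^sup>2) * (D * exp (- c * (norm Y)\<^sup>2))"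
      by (intro mult_mono f cD) auto
    then show "\<bar>f Y * gauss_weight M A Y\<bar> \<le> (C * D) * (1 + (norm Y)\<^sup>2)\<^sup>2 * exp (- c * (norm Y)\<^sup>2)"
      by (simp add: abs_mult mult_ac)
  qed measurable
qed

lemma inner_matrix_symmetric:
  fixes X Y :: "real^'p^'m"
  shows "transpose A = A \<Longrightarrow> (X ** A) \<bullet> Y = (Y ** A) \<bullet> X"
  by (metis inner_commute inner_matrix_mult_right)

text \<open>
  For each basis direction \<open>b\<close>, the derivative of \<open>(G \<bullet> b) w\<close> along \<open>b\<close> integrates to zero, and
  \<open>w\<close> has the logarithmic derivative \<open>- ((Y - M) A) \<bullet> b\<close>. Summation over \<open>b\<close> gives the
  divergence of \<open>G\<close> on the right. The weight is not normalized, because its integral is computed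
  from this identity in \<open>gauss_integral\<close>.
\<close>

lemma stein_unnormalized:
  fixes M :: "real^'p^'m" and A :: "real^'p^'p" and G :: "real^'p^'m \<Rightarrow> real^'p^'m"
  assumes A: "pos_def_matrix A"
    and G: "continuous_on UNIV G" and DG: "\<And>b. b \<in> Basis \<Longrightarrow> continuous_on UNIV (DG b)"
    and der: "\<And>b Y. b \<in> Basis \<Longrightarrow> ((\<lambda>t. G (Y + t *\<^sub>R b)) has_vector_derivative DG b Y) (at 0)"
    and Gb: "\<And>Y. norm (G Y) \<le> C * (1 + (norm Y)\<^sup>2)"
    and DGb: "\<And>b Y. b \<in> Basis \<Longrightarrow> norm (DG b Y) \<le> C * (1 + (norm Y)\<^sup>2)"
  defines "w \<equiv> \<lambda>Y. gauss_weight M A Y"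
  shows "(LINT Y|lborel. (((Y - M) ** A) \<bullet> G Y) * w Y) = (LINT Y|lborel. (\<Sum>b\<in>Basis. DG b Y \<bullet> b) * w Y)"
proof -
  note At = pos_def_matrix_symmetric[OF A]
  have w_cont: "continuous_on UNIV w" unfolding w_def by (intro continuous_intros) auto
  have C0: "0 \<le> C" using Gb[of 0] by (simp add: order_trans[OF norm_ge_zero])
  have one: "1 + (norm Y)\<^sup>2 \<le> (1 + (norm Y)\<^sup>2)\<^sup>2" for Y :: "real^'p^'m"
    using self_le_power[of "1 + (norm Y)\<^sup>2" 2] by simp
  have G_meas [measurable]: "G \<in> borel_measurable borel" by (rule borel_measurable_continuous_onI[OF G])
  have DG_meas: "DG b \<in> borel_measurable borel" if "b \<in> Basis" for b by (rule borel_measurable_continuous_onI[OF DG[OF that]])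
  define L where "L = (1 + norm M) * norm A"
  have L: "0 \<le> L" "norm ((Y - M) ** A) \<le> L * (1 + (norm Y)\<^sup>2)" for Y
    unfolding L_def by (auto intro: norm_diff_mult_le)
  have int1: "integrable lborel (\<lambda>Y. (DG b Y \<bullet> b) * w Y)" if b: "b \<in> Basis" for b
    unfolding w_def
  proof (rule integrable_polynomial_mult_gauss[OF A, of _ C])
    show "(\<lambda>Y. DG b Y \<bullet> b) \<in> borel_measurable borel" using DG_meas[OF b] by measurable
    fix Y :: "real^'p^'m"
    have "\<bar>DG b Y \<bullet> b\<bar> \<le> norm (DG b Y)" using b by (rule Basis_le_norm)
    also have "\<dots> \<le> C * (1 + (norm Y)\<^sup>2)" by (rule DGb[OF b])
    also have "\<dots> \<le> C * (1 + (norm Y)\<^sup>2)\<^sup>2" by (intro mult_left_mono one C0)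
    finally show "\<bar>DG b Y \<bullet> b\<bar> \<le> C * (1 + (norm Y)\<^sup>2)\<^sup>2" .
  qed
  have int2: "integrable lborel (\<lambda>Y. ((G Y \<bullet> b) * (((Y - M) ** A) \<bullet> b)) * w Y)" if b: "b \<in> Basis" for b
    unfolding w_def
  proof (rule integrable_polynomial_mult_gauss[OF A, of _ "C * L"])
    fix Y :: "real^'p^'m"
    have "\<bar>(G Y \<bullet> b) * (((Y - M) ** A) \<bullet> b)\<bar> \<le> (C * (1 + (norm Y)\<^sup>2)) * (L * (1 + (norm Y)\<^sup>2))"
      unfolding abs_mult using b C0
      by (intro mult_mono order_trans[OF Basis_le_norm Gb] order_trans[OF Basis_le_norm L(2)]) auto
    then show "\<bar>(G Y \<bullet> b) * (((Y - M) ** A) \<bullet> b)\<bar> \<le> C * L * (1 + (norm Y)\<^sup>2)\<^sup>2"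
      by (simp add: power2_eq_square mult_ac)
  qed measurable
  have int3: "integrable lborel (\<lambda>Y. (G Y \<bullet> b) * w Y)" if b: "b \<in> Basis" for b
    unfolding w_def
  proof (rule integrable_polynomial_mult_gauss[OF A, of _ C])
    fix Y :: "real^'p^'m"
    have "\<bar>G Y \<bullet> b\<bar> \<le> C * (1 + (norm Y)\<^sup>2)" by (rule order_trans[OF Basis_le_norm[OF b] Gb])
    also have "\<dots> \<le> C * (1 + (norm Y)\<^sup>2)\<^sup>2" by (intro mult_left_mono one C0)
    finally show "\<bar>G Y \<bullet> b\<bar> \<le> C * (1 + (norm Y)\<^sup>2)\<^sup>2" .
  qed measurable
  have main: "(LINT Y|lborel. ((G Y \<bullet> b) * (((Y - M) ** A) \<bullet> b)) * w Y) = (LINT Y|lborel. (DG b Y \<bullet> b) * w Y)"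
    if b: "b \<in> Basis" for b
  proof -
    have "(LINT Y|lborel. (DG b Y \<bullet> b) * w Y - ((G Y \<bullet> b) * (((Y - M) ** A) \<bullet> b)) * w Y) = 0"
    proof (rule integral_directional_derivative[OF int3[OF b]])
      show "integrable lborel (\<lambda>Y. (DG b Y \<bullet> b) * w Y - ((G Y \<bullet> b) * (((Y - M) ** A) \<bullet> b)) * w Y)"
        by (intro Bochner_Integration.integrable_diff int1 int2 b)
      show "continuous_on UNIV (\<lambda>Y. (DG b Y \<bullet> b) * w Y - ((G Y \<bullet> b) * (((Y - M) ** A) \<bullet> b)) * w Y)"
        by (intro continuous_intros w_cont G DG b)
      fix Y :: "real^'p^'m"
      have dG: "((\<lambda>t. G (Y + t *\<^sub>R b) \<bullet> b) has_real_derivative (DG b Y \<bullet> b)) (at 0)"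
        unfolding has_real_derivative_iff_has_vector_derivative
        by (rule bounded_linear.has_vector_derivative[OF bounded_linear_inner_left der[OF b]])
      have q: "((Y + t *\<^sub>R b - M) ** A) \<bullet> (Y + t *\<^sub>R b - M)
        = ((Y - M) ** A) \<bullet> (Y - M) + t * (2 * (((Y - M) ** A) \<bullet> b)) + t\<^sup>2 * ((b ** A) \<bullet> b)" for t
      proof -
        have "Y + t *\<^sub>R b - M = (Y - M) + t *\<^sub>R b" by simp
        moreover have "(b ** A) \<bullet> (Y - M) = ((Y - M) ** A) \<bullet> b" by (rule inner_matrix_symmetric[OF At])
        ultimately show ?thesis
          by (simp only: matrix_mult_bilinear inner_add_left inner_add_right inner_scaleR_left inner_scaleR_right)
             (simp add: power2_eq_square algebra_simps)
      qed
      have dw: "((\<lambda>t. w (Y + t *\<^sub>R b)) has_real_derivative - (((Y - M) ** A) \<bullet> b) * w Y) (at 0)"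
        unfolding w_def q by (auto intro!: derivative_eq_intros)
      show "((\<lambda>t. (G (Y + t *\<^sub>R b) \<bullet> b) * w (Y + t *\<^sub>R b)) has_real_derivative
        (DG b Y \<bullet> b) * w Y - ((G Y \<bullet> b) * (((Y - M) ** A) \<bullet> b)) * w Y) (at 0)"
        using DERIV_mult[OF dG dw] by (simp add: algebra_simps)
    qed
    then show ?thesis using int1[OF b] int2[OF b] by simp
  qed
  have "(LINT Y|lborel. (((Y - M) ** A) \<bullet> G Y) * w Y) = (LINT Y|lborel. (\<Sum>b\<in>Basis. ((G Y \<bullet> b) * (((Y - M) ** A) \<bullet> b)) * w Y))"
    by (subst euclidean_inner) (simp add: sum_distrib_right sum_distrib_left mult_ac)
  also have "\<dots> = (\<Sum>b\<in>Basis. LINT Y|lborel. (DG b Y \<bullet> b) * w Y)"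
    using int2 main by (subst Bochner_Integration.integral_sum) auto
  also have "\<dots> = (LINT Y|lborel. (\<Sum>b\<in>Basis. DG b Y \<bullet> b) * w Y)"
    using int1 by (subst Bochner_Integration.integral_sum[symmetric]) (auto simp: sum_distrib_right)
  finally show ?thesis .
qed

section \<open>The normalizing constant\<close>

lemma trace_quadratic: "trace (Y ** A ** transpose (Y :: real^'p^'m)) = (Y ** A) \<bullet> Y"
proof -
  have "(Y ** A) \<bullet> Y = Y \<bullet> (Y ** A)" by (rule inner_commute)
  also have "\<dots> = trace (transpose Y ** (Y ** A))" by (rule inner_matrix_eq_trace)
  also have "\<dots> = trace ((Y ** A) ** transpose Y)" by (rule trace_mul_sym)
  finally show ?thesis by simp
qed

text \<open>
  Stein's identity for the linear field \<open>(Y - M) H A\<^sup>-\<^sup>1\<close>, whose divergence is constant.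
\<close>

lemma gauss_second_moment_unnormalized:
  fixes M :: "real^'p^'m" and A H :: "real^'p^'p"
  assumes A: "pos_def_matrix A"
  defines "w \<equiv> \<lambda>Y. gauss_weight M A Y"
  shows "(LINT Y|lborel. (((Y - M) ** H) \<bullet> (Y - M)) * w Y)
    = real CARD('m) * trace (H ** matrix_inv A) * (LINT Y|lborel. w Y)"
proof -
  note At = pos_def_matrix_symmetric[OF A]
  have Ai: "matrix_inv A ** A = mat 1" by (intro matrix_inv_left pos_def_matrix_invertible A)
  let ?G = "\<lambda>Y. (Y - M) ** (H ** matrix_inv A)"
  let ?DG = "\<lambda>(b :: real^'p^'m) (Y :: real^'p^'m). b ** (H ** matrix_inv A)"
  define C where "C = (1 + norm M) * norm (H ** matrix_inv A)"
  have "(LINT Y|lborel. (((Y - M) ** A) \<bullet> ?G Y) * w Y) = (LINT Y|lborel. (\<Sum>b\<in>Basis. ?DG b Y \<bullet> b) * w Y)"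
    unfolding w_def
  proof (rule stein_unnormalized[where G = ?G and DG = ?DG and C = C, OF A])
    show "continuous_on UNIV ?G" "\<And>b. continuous_on UNIV (?DG b)" by (intro continuous_intros)+
    show "((\<lambda>t. (Y + t *\<^sub>R b - M) ** (H ** matrix_inv A)) has_vector_derivative b ** (H ** matrix_inv A)) (at 0)" for b Y :: "real^'p^'m"
      by (rule bounded_linear.has_vector_derivative[OF bounded_bilinear.bounded_linear_left[OF bounded_bilinear_matrix_mult]])
        (auto intro!: derivative_eq_intros simp: has_vector_derivative_def)
    show "norm (?G Y) \<le> C * (1 + (norm Y)\<^sup>2)" for Y
      unfolding C_def by (rule norm_diff_mult_le)
    show "norm (?DG b Y) \<le> C * (1 + (norm Y)\<^sup>2)" if "b \<in> Basis" for b Y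
    proof -
      have "norm (?DG b Y) \<le> 1 * norm (H ** matrix_inv A) * 1"
        using norm_matrix_mult_le[of b "H ** matrix_inv A"] that by simp
      also have "\<dots> \<le> C * (1 + (norm Y)\<^sup>2)"
        unfolding C_def by (intro mult_mono) auto
      finally show ?thesis .
    qed
  qed
  moreover have "((Y - M) ** A) \<bullet> ?G Y = ((Y - M) ** H) \<bullet> (Y - M)" for Y
  proof -
    have "((Y - M) ** A) \<bullet> ?G Y = ?G Y \<bullet> ((Y - M) ** A)" by (rule inner_commute)
    also have "\<dots> = (?G Y ** A) \<bullet> (Y - M)" by (simp add: inner_matrix_mult_right At)
    also have "?G Y ** A = (Y - M) ** H" by (simp add: matrix_mul_assoc[symmetric] Ai)
    finally show ?thesis .
  qed
  moreover have "(\<Sum>b\<in>Basis. ?DG b Y \<bullet> b) = real CARD('m) * trace (H ** matrix_inv A)" for Y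
    using sum_Basis_sandwich[of "mat 1" "H ** matrix_inv A"] by (simp add: trace_I)
  ultimately show ?thesis by simp
qed

lemma integrable_gauss_quadratic:
  fixes M :: "real^'p^'m" and A H :: "real^'p^'p"
  assumes A: "pos_def_matrix A"
  shows "integrable lborel (\<lambda>Y. (((Y - M) ** H) \<bullet> (Y - M)) * gauss_weight M A Y)"
proof -
  show ?thesis
  proof (rule integrable_polynomial_mult_gauss[OF A, of _ "norm H * (1 + norm M)\<^sup>2"])
    fix Y :: "real^'p^'m"
    note n = norm_diff_le_quadratic[of Y M]
    have "\<bar>((Y - M) ** H) \<bullet> (Y - M)\<bar> \<le> norm ((Y - M) ** H) * norm (Y - M)" by (rule Cauchy_Schwarz_ineq2)
    also have "\<dots> \<le> (norm (Y - M) * norm H) * norm (Y - M)" by (intro mult_right_mono norm_matrix_mult_le) auto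
    also have "\<dots> = norm H * (norm (Y - M))\<^sup>2" by (simp add: power2_eq_square)
    also have "\<dots> \<le> norm H * ((1 + norm M) * (1 + (norm Y)\<^sup>2))\<^sup>2"
      using n by (intro mult_left_mono power_mono) auto
    finally show "\<bar>((Y - M) ** H) \<bullet> (Y - M)\<bar> \<le> norm H * (1 + norm M)\<^sup>2 * (1 + (norm Y)\<^sup>2)\<^sup>2"
      by (simp add: power_mult_distrib)
  qed measurable
qed

lemma pos_def_matrix_one: "pos_def_matrix (mat 1 :: real^'p^'p)"
  by (simp add: pos_def_matrix_def)

lemma det_congruence_diagonal:
  fixes B :: "real^'p^'p"
  assumes "(mat 1 :: real^'p^'p) = transpose B ** B"
  shows "det (transpose B ** diagonal r ** B) = (\<Prod>i\<in>UNIV. r $ i)"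
proof -
  have "det (gram B) = 1" by (simp add: assms[symmetric])
  then have "det B * det B = 1" by (simp add: det_mul)
  then show ?thesis by (simp add: det_mul det_diagonal_eq)
qed

text \<open>
  Let \<open>A\<^sub>s = (1 - s) I + s A\<close>. By the second moments,
  \<open>d/ds log \<integral> exp (- tr (Y A\<^sub>s Y\<^sup>T) / 2) dY = - (m/2) tr ((A - I) A\<^sub>s\<^sup>-\<^sup>1)\<close>, which is also
  \<open>- (m/2) d/ds log |A\<^sub>s|\<close>. Hence \<open>|A\<^sub>s|\<^sup>m\<^sup>/\<^sup>2 \<integral> exp (- tr (Y A\<^sub>s Y\<^sup>T) / 2) dY\<close> is constant in \<open>s\<close>,
  and at \<open>s = 0\<close> the integral is a product of one-dimensional ones. Diagonalizing \<open>A\<close> by an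
  orthogonal \<open>B\<close> turns \<open>log |A\<^sub>s|\<close> into the sum of \<open>log (1 - s + s r\<^sub>i)\<close>.
\<close>

lemma gauss_integral:
  fixes A :: "real^'p^'p"
  assumes A: "pos_def_matrix A"
  shows "(LINT Y|lborel. exp (- ((Y ** A) \<bullet> (Y :: real^'p^'m)) / 2))
    = (2 * pi) powr (real CARD('m) * real CARD('p) / 2) * det A powr (- (real CARD('m) / 2))"
proof -
  define m where "m = real CARD('m)"
  obtain B :: "real^'p^'p" and r where B: "invertible B" "mat 1 = transpose B ** B" "A = transpose B ** diagonal r ** B"
    by (rule simultaneous_diagonalization[OF pos_def_matrix_one pos_def_matrix_symmetric[OF A]])
  have r0: "0 < r $ i" for i using A unfolding B(3) pos_def_matrix_diagonal[OF B(1)] by blast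
  define a where "a = (\<lambda>s i. 1 - s + s * r $ i)"
  have a0: "0 < a s i" if "0 \<le> s" "s \<le> 1" for s i
  proof (cases "s = 0")
    case False
    then have "0 < s * r $ i" using r0[of i] that by simp
    then show ?thesis using that by (simp add: a_def)
  qed (simp add: a_def)
  have a_le: "a s i \<le> 1 + r $ i" if "0 \<le> s" "s \<le> 1" for s i
  proof -
    have "s * r $ i \<le> 1 * r $ i" using that r0[of i] by (intro mult_right_mono) auto
    then show ?thesis using that by (simp add: a_def)
  qed
  have BBt: "B ** transpose B = mat 1" using B(2) matrix_left_right_inverse by metis
  define As where "As s = transpose B ** diagonal (\<chi> i. a s i) ** B" for s
  have As_eq: "As s = (1 - s) *\<^sub>R mat 1 + s *\<^sub>R A" for s
  proof -
    have "diagonal (\<chi> i. a s i) = (1 - s) *\<^sub>R diagonal (\<chi> i. 1) + s *\<^sub>R diagonal r"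
      by (simp add: diagonal_def vec_eq_iff a_def)
    then show ?thesis unfolding As_def by (simp add: matrix_mult_bilinear diagonal_one B(2)[symmetric] B(3)[symmetric])
  qed
  have As_pd: "pos_def_matrix (As s)" if "s \<in> {0..1}" for s
    unfolding As_def pos_def_matrix_diagonal[OF B(1)] using a0 that by auto
  define T where "T = (\<lambda>s. \<Sum>i\<in>UNIV. (r $ i - 1) / a s i)"
  have trace_As: "trace ((A - mat 1) ** matrix_inv (As s)) = T s" if s: "s \<in> {0..1}" for s
  proof -
    have 1: "As s ** (transpose B ** diagonal (\<chi> i. 1 / a s i) ** B) = mat 1"
    proof -
      have "As s ** (transpose B ** diagonal (\<chi> i. 1 / a s i) ** B)
        = transpose B ** (diagonal (\<chi> i. a s i) ** (B ** transpose B) ** diagonal (\<chi> i. 1 / a s i)) ** B"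
        unfolding As_def by (simp only: matrix_mul_assoc)
      also have "diagonal (\<chi> i. a s i) ** (B ** transpose B) ** diagonal (\<chi> i. 1 / a s i) = mat 1"
        using a0[of s] s by (simp add: BBt diagonal_mult less_imp_neq[symmetric] diagonal_one)
      finally show ?thesis by (simp add: B(2)[symmetric])
    qed
    have 2: "A - mat 1 = transpose B ** diagonal (\<chi> i. r $ i - 1) ** B"
    proof -
      have "diagonal (\<chi> i. r $ i - 1) = diagonal r - diagonal (\<chi> i. 1)"
        by (simp add: diagonal_def vec_eq_iff)
      then show ?thesis by (simp add: matrix_mult_bilinear diagonal_one B(2)[symmetric] B(3)[symmetric])
    qed
    have "(A - mat 1) ** matrix_inv (As s)
      = transpose B ** (diagonal (\<chi> i. r $ i - 1) ** (B ** transpose B) ** diagonal (\<chi> i. 1 / a s i)) ** B"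
      unfolding 2 matrix_inv_eqI[OF 1] by (simp only: matrix_mul_assoc)
    also have "\<dots> = transpose B ** diagonal (\<chi> i. (r $ i - 1) / a s i) ** B"
      by (simp add: BBt diagonal_mult)
    also have "trace \<dots> = trace (B ** (transpose B ** diagonal (\<chi> i. (r $ i - 1) / a s i)))"
      by (rule trace_mul_sym)
    also have "\<dots> = T s" by (simp add: matrix_mul_assoc BBt trace_diagonal T_def)
    finally show ?thesis .
  qed
  define q where "q = (\<lambda>s (Y :: real^'p^'m). (1 - s) * (norm Y)\<^sup>2 + s * ((Y ** A) \<bullet> Y))"
  have q_As: "(Y ** As s) \<bullet> Y = q s Y" for s Y
    by (simp add: As_eq q_def matrix_mult_bilinear inner_add_left power2_norm_eq_inner)
  \<comment> \<open>\<open>h s\<close> is \<open>|A\<^sub>s|\<^sup>m\<^sup>/\<^sup>2\<close> times the Gaussian weight of \<open>A\<^sub>s\<close>, and \<open>h' s\<close> its derivative in \<open>s\<close>.\<close>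
  define h where "h = (\<lambda>s Y. exp (m / 2 * (\<Sum>i\<in>UNIV. ln (a s i)) - q s Y / 2))"
  define h' where "h' = (\<lambda>s Y. h s Y * (m / 2 * T s - ((Y ** A) \<bullet> Y - (norm Y)\<^sup>2) / 2))"
  have q_diff: "(Y ** (A - mat 1)) \<bullet> Y = (Y ** A) \<bullet> Y - (norm Y)\<^sup>2" for Y :: "real^'p^'m"
    by (simp add: matrix_mult_bilinear inner_diff_left power2_norm_eq_inner)
  have h_As: "h s Y = exp (m / 2 * (\<Sum>i\<in>UNIV. ln (a s i))) * exp (- ((Y ** As s) \<bullet> Y) / 2)" for s Y
    by (simp add: h_def q_As exp_add[symmetric])
  have int_w: "integrable lborel (\<lambda>Y :: real^'p^'m. exp (- ((Y ** As s) \<bullet> Y) / 2))" if "s \<in> {0..1}" for s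
    using integrable_polynomial_mult_gauss[OF As_pd[OF that], of "\<lambda>_. 1" 1 "0 :: real^'p^'m"] by simp
  have int_qw: "integrable lborel (\<lambda>Y :: real^'p^'m. ((Y ** (A - mat 1)) \<bullet> Y) * exp (- ((Y ** As s) \<bullet> Y) / 2))" if "s \<in> {0..1}" for s
    using integrable_gauss_quadratic[OF As_pd[OF that], of "0 :: real^'p^'m"] by simp
  have h'_As: "h' s Y = exp (m / 2 * (\<Sum>i\<in>UNIV. ln (a s i))) * (m / 2 * T s * exp (- ((Y ** As s) \<bullet> Y) / 2)
      - 1 / 2 * (((Y ** (A - mat 1)) \<bullet> Y) * exp (- ((Y ** As s) \<bullet> Y) / 2)))" for s Y
  proof -
    have "e * w * (c - d / 2) = e * (c * w - 1 / 2 * (d * w))" for e w c d :: real by (simp add: algebra_simps)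
    then show ?thesis unfolding h'_def h_As q_diff .
  qed
  have h'_zero: "(LINT Y|lborel. h' s Y) = 0" if s: "s \<in> {0..1}" for s
  proof -
    have "(LINT Y|lborel. ((Y ** (A - mat 1)) \<bullet> (Y :: real^'p^'m)) * exp (- ((Y ** As s) \<bullet> Y) / 2))
      = m * T s * (LINT Y|lborel. exp (- ((Y ** As s) \<bullet> (Y :: real^'p^'m)) / 2))"
      using gauss_second_moment_unnormalized[OF As_pd[OF s], of "0 :: real^'p^'m" "A - mat 1"] trace_As[OF s]
      by (simp add: m_def)
    then show ?thesis unfolding h'_As using int_w[OF s] int_qw[OF s] by simp
  qed
  have h_int: "integrable lborel (h s)" if "s \<in> {0..1}" for s
    unfolding h_As[abs_def] using int_w[OF that] by simp
  obtain c where c: "0 < c" "\<And>x. c * (norm x)\<^sup>2 \<le> x \<bullet> (A *v x)"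
    by (rule pos_def_matrix_coercive[OF A]) blast
  define d where "d = min 1 c"
  have d0: "0 < d" using c by (simp add: d_def)
  have coer: "d * (norm Y)\<^sup>2 \<le> q s Y" if "s \<in> {0..1}" for s Y
  proof -
    have "c * (norm Y)\<^sup>2 \<le> (Y ** A) \<bullet> Y" by (rule matrix_quadratic_coercive[OF c(2)])
    then have "d * (norm Y)\<^sup>2 \<le> (Y ** A) \<bullet> Y" using order_trans[OF mult_right_mono[of d c "(norm Y)\<^sup>2"]] by (simp add: d_def)
    then have "s * (d * (norm Y)\<^sup>2) \<le> s * ((Y ** A) \<bullet> Y)" using that by (intro mult_left_mono) auto
    moreover have "(1 - s) * (d * (norm Y)\<^sup>2) \<le> (1 - s) * (norm Y)\<^sup>2"
      using that mult_right_mono[of d 1 "(norm Y)\<^sup>2"] by (intro mult_left_mono) (auto simp: d_def)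
    ultimately show ?thesis unfolding q_def by (simp add: algebra_simps)
  qed
  define R where "R = (\<Sum>i\<in>UNIV. r $ i)"
  define V where "V = (\<Sum>i\<in>UNIV. \<bar>r $ i - 1\<bar> / min 1 (r $ i))"
  define L where "L = m / 2 * V + norm A + 1"
  have m0: "0 \<le> m" by (simp add: m_def)
  have V0: "0 \<le> V" unfolding V_def using r0 by (intro sum_nonneg divide_nonneg_nonneg) (auto simp: less_imp_le)
  have L0: "0 \<le> L" unfolding L_def using V0 m0 by simp
  \<comment> \<open>A bound of \<open>h'\<close> that does not depend on \<open>s\<close>, from \<open>log a \<le> a - 1\<close> and \<open>a s i \<ge> min 1 r\<^sub>i\<close>.\<close>
  have h'_bound: "\<bar>h' s Y\<bar> \<le> exp (m / 2 * R) * (L * (1 + (norm Y)\<^sup>2) * exp (- (d / 2) * (norm Y)\<^sup>2))"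
    if s: "s \<in> {0..1}" for s Y
  proof -
    have "(\<Sum>i\<in>UNIV. ln (a s i)) \<le> R" unfolding R_def
    proof (rule sum_mono)
      fix i
      have "ln (a s i) \<le> a s i - 1" using a0[of s i] s by (intro ln_le_minus_one) auto
      then show "ln (a s i) \<le> r $ i" using a_le[of s i] s by simp
    qed
    then have "m / 2 * (\<Sum>i\<in>UNIV. ln (a s i)) \<le> m / 2 * R" using m0 by (intro mult_left_mono) auto
    then have h1: "h s Y \<le> exp (m / 2 * R) * exp (- (d / 2) * (norm Y)\<^sup>2)"
      using coer[OF s, of Y] unfolding h_def by (simp add: exp_add[symmetric])
    have "\<bar>T s\<bar> \<le> V" unfolding T_def V_def
    proof (rule order_trans[OF sum_abs sum_mono])
      fix i
      have "min 1 (r $ i) \<le> a s i"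
      proof -
        have "(1 - s) * min 1 (r $ i) + s * min 1 (r $ i) \<le> (1 - s) * 1 + s * r $ i"
          using s by (intro add_mono mult_left_mono) auto
        then show ?thesis by (simp add: a_def algebra_simps)
      qed
      then show "\<bar>(r $ i - 1) / a s i\<bar> \<le> \<bar>r $ i - 1\<bar> / min 1 (r $ i)"
        using a0[of s i] s r0[of i] unfolding abs_divide by (intro frac_le) auto
    qed
    then have 1: "\<bar>m / 2 * T s\<bar> \<le> m / 2 * V" using m0 by (simp add: abs_mult mult_left_mono)
    have "\<bar>(Y ** A) \<bullet> Y\<bar> \<le> norm (Y ** A) * norm Y" by (rule Cauchy_Schwarz_ineq2)
    also have "\<dots> \<le> norm Y * norm A * norm Y" by (intro mult_right_mono norm_matrix_mult_le) auto
    finally have 2: "\<bar>(Y ** A) \<bullet> Y\<bar> \<le> norm A * (norm Y)\<^sup>2" by (simp add: power2_eq_square mult_ac)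
    have "\<bar>m / 2 * T s - ((Y ** A) \<bullet> Y - (norm Y)\<^sup>2) / 2\<bar> \<le> m / 2 * V + norm A * (norm Y)\<^sup>2 + (norm Y)\<^sup>2"
    proof -
      have "\<bar>a\<bar> \<le> u \<Longrightarrow> \<bar>b\<bar> \<le> v \<Longrightarrow> 0 \<le> n \<Longrightarrow> \<bar>a - (b - n) / 2\<bar> \<le> u + v + n" for a b u v n :: real
        unfolding abs_le_iff diff_divide_distrib by (elim conjE, intro conjI) linarith+
      then show ?thesis using 1 2 zero_le_power2[of "norm Y"] by blast
    qed
    also have "\<dots> \<le> L * (1 + (norm Y)\<^sup>2)"
      unfolding L_def using V0 m0 by (simp add: algebra_simps)
    finally have 3: "\<bar>m / 2 * T s - ((Y ** A) \<bullet> Y - (norm Y)\<^sup>2) / 2\<bar> \<le> L * (1 + (norm Y)\<^sup>2)" .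
    have "\<bar>h' s Y\<bar> = h s Y * \<bar>m / 2 * T s - ((Y ** A) \<bullet> Y - (norm Y)\<^sup>2) / 2\<bar>"
      unfolding h'_def by (simp add: abs_mult h_def)
    also have "\<dots> \<le> (exp (m / 2 * R) * exp (- (d / 2) * (norm Y)\<^sup>2)) * (L * (1 + (norm Y)\<^sup>2))"
      using h1 3 by (intro mult_mono) auto
    finally show ?thesis by (simp add: mult_ac)
  qed
  have dom: "integrable lborel (\<lambda>Y :: real^'p^'m. exp (m / 2 * R) * (L * (1 + (norm Y)\<^sup>2) * exp (- (d / 2) * (norm Y)\<^sup>2)))"
  proof (rule integrable_mult_right, rule integrable_polynomial_gauss[of _ "d / 2" L])
    fix Y :: "real^'p^'m"
    have "1 + (norm Y)\<^sup>2 \<le> (1 + (norm Y)\<^sup>2)\<^sup>2" using self_le_power[of "1 + (norm Y)\<^sup>2" 2] by simp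
    then have "L * (1 + (norm Y)\<^sup>2) * exp (- (d / 2) * (norm Y)\<^sup>2) \<le> L * (1 + (norm Y)\<^sup>2)\<^sup>2 * exp (- (d / 2) * (norm Y)\<^sup>2)"
      using L0 by (intro mult_right_mono mult_left_mono) auto
    then show "\<bar>L * (1 + (norm Y)\<^sup>2) * exp (- (d / 2) * (norm Y)\<^sup>2)\<bar> \<le> L * (1 + (norm Y)\<^sup>2)\<^sup>2 * exp (- (d / 2) * (norm Y)\<^sup>2)"
      using L0 by (simp add: abs_mult)
  qed (use d0 in auto)
  have "(LINT Y|lborel. h 1 Y - h 0 Y) = (LINT s|lborel. indicator {0..1} s * (LINT Y|lborel. h' s Y))"
  proof (rule integral_increment)
    show "(\<lambda>(s, Y). h' s Y) \<in> borel_measurable (lborel \<Otimes>\<^sub>M lborel)"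
      unfolding h'_def h_def T_def q_def a_def by measurable
    show int_h': "integrable lborel (h' s)" if "s \<in> {0..1}" for s
      unfolding h'_As[abs_def] using int_w[OF that] int_qw[OF that]
      by (intro integrable_mult_right Bochner_Integration.integrable_diff)
    show "(LINT Y|lborel. \<bar>h' s Y\<bar>) \<le> (LINT Y|lborel. exp (m / 2 * R) * (L * (1 + (norm (Y :: real^'p^'m))\<^sup>2) * exp (- (d / 2) * (norm Y)\<^sup>2)))"
      if "s \<in> {0..1}" for s
      using int_h'[OF that] dom h'_bound[OF that] by (intro integral_mono) auto
    fix Y :: "real^'p^'m"
    have T_cont: "continuous_on {0..1} (\<lambda>s. a s i)" for i unfolding a_def by (intro continuous_intros)
    have a_nz: "\<forall>s\<in>{0..1}. a s i \<noteq> 0" for i using a0 by (force simp: less_imp_neq[symmetric])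
    show "continuous_on {0..1} (\<lambda>s. h' s Y)"
      unfolding h'_def h_def T_def q_def by (intro continuous_intros T_cont a_nz) auto
    fix s :: real assume s: "0 \<le> s" "s \<le> 1"
    have "((\<lambda>s. ln (a s i)) has_real_derivative (r $ i - 1) / a s i) (at s)" for i
      unfolding a_def using a0[OF s, of i] by (auto intro!: derivative_eq_intros simp: a_def divide_inverse)
    then have DT: "((\<lambda>s. \<Sum>i\<in>UNIV. ln (a s i)) has_real_derivative T s) (at s)"
      unfolding T_def by (intro DERIV_sum)
    have Dq: "((\<lambda>s. q s Y) has_real_derivative ((Y ** A) \<bullet> Y - (norm Y)\<^sup>2)) (at s)"
      unfolding q_def by (auto intro!: derivative_eq_intros)
    have "((\<lambda>s. m / 2 * (\<Sum>i\<in>UNIV. ln (a s i)) - q s Y / 2) has_real_derivative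
        (m / 2 * T s - ((Y ** A) \<bullet> Y - (norm Y)\<^sup>2) / 2)) (at s)"
      by (intro DERIV_diff DERIV_cmult DERIV_cdivide DT Dq)
    from DERIV_fun_exp[OF this] show "((\<lambda>s. h s Y) has_real_derivative h' s Y) (at s)"
      unfolding h_def h'_def .
  qed
  also have "\<dots> = 0" using h'_zero by (intro integral_eq_zero_AE AE_I2) (auto simp: indicator_def)
  finally have "(LINT Y|lborel. h 1 Y) = (LINT Y|lborel. h 0 Y)"
    using h_int[of 0] h_int[of 1] by simp
  also have "(LINT Y|lborel. h 0 Y) = (2 * pi) powr (m * real CARD('p) / 2)"
  proof -
    have "h 0 = (\<lambda>Y. exp (- (1 / 2) * (norm Y)\<^sup>2))" by (rule ext) (simp add: h_def a_def q_def)
    then have "(LINT Y|lborel. h 0 Y) = sqrt (2 * pi) ^ DIM(real^'p^'m)"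
      using has_bochner_integral_gauss[of "1/2", where 'a="real^'p^'m"] by (simp add: has_bochner_integral_iff mult.commute)
    also have "\<dots> = (2 * pi) powr (m * real CARD('p) / 2)"
      by (simp add: powr_half_sqrt[symmetric] powr_realpow[symmetric] powr_powr m_def)
    finally show ?thesis .
  qed
  also have "(LINT Y|lborel. h 1 Y) = det A powr (m / 2) * (LINT Y|lborel. exp (- ((Y ** A) \<bullet> (Y :: real^'p^'m)) / 2))"
  proof -
    have A1: "As 1 = A" by (simp add: As_eq)
    have "(\<Sum>i\<in>UNIV. ln (a 1 i)) = ln (det A)"
      unfolding B(3) det_congruence_diagonal[OF B(2)] using r0 less_imp_neq[OF r0] by (subst ln_prod) (auto simp: a_def)
    moreover have "0 < det A" unfolding B(3) det_congruence_diagonal[OF B(2)] using r0 by (intro prod_pos) auto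
    ultimately have "h 1 Y = det A powr (m / 2) * exp (- ((Y ** A) \<bullet> Y) / 2)" for Y
      unfolding h_As A1 by (simp add: powr_def)
    then show ?thesis by simp
  qed
  moreover have "0 < det A" unfolding B(3) det_congruence_diagonal[OF B(2)] using r0 by (intro prod_pos) auto
  ultimately show ?thesis by (simp add: powr_minus field_simps m_def)
qed

section \<open>The matrix normal distribution\<close>

lemma pos_def_matrix_factor:
  fixes A :: "real^'p^'p"
  assumes "pos_def_matrix A"
  obtains B :: "real^'p^'p" where "invertible B" "A = transpose B ** B"
proof -
  obtain B :: "real^'p^'p" and r where "invertible B" "A = transpose B ** B" "A = transpose B ** diagonal r ** B"
    by (rule simultaneous_diagonalization[OF assms pos_def_matrix_symmetric[OF assms]])
  then show thesis by (intro that)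
qed

lemma pos_def_matrix_det_pos:
  fixes A :: "real^'p^'p"
  assumes "pos_def_matrix A" shows "0 < det A"
proof -
  obtain B :: "real^'p^'p" where B: "invertible B" "A = transpose B ** B" by (rule pos_def_matrix_factor[OF assms])
  have "det B \<noteq> 0" using B(1) by (simp add: invertible_det_nz)
  then show ?thesis unfolding B(2) by (simp add: det_mul zero_less_mult_iff linorder_neq_iff disj_commute)
qed

lemma pos_def_matrix_inverse:
  fixes A :: "real^'p^'p"
  assumes "pos_def_matrix A" shows "pos_def_matrix (matrix_inv A)"
proof -
  note inv = pos_def_matrix_invertible[OF assms]
  have "transpose (matrix_inv A) ** A = mat 1"
    by (metis assms matrix_inv_right[OF inv] matrix_transpose_mul pos_def_matrix_symmetric transpose_mat)
  then have sym: "transpose (matrix_inv A) = matrix_inv A"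
    by (metis matrix_inv_right[OF inv] matrix_mul_assoc matrix_mul_lid matrix_mul_rid)
  have "invertible (matrix_inv A)" using matrix_inv_right[OF inv] invertible_left_inverse by blast
  then have "pos_def_matrix (transpose (matrix_inv A) ** A ** matrix_inv A)"
    by (rule pos_def_matrix_congruence[OF assms])
  moreover have "transpose (matrix_inv A) ** A ** matrix_inv A = matrix_inv A"
    unfolding sym matrix_inv_left[OF inv] by simp
  ultimately show ?thesis by simp
qed

lemma det_matrix_inv:
  fixes A :: "real^'p^'p"
  assumes "invertible A" shows "det (matrix_inv A) = 1 / det A"
proof -
  have "det A * det (matrix_inv A) = 1" by (metis det_mul det_I matrix_inv_right[OF assms])
  then show ?thesis by (metis mult_zero_left nonzero_eq_divide_eq mult.commute zero_neq_one)
qed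

lemma matrix_normal_density_eq:
  "matrix_normal_density \<Theta> \<Sigma> (Y :: real^'p^'m) =
    ((2 * pi) powr (- (real CARD('m) * real CARD('p) / 2)) * det \<Sigma> powr (- (real CARD('m) / 2))) *
      gauss_weight \<Theta> (matrix_inv \<Sigma>) Y"
  unfolding matrix_normal_density_def trace_quadratic by simp

lemma matrix_normal_density_pos:
  "pos_def_matrix \<Sigma> \<Longrightarrow> 0 < matrix_normal_density \<Theta> \<Sigma> Y"
  using pos_def_matrix_det_pos[of \<Sigma>] by (simp add: matrix_normal_density_eq)

lemma matrix_normal_density_nonneg: "0 \<le> matrix_normal_density \<Theta> \<Sigma> Y"
  by (simp add: matrix_normal_density_eq)

lemma borel_measurable_matrix_normal_density [measurable]:
  "matrix_normal_density \<Theta> \<Sigma> \<in> borel_measurable borel"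
  unfolding matrix_normal_density_eq[abs_def] by measurable

lemma sets_matrix_normal [measurable_cong, simp]: "sets (matrix_normal \<Theta> \<Sigma>) = sets borel"
  by (simp add: matrix_normal_def)

lemma space_matrix_normal [simp]: "space (matrix_normal \<Theta> \<Sigma>) = UNIV"
  by (simp add: matrix_normal_def)

lemma integral_matrix_normal:
  fixes f :: "real^'p^'m \<Rightarrow> real"
  assumes [measurable]: "f \<in> borel_measurable borel"
  shows "(LINT Y|matrix_normal \<Theta> \<Sigma>. f Y) = (LINT Y|lborel. f Y * matrix_normal_density \<Theta> \<Sigma> Y)"
  unfolding matrix_normal_def
  by (subst integral_density) (auto simp: matrix_normal_density_nonneg mult.commute)

lemma integrable_matrix_normal:
  fixes f :: "real^'p^'m \<Rightarrow> real"
  assumes [measurable]: "f \<in> borel_measurable borel"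
  shows "integrable (matrix_normal \<Theta> \<Sigma>) f \<longleftrightarrow> integrable lborel (\<lambda>Y. f Y * matrix_normal_density \<Theta> \<Sigma> Y)"
  unfolding matrix_normal_def
  by (subst integrable_density) (auto simp: matrix_normal_density_nonneg mult.commute)

lemma integral_matrix_normal_density:
  fixes \<Theta> :: "real^'p^'m"
  assumes S: "pos_def_matrix \<Sigma>"
  shows "(LINT Y|lborel. matrix_normal_density \<Theta> \<Sigma> Y) = 1" "integrable lborel (matrix_normal_density \<Theta> \<Sigma>)"
proof -
  note A = pos_def_matrix_inverse[OF S]
  show "integrable lborel (matrix_normal_density \<Theta> \<Sigma>)"
    unfolding matrix_normal_density_eq[abs_def]
    using integrable_polynomial_mult_gauss[OF A, of "\<lambda>_. 1" 1 \<Theta>] by simp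
  have "(LINT Y|lborel. gauss_weight \<Theta> (matrix_inv \<Sigma>) Y)
    = (LINT Y|lborel. exp (- ((Y ** matrix_inv \<Sigma>) \<bullet> (Y :: real^'p^'m)) / 2))"
    using integral_translation(1)[of "\<lambda>Y. exp (- ((Y ** matrix_inv \<Sigma>) \<bullet> (Y :: real^'p^'m)) / 2)" "- \<Theta>"] by simp
  also note gauss_integral[OF A]
  also have "det (matrix_inv \<Sigma>) powr (- (real CARD('m) / 2)) = det \<Sigma> powr (real CARD('m) / 2)"
    using pos_def_matrix_det_pos[OF S]
    by (simp add: det_matrix_inv pos_def_matrix_invertible[OF S] powr_divide powr_minus field_simps)
  finally show "(LINT Y|lborel. matrix_normal_density \<Theta> \<Sigma> Y) = 1"
    unfolding matrix_normal_density_eq[abs_def] using pos_def_matrix_det_pos[OF S]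
    by (simp add: powr_minus field_simps)
qed

lemma prob_space_matrix_normal:
  assumes S: "pos_def_matrix \<Sigma>"
  shows "prob_space (matrix_normal \<Theta> \<Sigma>)"
proof
  have "emeasure (matrix_normal \<Theta> \<Sigma>) UNIV = (\<integral>\<^sup>+Y. ennreal (matrix_normal_density \<Theta> \<Sigma> Y) \<partial>lborel)"
    by (simp add: matrix_normal_def emeasure_density)
  also have "\<dots> = 1"
    using integral_matrix_normal_density[OF S, of \<Theta>]
    by (subst nn_integral_eq_integral) (auto simp: matrix_normal_density_nonneg)
  finally show "emeasure (matrix_normal \<Theta> \<Sigma>) (space (matrix_normal \<Theta> \<Sigma>)) = 1" by simp
qed

lemma integrable_matrix_normal_polynomial:
  fixes f :: "real^'p^'m \<Rightarrow> real"
  assumes S: "pos_def_matrix \<Sigma>" and [measurable]: "f \<in> borel_measurable borel"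
    and f: "\<And>Y. \<bar>f Y\<bar> \<le> C * (1 + (norm Y)\<^sup>2)\<^sup>2"
  shows "integrable (matrix_normal \<Theta> \<Sigma>) f"
proof -
  define k where "k = (2 * pi) powr (- (real CARD('m) * real CARD('p) / 2)) * det \<Sigma> powr (- (real CARD('m) / 2))"
  have "integrable lborel (\<lambda>Y. k * (f Y * gauss_weight \<Theta> (matrix_inv \<Sigma>) Y))"
    by (intro integrable_mult_right integrable_polynomial_mult_gauss[OF pos_def_matrix_inverse[OF S] _ f]) measurable
  then show ?thesis by (simp add: integrable_matrix_normal matrix_normal_density_eq k_def mult_ac)
qed

text \<open>
  Stein's identity: under \<open>N (\<Theta>, I \<otimes> \<Sigma>)\<close>, the inner product of a field with
  \<open>(Y - \<Theta>) \<Sigma>\<^sup>-\<^sup>1\<close> has the same expectation as the divergence of the field.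
\<close>

lemma matrix_normal_stein:
  fixes \<Theta> :: "real^'p^'m" and G :: "real^'p^'m \<Rightarrow> real^'p^'m"
  assumes S: "pos_def_matrix \<Sigma>"
    and G: "continuous_on UNIV G" and DG: "\<And>b. b \<in> Basis \<Longrightarrow> continuous_on UNIV (DG b)"
    and der: "\<And>b Y. b \<in> Basis \<Longrightarrow> ((\<lambda>t. G (Y + t *\<^sub>R b)) has_vector_derivative DG b Y) (at 0)"
    and Gb: "\<And>Y. norm (G Y) \<le> C * (1 + (norm Y)\<^sup>2)"
    and DGb: "\<And>b Y. b \<in> Basis \<Longrightarrow> norm (DG b Y) \<le> C * (1 + (norm Y)\<^sup>2)"
  shows "(LINT Y|matrix_normal \<Theta> \<Sigma>. ((Y - \<Theta>) ** matrix_inv \<Sigma>) \<bullet> G Y)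
    = (LINT Y|matrix_normal \<Theta> \<Sigma>. (\<Sum>b\<in>Basis. DG b Y \<bullet> b))"
proof -
  define k where "k = (2 * pi) powr (- (real CARD('m) * real CARD('p) / 2)) * det \<Sigma> powr (- (real CARD('m) / 2))"
  have k: "f * matrix_normal_density \<Theta> \<Sigma> Y = k * (f * gauss_weight \<Theta> (matrix_inv \<Sigma>) Y)" for f Y
    by (simp add: matrix_normal_density_eq k_def mult_ac)
  have [measurable]: "G \<in> borel_measurable borel" by (rule borel_measurable_continuous_onI[OF G])
  have [measurable]: "(\<lambda>Y. \<Sum>b\<in>Basis. DG b Y \<bullet> b) \<in> borel_measurable borel"
    by (intro borel_measurable_continuous_onI continuous_intros DG)
  show ?thesis
    using stein_unnormalized[OF pos_def_matrix_inverse[OF S] G DG der Gb DGb, of \<Theta>]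
    by (simp add: integral_matrix_normal k)
qed

lemma matrix_normal_second_moment:
  fixes \<Theta> :: "real^'p^'m"
  assumes S: "pos_def_matrix \<Sigma>"
  shows "(LINT Y|matrix_normal \<Theta> \<Sigma>. ((Y - \<Theta>) ** H) \<bullet> (Y - \<Theta>)) = real CARD('m) * trace (H ** \<Sigma>)"
    and "integrable (matrix_normal \<Theta> \<Sigma>) (\<lambda>Y. ((Y - \<Theta>) ** H) \<bullet> (Y - \<Theta>))"
proof -
  note A = pos_def_matrix_inverse[OF S]
  define k where "k = (2 * pi) powr (- (real CARD('m) * real CARD('p) / 2)) * det \<Sigma> powr (- (real CARD('m) / 2))"
  have k: "matrix_normal_density \<Theta> \<Sigma> Y = k * gauss_weight \<Theta> (matrix_inv \<Sigma>) Y" for Y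
    by (simp add: matrix_normal_density_eq k_def)
  have inv_inv: "matrix_inv (matrix_inv \<Sigma>) = \<Sigma>"
    by (intro matrix_inv_eqI matrix_inv_left pos_def_matrix_invertible S)
  have mass: "k * (LINT Y|lborel. gauss_weight \<Theta> (matrix_inv \<Sigma>) Y) = 1"
    using integral_matrix_normal_density(1)[OF S, of \<Theta>] unfolding k[abs_def] by simp
  have 1: "f * (k * e) = k * (f * e)" for f e :: real by simp
  have "(LINT Y|matrix_normal \<Theta> \<Sigma>. ((Y - \<Theta>) ** H) \<bullet> (Y - \<Theta>))
    = (LINT Y|lborel. (((Y - \<Theta>) ** H) \<bullet> (Y - \<Theta>)) * matrix_normal_density \<Theta> \<Sigma> Y)"
    by (rule integral_matrix_normal) measurable
  also have "\<dots> = k * (LINT Y|lborel. (((Y - \<Theta>) ** H) \<bullet> (Y - \<Theta>)) * gauss_weight \<Theta> (matrix_inv \<Sigma>) Y)"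
    unfolding k 1 by (rule integral_mult_right_zero)
  also have "\<dots> = real CARD('m) * trace (H ** \<Sigma>) * (k * (LINT Y|lborel. gauss_weight \<Theta> (matrix_inv \<Sigma>) Y))"
    unfolding gauss_second_moment_unnormalized[OF A] inv_inv by (simp only: mult_ac)
  finally show "(LINT Y|matrix_normal \<Theta> \<Sigma>. ((Y - \<Theta>) ** H) \<bullet> (Y - \<Theta>)) = real CARD('m) * trace (H ** \<Sigma>)"
    unfolding mass by simp
  show "integrable (matrix_normal \<Theta> \<Sigma>) (\<lambda>Y. ((Y - \<Theta>) ** H) \<bullet> (Y - \<Theta>))"
    using integrable_gauss_quadratic[OF A, of \<Theta> H] unfolding k by (subst integrable_matrix_normal) (simp_all add: k 1)
qed

lemma matrix_normal_first_moment:
  fixes \<Theta> D :: "real^'p^'m"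
  assumes S: "pos_def_matrix \<Sigma>"
  shows "(LINT Y|matrix_normal \<Theta> \<Sigma>. D \<bullet> (Y - \<Theta>)) = 0"
    and "integrable (matrix_normal \<Theta> \<Sigma>) (\<lambda>Y. D \<bullet> (Y - \<Theta>))"
proof -
  note inv = pos_def_matrix_invertible[OF S]
  let ?G = "\<lambda>Y :: real^'p^'m. D ** \<Sigma>"
  let ?DG = "\<lambda>(b :: real^'p^'m) (Y :: real^'p^'m). 0 :: real^'p^'m"
  have "(LINT Y|matrix_normal \<Theta> \<Sigma>. ((Y - \<Theta>) ** matrix_inv \<Sigma>) \<bullet> ?G Y)
    = (LINT Y|matrix_normal \<Theta> \<Sigma>. (\<Sum>b\<in>Basis. ?DG b Y \<bullet> b))"
  proof (rule matrix_normal_stein[where G = ?G and DG = ?DG and C = "norm (D ** \<Sigma>)", OF S])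
    fix Y :: "real^'p^'m"
    have "norm (D ** \<Sigma>) * 1 \<le> norm (D ** \<Sigma>) * (1 + (norm Y)\<^sup>2)" by (intro mult_left_mono) auto
    then show "norm (D ** \<Sigma>) \<le> norm (D ** \<Sigma>) * (1 + (norm Y)\<^sup>2)" by simp
  qed auto
  moreover have "((Y - \<Theta>) ** matrix_inv \<Sigma>) \<bullet> (D ** \<Sigma>) = D \<bullet> (Y - \<Theta>)" for Y
  proof -
    have "((Y - \<Theta>) ** matrix_inv \<Sigma>) \<bullet> (D ** \<Sigma>) = ((D ** \<Sigma>) ** matrix_inv \<Sigma>) \<bullet> (Y - \<Theta>)"
      by (rule inner_matrix_symmetric[OF pos_def_matrix_symmetric[OF pos_def_matrix_inverse[OF S]]])
    then show ?thesis by (simp add: matrix_mul_assoc[symmetric] matrix_inv_right[OF inv])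
  qed
  ultimately show "(LINT Y|matrix_normal \<Theta> \<Sigma>. D \<bullet> (Y - \<Theta>)) = 0" by simp
  show "integrable (matrix_normal \<Theta> \<Sigma>) (\<lambda>Y. D \<bullet> (Y - \<Theta>))"
  proof (rule integrable_matrix_normal_polynomial[OF S])
    fix Y :: "real^'p^'m"
    have "\<bar>D \<bullet> (Y - \<Theta>)\<bar> \<le> norm D * norm (Y - \<Theta>)" by (rule Cauchy_Schwarz_ineq2)
    also have "\<dots> \<le> norm D * ((1 + norm \<Theta>) * (1 + (norm Y)\<^sup>2))" by (intro mult_left_mono norm_diff_le_quadratic) auto
    also have "\<dots> \<le> norm D * ((1 + norm \<Theta>) * (1 + (norm Y)\<^sup>2)\<^sup>2)"
      using self_le_power[of "1 + (norm Y)\<^sup>2" 2] by (intro mult_left_mono) auto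
    finally show "\<bar>D \<bullet> (Y - \<Theta>)\<bar> \<le> norm D * (1 + norm \<Theta>) * (1 + (norm Y)\<^sup>2)\<^sup>2" by (simp add: mult_ac)
  qed measurable
qed

section \<open>The Kullback-Leibler loss in closed form\<close>

definition kl_formula :: "real^'p^'m \<Rightarrow> real^'p^'p \<Rightarrow> real^'p^'m \<Rightarrow> real^'p^'p \<Rightarrow> real" where
  "kl_formula \<Theta>h \<Sigma>h \<Theta> \<Sigma> =
     real CARD('m) / 2 * (trace (matrix_inv \<Sigma> ** \<Sigma>h) - ln (det \<Sigma>h) + ln (det \<Sigma>) - real CARD('p))
     + ((\<Theta>h - \<Theta>) ** matrix_inv \<Sigma>) \<bullet> (\<Theta>h - \<Theta>) / 2"

text \<open>
  The logarithm of the density ratio is a quadratic polynomial in \<open>Y\<close>, so only the mass and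
  the first two moments of the estimated distribution are needed.
\<close>

lemma kl_loss_eq:
  fixes \<Theta>h \<Theta> :: "real^'p^'m"
  assumes S: "pos_def_matrix \<Sigma>" and Sh: "pos_def_matrix \<Sigma>h"
  shows "kl_loss (\<Theta>h, \<Sigma>h) \<Theta> \<Sigma> = kl_formula \<Theta>h \<Sigma>h \<Theta> \<Sigma>"
proof -
  interpret prob_space "matrix_normal \<Theta>h \<Sigma>h" by (rule prob_space_matrix_normal[OF Sh])
  define Q where "Q = (\<lambda>Y. ((Y - \<Theta>h) ** matrix_inv \<Sigma>) \<bullet> (Y - \<Theta>h))"
  define Qh where "Qh = (\<lambda>Y. ((Y - \<Theta>h) ** matrix_inv \<Sigma>h) \<bullet> (Y - \<Theta>h))"
  define D where "D = (\<Theta>h - \<Theta>) ** matrix_inv \<Sigma>"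
  define c where "c = real CARD('m) / 2 * (ln (det \<Sigma>) - ln (det \<Sigma>h)) + (D \<bullet> (\<Theta>h - \<Theta>)) / 2"
  note dets = pos_def_matrix_det_pos[OF S] pos_def_matrix_det_pos[OF Sh]
  note sym = pos_def_matrix_symmetric[OF pos_def_matrix_inverse[OF S]]
  have "ln (matrix_normal_density \<Theta>h \<Sigma>h Y / matrix_normal_density \<Theta> \<Sigma> Y)
    = c - Qh Y / 2 + Q Y / 2 + D \<bullet> (Y - \<Theta>h)" for Y
  proof -
    have q: "((Y - \<Theta>) ** matrix_inv \<Sigma>) \<bullet> (Y - \<Theta>) = Q Y + 2 * (D \<bullet> (Y - \<Theta>h)) + D \<bullet> (\<Theta>h - \<Theta>)"
    proof -
      have "Y - \<Theta> = (Y - \<Theta>h) + (\<Theta>h - \<Theta>)" by simp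
      moreover have "((Y - \<Theta>h) ** matrix_inv \<Sigma>) \<bullet> (\<Theta>h - \<Theta>) = D \<bullet> (Y - \<Theta>h)"
        unfolding D_def by (rule inner_matrix_symmetric[OF sym])
      ultimately show ?thesis
        by (simp only: bounded_bilinear.add_left[OF bounded_bilinear_matrix_mult] inner_add_left inner_add_right Q_def D_def)
    qed
    have "ln (matrix_normal_density \<Theta>h \<Sigma>h Y / matrix_normal_density \<Theta> \<Sigma> Y)
      = ln (matrix_normal_density \<Theta>h \<Sigma>h Y) - ln (matrix_normal_density \<Theta> \<Sigma> Y)"
      by (rule ln_divide_pos) (use matrix_normal_density_pos S Sh in auto)
    also have "\<dots> = c - Qh Y / 2 + Q Y / 2 + D \<bullet> (Y - \<Theta>h)"
      unfolding matrix_normal_density_eq q c_def Qh_def using dets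
      by (simp add: ln_mult ln_powr field_simps)
    finally show ?thesis .
  qed
  then have "kl_loss (\<Theta>h, \<Sigma>h) \<Theta> \<Sigma> = expectation (\<lambda>Y. c - Qh Y / 2 + Q Y / 2 + D \<bullet> (Y - \<Theta>h))"
    unfolding kl_loss_def by (simp add: integral_matrix_normal Q_def Qh_def)
  also have "\<dots> = c - expectation Qh / 2 + expectation Q / 2"
    using matrix_normal_second_moment(2)[OF Sh, of \<Theta>h] matrix_normal_first_moment[OF Sh, of \<Theta>h D]
    by (simp add: Q_def Qh_def prob_space[simplified])
  also have "expectation Qh = real CARD('m) * real CARD('p)"
    unfolding Qh_def matrix_normal_second_moment(1)[OF Sh]
    by (simp add: matrix_inv_left pos_def_matrix_invertible[OF Sh] trace_I)
  also have "expectation Q = real CARD('m) * trace (matrix_inv \<Sigma> ** \<Sigma>h)"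
    unfolding Q_def matrix_normal_second_moment(1)[OF Sh] ..
  finally show ?thesis unfolding kl_formula_def c_def D_def by (simp add: field_simps)
qed

text \<open>
  In the eigenvalues \<open>r\<^sub>i\<close> of \<open>\<Sigma>\<^sup>-\<^sup>1 \<Sigma>h\<close> the first part is the sum of \<open>r\<^sub>i - log r\<^sub>i - 1\<close>.
\<close>

lemma kl_formula_nonneg:
  fixes \<Theta>h \<Theta> :: "real^'p^'m"
  assumes S: "pos_def_matrix \<Sigma>" and Sh: "pos_def_matrix \<Sigma>h"
  shows "0 \<le> kl_formula \<Theta>h \<Sigma>h \<Theta> \<Sigma>"
proof -
  obtain B :: "real^'p^'p" and r where B: "invertible B" "\<Sigma> = transpose B ** B" "\<Sigma>h = transpose B ** diagonal r ** B"
    by (rule simultaneous_diagonalization[OF S pos_def_matrix_symmetric[OF Sh]])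
  have r: "0 < r $ i" for i using Sh unfolding B(3) pos_def_matrix_diagonal[OF B(1)] by blast
  have "trace (matrix_inv \<Sigma> ** \<Sigma>h) = (\<Sum>i\<in>UNIV. r $ i)"
    unfolding B(2,3) matrix_inv_gram_mult_diagonal[OF B(1)] trace_similar_diagonal[OF B(1)] ..
  moreover have "ln (det \<Sigma>h) = ln (det \<Sigma>) + (\<Sum>i\<in>UNIV. ln (r $ i))"
  proof -
    have "det \<Sigma>h = det \<Sigma> * (\<Prod>i\<in>UNIV. r $ i)" unfolding B(2,3) by (simp add: det_mul det_diagonal_eq)
    then show ?thesis using pos_def_matrix_det_pos[OF S] r less_imp_neq[OF r]
      by (simp add: ln_mult_pos prod_pos ln_prod)
  qed
  ultimately have "trace (matrix_inv \<Sigma> ** \<Sigma>h) - ln (det \<Sigma>h) + ln (det \<Sigma>) - real CARD('p)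
    = (\<Sum>i\<in>UNIV. r $ i - ln (r $ i) - 1)" by (simp add: sum_subtractf)
  also have "\<dots> \<ge> 0"
  proof (rule sum_nonneg)
    show "0 \<le> r $ i - ln (r $ i) - 1" for i using ln_le_minus_one[OF r, of i] by simp
  qed
  finally have "0 \<le> trace (matrix_inv \<Sigma> ** \<Sigma>h) - ln (det \<Sigma>h) + ln (det \<Sigma>) - real CARD('p)" .
  moreover have "0 \<le> ((\<Theta>h - \<Theta>) ** matrix_inv \<Sigma>) \<bullet> (\<Theta>h - \<Theta>)"
  proof -
    obtain C :: "real^'p^'p" where C: "invertible C" "matrix_inv \<Sigma> = transpose C ** C"
      by (rule pos_def_matrix_factor[OF pos_def_matrix_inverse[OF S]])
    have "((\<Theta>h - \<Theta>) ** matrix_inv \<Sigma>) \<bullet> (\<Theta>h - \<Theta>) = ((\<Theta>h - \<Theta>) ** transpose C) \<bullet> ((\<Theta>h - \<Theta>) ** transpose C)"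
      unfolding C(2) matrix_mul_assoc by (subst inner_matrix_mult_right) simp
    then show ?thesis by simp
  qed
  ultimately show ?thesis unfolding kl_formula_def by simp
qed

section \<open>Stein identities for ridge-type fields\<close>

text \<open>
  The resolvent \<open>(Z\<^sup>T Z + P)\<^sup>-\<^sup>1\<close>. With \<open>P = \<beta> X\<^sup>T X\<close> it is \<open>A\<^sup>-\<^sup>1\<close>; with the roles of \<open>X\<close> and \<open>Z\<close>
  exchanged and \<open>P = \<beta>\<^sup>-\<^sup>1 S\<close> it is \<open>\<beta> A\<^sup>-\<^sup>1\<close>. One computation thus covers both samples.
\<close>

definition ridge_inv :: "real^'p^'p \<Rightarrow> real^'p^'n \<Rightarrow> real^'p^'p" where
  "ridge_inv P Z = matrix_inv (transpose Z ** Z + P)"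

text \<open>
  For \<open>P = \<beta> X\<^sup>T X\<close> this is \<open>Q\<close>, and with exchanged roles it is \<open>R\<close>.
\<close>

definition ridge :: "real^'p^'p \<Rightarrow> real^'p^'n \<Rightarrow> real^'p^'p" where
  "ridge P Z = ridge_inv P Z ** P"

context
  fixes P :: "real^'p^'p"
  assumes P: "pos_def_matrix P"
begin

lemma ridge_pos_def: "pos_def_matrix (transpose Z ** (Z :: real^'p^'n) + P)"
  using pos_def_matrix_add_semidef[OF P transpose_gram inner_gram_nonneg, of Z] by (simp add: add.commute)

lemma ridge_inv_symmetric: "transpose (ridge_inv P Z) = ridge_inv P (Z :: real^'p^'n)"
  unfolding ridge_inv_def by (intro pos_def_matrix_symmetric pos_def_matrix_inverse ridge_pos_def)

lemma ridge_inv_gram: "ridge_inv P Z ** gram Z = mat 1 - ridge P (Z :: real^'p^'n)"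
proof -
  have "ridge_inv P Z ** (transpose Z ** Z + P) = mat 1"
    unfolding ridge_inv_def by (intro matrix_inv_left pos_def_matrix_invertible ridge_pos_def)
  then show ?thesis unfolding ridge_def by (simp add: matrix_mult_bilinear eq_diff_eq)
qed

lemma transpose_ridge: "transpose (ridge P Z) = P ** ridge_inv P (Z :: real^'p^'n)"
  by (simp add: ridge_def matrix_transpose_mul ridge_inv_symmetric pos_def_matrix_symmetric[OF P])

lemma continuous_on_ridge_inv: "continuous_on UNIV (ridge_inv P :: real^'p^'n \<Rightarrow> _)"
  unfolding ridge_inv_def[abs_def]
  by (intro continuous_on_matrix_inv continuous_intros pos_def_matrix_invertible ridge_pos_def)

lemma continuous_on_ridge: "continuous_on UNIV (ridge P :: real^'p^'n \<Rightarrow> _)"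
  unfolding ridge_def[abs_def] by (intro continuous_intros continuous_on_ridge_inv)

lemma has_vector_derivative_ridge:
  fixes Z b :: "real^'p^'n"
  shows "((\<lambda>t. ridge P (Z + t *\<^sub>R b)) has_vector_derivative
    - (ridge_inv P Z ** (transpose b ** Z + transpose Z ** b) ** ridge P Z)) (at 0)"
proof -
  have d1: "((\<lambda>t. Z + t *\<^sub>R b) has_vector_derivative b) (at 0)"
    by (auto intro!: derivative_eq_intros)
  have d2: "((\<lambda>t. transpose (Z + t *\<^sub>R b)) has_vector_derivative transpose b) (at 0)"
    by (rule bounded_linear.has_vector_derivative[OF bounded_linear_transpose d1])
  have d3: "((\<lambda>t. transpose (Z + t *\<^sub>R b) ** (Z + t *\<^sub>R b) + P) has_vector_derivative
      (transpose Z ** b + transpose b ** Z)) (at 0)"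
    using has_vector_derivative_add[OF bounded_bilinear.has_vector_derivative[OF bounded_bilinear_matrix_mult d2 d1]
        has_vector_derivative_const[of P]] by simp
  have "((\<lambda>t. ridge_inv P (Z + t *\<^sub>R b)) has_vector_derivative
      - (ridge_inv P (Z + 0 *\<^sub>R b) ** (transpose Z ** b + transpose b ** Z) ** ridge_inv P (Z + 0 *\<^sub>R b))) (at 0)"
    unfolding ridge_inv_def
    by (rule has_vector_derivative_matrix_inv[OF d3])
      (intro continuous_intros pos_def_matrix_invertible ridge_pos_def)+
  from bounded_linear.has_vector_derivative[OF
      bounded_bilinear.bounded_linear_left[OF bounded_bilinear_matrix_mult, of P] this]
  show ?thesis unfolding ridge_def
    by (simp add: matrix_mult_bilinear matrix_mul_assoc add.commute)
qed

lemma ridge_bounded: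
  obtains c \<kappa> where "0 \<le> c" "0 \<le> \<kappa>"
    "\<And>Z :: real^'p^'n. norm (ridge_inv P Z) \<le> c" "\<And>Z :: real^'p^'n. norm (ridge P Z) \<le> \<kappa>"
proof -
  obtain c where c: "0 \<le> c"
    "\<And>S. transpose S = S \<Longrightarrow> (\<And>x. 0 \<le> x \<bullet> (S *v x)) \<Longrightarrow> norm (matrix_inv (S + P)) \<le> c"
    by (rule norm_matrix_inv_bounded[OF P]) blast
  have 1: "norm (ridge_inv P Z) \<le> c" for Z :: "real^'p^'n"
    unfolding ridge_inv_def by (rule c(2)[OF transpose_gram inner_gram_nonneg])
  have "norm (ridge P Z) \<le> c * norm P" for Z :: "real^'p^'n"
    unfolding ridge_def by (rule order_trans[OF norm_matrix_mult_le mult_right_mono[OF 1]]) simp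
  then show thesis using that[of c "c * norm P"] c(1) 1 by simp
qed

lemma trace_ridge_inv_gram:
  "trace (Z ** ridge_inv P Z ** transpose Z) = real CARD('p) - trace (ridge P (Z :: real^'p^'n))"
proof -
  have "trace (Z ** ridge_inv P Z ** transpose Z) = trace (Z ** (ridge_inv P Z ** transpose Z))"
    by (simp add: matrix_mul_assoc)
  also have "\<dots> = trace ((ridge_inv P Z ** transpose Z) ** Z)" by (rule trace_mul_sym)
  also have "\<dots> = trace (mat 1 - ridge P Z)" by (simp add: ridge_inv_gram[symmetric] matrix_mul_assoc)
  finally show ?thesis by (simp add: trace_linear trace_I)
qed

lemma trace_mult_ridge_inv_gram:
  "trace (Z ** ridge P Z ** ridge_inv P Z ** transpose Z)
    = trace (ridge P Z) - trace (ridge P Z ** ridge P (Z :: real^'p^'n))"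
proof -
  have "trace (Z ** ridge P Z ** ridge_inv P Z ** transpose Z) = trace (Z ** (ridge P Z ** ridge_inv P Z ** transpose Z))"
    by (simp add: matrix_mul_assoc)
  also have "\<dots> = trace ((ridge P Z ** ridge_inv P Z ** transpose Z) ** Z)" by (rule trace_mul_sym)
  also have "\<dots> = trace (ridge P Z ** (mat 1 - ridge P Z))" by (simp add: ridge_inv_gram[symmetric] matrix_mul_assoc)
  finally show ?thesis by (simp add: trace_linear matrix_mult_bilinear)
qed

lemma inner_ridge_inv: "(Z ** ridge_inv P Z) \<bullet> (Z ** M) = trace M - trace (ridge P (Z :: real^'p^'n) ** M)"
proof -
  have "(Z ** ridge_inv P Z) \<bullet> (Z ** M) = trace (ridge_inv P Z ** gram Z ** M)"
    by (simp add: inner_matrix_eq_trace matrix_transpose_mul ridge_inv_symmetric matrix_mul_assoc)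
  then show ?thesis unfolding ridge_inv_gram by (simp add: matrix_mult_bilinear trace_linear)
qed

lemma inner_ridge_ridge_inv:
  "(Z ** ridge P Z ** ridge_inv P Z) \<bullet> (Z ** ridge P (Z :: real^'p^'n))
    = trace (ridge P Z ** ridge P Z) - trace (ridge P Z ** ridge P Z ** ridge P Z)"
proof -
  have "(Z ** ridge P Z ** ridge_inv P Z) \<bullet> (Z ** ridge P Z)
    = trace (ridge_inv P Z ** transpose (ridge P Z) ** gram Z ** ridge P Z)"
    by (simp add: inner_matrix_eq_trace matrix_transpose_mul ridge_inv_symmetric matrix_mul_assoc)
  also have "ridge_inv P Z ** transpose (ridge P Z) ** gram Z = ridge P Z ** (mat 1 - ridge P Z)"
    unfolding transpose_ridge ridge_inv_gram[symmetric] by (simp add: ridge_def matrix_mul_assoc)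
  finally show ?thesis by (simp add: matrix_mult_bilinear trace_linear)
qed

text \<open>
  The derivative of \<open>Z K\<close> in the direction \<open>b\<close> is \<open>b K - Z A\<^sup>-\<^sup>1 (b\<^sup>T Z + Z\<^sup>T b) K\<close>, where
  \<open>A = Z\<^sup>T Z + P\<close>. The three terms contribute \<open>n tr K\<close>, \<open>- tr ((I - K) K)\<close> and \<open>- tr (I - K) tr K\<close>
  to the divergence, because \<open>A\<^sup>-\<^sup>1 Z\<^sup>T Z = I - K\<close>.
\<close>

lemma stein_ridge:
  fixes \<Theta> :: "real^'p^'n"
  assumes \<Sigma>: "pos_def_matrix \<Sigma>"
  defines "K \<equiv> ridge P :: real^'p^'n \<Rightarrow> real^'p^'p"
  shows "(LINT Z|matrix_normal \<Theta> \<Sigma>. ((Z - \<Theta>) ** matrix_inv \<Sigma>) \<bullet> (Z ** K Z))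
    = (LINT Z|matrix_normal \<Theta> \<Sigma>. real CARD('n) * trace (K Z) - (trace (K Z) - trace (K Z ** K Z))
        - (real CARD('p) - trace (K Z)) * trace (K Z))"
proof -
  let ?A = "ridge_inv P :: real^'p^'n \<Rightarrow> real^'p^'p"
  \<comment> \<open>The factor \<open>mat 1\<close> brings the first term into the form \<open>U b V\<close>.\<close>
  define D where "D = (\<lambda>b Z :: real^'p^'n. mat 1 ** b ** K Z - (Z ** ?A Z) ** transpose b ** (Z ** K Z)
    - (Z ** ?A Z ** transpose Z) ** b ** K Z)"
  obtain c \<kappa> where c: "0 \<le> c" "0 \<le> \<kappa>" "\<And>Z :: real^'p^'n. norm (?A Z) \<le> c" "\<And>Z :: real^'p^'n. norm (K Z) \<le> \<kappa>"
    unfolding K_def by (rule ridge_bounded[where 'n='n]) blast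
  define C where "C = \<kappa> + 2 * (c * \<kappa>)"
  have "(LINT Z|matrix_normal \<Theta> \<Sigma>. ((Z - \<Theta>) ** matrix_inv \<Sigma>) \<bullet> (Z ** K Z))
    = (LINT Z|matrix_normal \<Theta> \<Sigma>. (\<Sum>b\<in>Basis. D b Z \<bullet> b))"
  proof (rule matrix_normal_stein[where G = "\<lambda>Z. Z ** K Z" and DG = D and C = C, OF \<Sigma>])
    show "continuous_on UNIV (\<lambda>Z. Z ** K Z)" unfolding K_def by (intro continuous_intros continuous_on_ridge)
    fix b :: "real^'p^'n" assume b: "b \<in> Basis"
    show "continuous_on UNIV (D b)" unfolding D_def K_def
      by (intro continuous_intros continuous_on_ridge continuous_on_ridge_inv)
    fix Z :: "real^'p^'n"
    have d1: "((\<lambda>t. Z + t *\<^sub>R b) has_vector_derivative b) (at 0)"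
      by (auto intro!: derivative_eq_intros)
    from bounded_bilinear.has_vector_derivative[OF bounded_bilinear_matrix_mult d1 has_vector_derivative_ridge]
    show "((\<lambda>t. (Z + t *\<^sub>R b) ** K (Z + t *\<^sub>R b)) has_vector_derivative D b Z) (at 0)"
      unfolding D_def K_def by (simp add: matrix_mult_bilinear matrix_mul_assoc algebra_simps)
    have n: "norm (D b Z) \<le> norm b * \<kappa> + (norm Z * c) * norm b * (norm Z * \<kappa>) + (norm Z * c * norm Z) * norm b * \<kappa>"
      unfolding D_def
      by (intro order_trans[OF norm_triangle_ineq4] add_mono)
        (auto intro!: order_trans[OF norm_matrix_mult_le] mult_mono mult_nonneg_nonneg c simp: norm_transpose)
    also have "\<dots> = \<kappa> + 2 * (c * \<kappa>) * (norm Z)\<^sup>2" using b by (simp add: power2_eq_square algebra_simps)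
    also have "\<dots> \<le> C * (1 + (norm Z)\<^sup>2)" unfolding C_def using c by (simp add: algebra_simps)
    finally show "norm (D b Z) \<le> C * (1 + (norm Z)\<^sup>2)" .
  next
    fix Z :: "real^'p^'n"
    have "norm (Z ** K Z) \<le> norm Z * \<kappa>" by (intro order_trans[OF norm_matrix_mult_le] mult_mono c) auto
    also have "\<dots> \<le> (1 + (norm Z)\<^sup>2) * \<kappa>" using norm_diff_le_quadratic[of Z 0] c by (intro mult_right_mono) auto
    also have "\<dots> \<le> (1 + (norm Z)\<^sup>2) * C" using c by (intro mult_left_mono) (auto simp: C_def)
    finally show "norm (Z ** K Z) \<le> C * (1 + (norm Z)\<^sup>2)" by (simp add: mult.commute)
  qed
  also have "(\<lambda>Z. \<Sum>b\<in>Basis. D b Z \<bullet> b) = (\<lambda>Z. real CARD('n) * trace (K Z) - (trace (K Z) - trace (K Z ** K Z))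
        - (real CARD('p) - trace (K Z)) * trace (K Z))"
    unfolding D_def inner_diff_left sum_subtractf sum_Basis_sandwich sum_Basis_sandwich_transpose
    unfolding K_def inner_ridge_inv trace_ridge_inv_gram by (simp add: trace_I)
  finally show ?thesis .
qed

text \<open>
  The same computation for \<open>Z K\<^sup>2\<close>, with two more terms from the derivative of the second factor
  \<open>K\<close>. They contribute \<open>- tr ((I - K) K\<^sup>2)\<close> and \<open>- tr ((I - K) K) tr K\<close>.
\<close>

lemma stein_ridge_square:
  fixes \<Theta> :: "real^'p^'n"
  assumes \<Sigma>: "pos_def_matrix \<Sigma>"
  defines "K \<equiv> ridge P :: real^'p^'n \<Rightarrow> real^'p^'p"
  shows "(LINT Z|matrix_normal \<Theta> \<Sigma>. ((Z - \<Theta>) ** matrix_inv \<Sigma>) \<bullet> (Z ** K Z ** K Z))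
    = (LINT Z|matrix_normal \<Theta> \<Sigma>. real CARD('n) * trace (K Z ** K Z)
        - 2 * (trace (K Z ** K Z) - trace (K Z ** K Z ** K Z))
        - (real CARD('p) - trace (K Z)) * trace (K Z ** K Z)
        - (trace (K Z) - trace (K Z ** K Z)) * trace (K Z))"
proof -
  let ?A = "ridge_inv P :: real^'p^'n \<Rightarrow> real^'p^'p"
  define D where "D = (\<lambda>b Z :: real^'p^'n. mat 1 ** b ** (K Z ** K Z) - (Z ** ?A Z) ** transpose b ** (Z ** (K Z ** K Z))
    - (Z ** ?A Z ** transpose Z) ** b ** (K Z ** K Z)
    - (Z ** K Z ** ?A Z) ** transpose b ** (Z ** K Z) - (Z ** K Z ** ?A Z ** transpose Z) ** b ** K Z)"
  obtain c \<kappa> where c: "0 \<le> c" "0 \<le> \<kappa>" "\<And>Z :: real^'p^'n. norm (?A Z) \<le> c" "\<And>Z :: real^'p^'n. norm (K Z) \<le> \<kappa>"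
    unfolding K_def by (rule ridge_bounded[where 'n='n]) blast
  define C where "C = \<kappa> * \<kappa> + 4 * (c * (\<kappa> * \<kappa>))"
  have "(LINT Z|matrix_normal \<Theta> \<Sigma>. ((Z - \<Theta>) ** matrix_inv \<Sigma>) \<bullet> (Z ** K Z ** K Z))
    = (LINT Z|matrix_normal \<Theta> \<Sigma>. (\<Sum>b\<in>Basis. D b Z \<bullet> b))"
  proof (rule matrix_normal_stein[where G = "\<lambda>Z. Z ** K Z ** K Z" and DG = D and C = C, OF \<Sigma>])
    show "continuous_on UNIV (\<lambda>Z. Z ** K Z ** K Z)" unfolding K_def by (intro continuous_intros continuous_on_ridge)
    fix b :: "real^'p^'n" assume b: "b \<in> Basis"
    show "continuous_on UNIV (D b)" unfolding D_def K_def
      by (intro continuous_intros continuous_on_ridge continuous_on_ridge_inv)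
    fix Z :: "real^'p^'n"
    have d1: "((\<lambda>t. Z + t *\<^sub>R b) has_vector_derivative b) (at 0)"
      by (auto intro!: derivative_eq_intros)
    note d2 = bounded_bilinear.has_vector_derivative[OF bounded_bilinear_matrix_mult d1 has_vector_derivative_ridge]
    from bounded_bilinear.has_vector_derivative[OF bounded_bilinear_matrix_mult d2 has_vector_derivative_ridge]
    show "((\<lambda>t. (Z + t *\<^sub>R b) ** K (Z + t *\<^sub>R b) ** K (Z + t *\<^sub>R b)) has_vector_derivative D b Z) (at 0)"
      unfolding D_def K_def by (simp add: matrix_mult_bilinear matrix_mul_assoc algebra_simps)
    have n: "norm (D b Z) \<le> norm b * (\<kappa> * \<kappa>) + (norm Z * c) * norm b * (norm Z * (\<kappa> * \<kappa>))
        + (norm Z * c * norm Z) * norm b * (\<kappa> * \<kappa>)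
        + (norm Z * \<kappa> * c) * norm b * (norm Z * \<kappa>) + (norm Z * \<kappa> * c * norm Z) * norm b * \<kappa>"
      unfolding D_def
      by (intro order_trans[OF norm_triangle_ineq4] add_mono)
        (auto intro!: order_trans[OF norm_matrix_mult_le] mult_mono mult_nonneg_nonneg c simp: norm_transpose)
    also have "\<dots> = \<kappa> * \<kappa> + 4 * (c * (\<kappa> * \<kappa>)) * (norm Z)\<^sup>2" using b by (simp add: power2_eq_square algebra_simps)
    also have "\<dots> \<le> C * (1 + (norm Z)\<^sup>2)" unfolding C_def using c by (simp add: algebra_simps)
    finally show "norm (D b Z) \<le> C * (1 + (norm Z)\<^sup>2)" .
  next
    fix Z :: "real^'p^'n"
    have "norm (Z ** K Z ** K Z) \<le> norm Z * \<kappa> * \<kappa>"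
      by (intro order_trans[OF norm_matrix_mult_le] mult_mono c order_trans[OF norm_matrix_mult_le]) (use c in auto)
    also have "\<dots> \<le> (1 + (norm Z)\<^sup>2) * \<kappa> * \<kappa>" using norm_diff_le_quadratic[of Z 0] c by (intro mult_right_mono) auto
    also have "\<dots> \<le> (1 + (norm Z)\<^sup>2) * C" using c unfolding mult.assoc by (intro mult_left_mono) (auto simp: C_def)
    finally show "norm (Z ** K Z ** K Z) \<le> C * (1 + (norm Z)\<^sup>2)" by (simp add: mult.commute)
  qed
  also have "(\<lambda>Z. \<Sum>b\<in>Basis. D b Z \<bullet> b) = (\<lambda>Z. real CARD('n) * trace (K Z ** K Z)
        - 2 * (trace (K Z ** K Z) - trace (K Z ** K Z ** K Z))
        - (real CARD('p) - trace (K Z)) * trace (K Z ** K Z)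
        - (trace (K Z) - trace (K Z ** K Z)) * trace (K Z))"
    unfolding D_def inner_diff_left sum_subtractf sum_Basis_sandwich sum_Basis_sandwich_transpose
    unfolding K_def inner_ridge_inv trace_ridge_inv_gram inner_ridge_ridge_inv trace_mult_ridge_inv_gram
    by (simp add: trace_I matrix_mul_assoc algebra_simps)
  finally show ?thesis .
qed

end

section \<open>Integrability of the logarithm of a random determinant\<close>

text \<open>
  The bounds \<open>a\<close> and \<open>b\<close> may exceed the degrees, as happens for the products in a
  determinant, whose entries have different degrees.
\<close>

lemma coeff_mult_top:
  fixes p q :: "'a::comm_semiring_1 poly"
  assumes "degree p \<le> a" "degree q \<le> b"
  shows "coeff (p * q) (a + b) = coeff p a * coeff q b"
proof (cases "degree p = a \<and> degree q = b")
  case True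
  then show ?thesis by (metis coeff_mult_degree_sum)
next
  case False
  then have lt: "degree p < a \<or> degree q < b" using assms by auto
  then have "degree (p * q) < a + b" using degree_mult_le[of p q] assms by linarith
  then show ?thesis using lt by (auto simp: coeff_eq_0)
qed

lemma coeff_prod_top:
  fixes f :: "'b \<Rightarrow> 'a::comm_semiring_1 poly"
  assumes "finite A" "\<And>x. x \<in> A \<Longrightarrow> degree (f x) \<le> k"
  shows "coeff (prod f A) (k * card A) = (\<Prod>x\<in>A. coeff (f x) k) \<and> degree (prod f A) \<le> k * card A"
  using assms
proof (induction A)
  case (insert x A)
  then have IH: "coeff (prod f A) (k * card A) = (\<Prod>x\<in>A. coeff (f x) k)" "degree (prod f A) \<le> k * card A" by auto
  have fx: "degree (f x) \<le> k" using insert by auto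
  show ?case using insert(1,2) coeff_mult_top[OF fx IH(2)] IH degree_mult_le[of "f x" "prod f A"] fx by simp
qed simp

lemma poly_det: "poly (det M) t = det (\<chi> i j. poly (M $ i $ j) t)" for M :: "real poly^'p^'p"
proof -
  have "poly (of_int (sign p)) t = of_int (sign p)" for p :: "'p \<Rightarrow> 'p" by (cases rule: sign_cases[of p]) auto
  then show ?thesis by (simp add: det_def poly_sum poly_prod)
qed

text \<open>
  In the Leibniz formula each product has \<open>p\<close> factors of degree at most \<open>k\<close>, so the top
  coefficient of the determinant is the determinant of the top coefficients.
\<close>

lemma det_poly_matrix_top:
  fixes M :: "real poly^'p^'p"
  assumes deg: "\<And>i j. degree (M $ i $ j) \<le> k"
  shows "coeff (det M) (k * CARD('p)) = det (\<chi> i j. coeff (M $ i $ j) k)"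
    and "degree (det M) \<le> k * CARD('p)"
proof -
  have prods: "coeff (\<Prod>i\<in>UNIV. M $ i $ \<sigma> i) (k * CARD('p)) = (\<Prod>i\<in>UNIV. coeff (M $ i $ \<sigma> i) k)"
    "degree (\<Prod>i\<in>UNIV. M $ i $ \<sigma> i) \<le> k * CARD('p)" for \<sigma> :: "'p \<Rightarrow> 'p"
    using coeff_prod_top[of "UNIV :: 'p set" "\<lambda>i. M $ i $ \<sigma> i" k] deg by auto
  have s: "of_int (sign \<sigma>) * q = smult (of_int (sign \<sigma>)) q" for \<sigma> :: "'p \<Rightarrow> 'p" and q :: "real poly"
    by (cases rule: sign_cases[of \<sigma>]) auto
  show "coeff (det M) (k * CARD('p)) = det (\<chi> i j. coeff (M $ i $ j) k)"
    by (simp add: det_def s coeff_sum prods)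
  show "degree (det M) \<le> k * CARD('p)" unfolding det_def s
    by (intro degree_sum_le order_trans[OF degree_smult_le prods(2)]) (auto intro: finite_permutations)
qed

text \<open>
  The negative part of \<open>log |x|\<close>: \<open>ennreal\<close> sends negative reals to \<open>0\<close>. The value \<open>\<infinity>\<close> at
  \<open>0\<close> lets a finite integral of \<open>neg_log\<close> also say that the argument is almost never \<open>0\<close>.
\<close>

definition neg_log :: "real \<Rightarrow> ennreal" where
  "neg_log x = (if x = 0 then \<infinity> else ennreal (- ln \<bar>x\<bar>))"

lemma borel_measurable_neg_log [measurable]: "neg_log \<in> borel_measurable borel"
  unfolding neg_log_def[abs_def] by measurable

lemma neg_log_antimono: "\<bar>x\<bar> \<le> \<bar>y\<bar> \<Longrightarrow> neg_log y \<le> neg_log x"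
  by (auto simp: neg_log_def intro!: ennreal_leI)

lemma neg_log_mult_le: "neg_log (x * y) \<le> neg_log x + neg_log y"
proof (cases "x = 0 \<or> y = 0")
  case False
  then have "neg_log (x * y) = ennreal (- ln \<bar>x\<bar> + - ln \<bar>y\<bar>)" by (simp add: neg_log_def abs_mult ln_mult)
  also have "\<dots> \<le> ennreal (max 0 (- ln \<bar>x\<bar>) + max 0 (- ln \<bar>y\<bar>))" by (intro ennreal_leI) auto
  also have "\<dots> = neg_log x + neg_log y" using False by (simp add: neg_log_def ennreal_plus[symmetric] del: ennreal_plus)
     (simp add: ennreal_plus max_def ennreal_neg)
  finally show ?thesis .
qed (auto simp: neg_log_def)

text \<open>
  At least \<open>- log |u|\<close> of the intervals \<open>[- exp (- k), exp (- k)]\<close> contain \<open>u\<close>. Their lengths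
  form a convergent geometric series, whence the next lemma.
\<close>

lemma neg_log_le_suminf: "neg_log u \<le> (\<Sum>k. indicator {- exp (- real k) .. exp (- real k)} u)"
proof -
  let ?f = "\<lambda>k. indicator {- exp (- real k) .. exp (- real k)} u :: ennreal"
  have N: "of_nat N \<le> (\<Sum>k. ?f k)" if "\<And>k. k < N \<Longrightarrow> \<bar>u\<bar> \<le> exp (- real k)" for N
  proof -
    have "?f k = 1" if "k < N" for k
      using \<open>\<And>k. k < N \<Longrightarrow> \<bar>u\<bar> \<le> exp (- real k)\<close>[OF that] by (simp add: indicator_def abs_le_iff minus_le_iff)
    then have "(of_nat N :: ennreal) = (\<Sum>k<N. ?f k)" by simp
    also have "\<dots> \<le> (\<Sum>k. ?f k)" by (intro sum_le_suminf) auto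
    finally show ?thesis .
  qed
  show ?thesis
  proof (cases "u = 0")
    case True
    then have "of_nat n \<le> (\<Sum>k. ?f k)" for n by (intro N) simp
    then have "\<not> (\<Sum>k. ?f k) < top" using ennreal_Ex_less_of_nat by (meson linorder_not_le)
    then show ?thesis by (simp add: not_less top_unique)
  next
    case False
    define s where "s = - ln \<bar>u\<bar>"
    have u: "\<bar>u\<bar> = exp (- s)" using False by (simp add: s_def)
    have "neg_log u = ennreal s" using False by (simp add: neg_log_def s_def)
    also have "\<dots> \<le> ennreal (real (nat \<lceil>s\<rceil>))" by (intro ennreal_leI) linarith
    also have "\<dots> = of_nat (nat \<lceil>s\<rceil>)" by (simp add: ennreal_of_nat_eq_real_of_nat)
    also have "\<dots> \<le> (\<Sum>k. ?f k)"
    proof (rule N)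
      fix k assume "k < nat \<lceil>s\<rceil>"
      then have "real k \<le> s" by linarith
      then show "\<bar>u\<bar> \<le> exp (- real k)" unfolding u by simp
    qed
    finally show ?thesis .
  qed
qed

lemma nn_integral_neg_log_finite: "(\<integral>\<^sup>+u. neg_log u \<partial>lborel) < \<infinity>"
proof -
  have "(\<integral>\<^sup>+u. neg_log u \<partial>lborel) \<le> (\<integral>\<^sup>+u. (\<Sum>k. indicator {- exp (- real k) .. exp (- real k)} u) \<partial>lborel)"
    by (intro nn_integral_mono neg_log_le_suminf)
  also have "\<dots> = (\<Sum>k. \<integral>\<^sup>+u. indicator {- exp (- real k) .. exp (- real k)} u \<partial>lborel)"
    by (rule nn_integral_suminf) measurable
  also have "\<dots> = (\<Sum>k. ennreal (2 * exp (- real k)))" by simp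
  also have "\<dots> < \<infinity>"
  proof -
    have "summable (\<lambda>k. 2 * (exp (- 1 :: real)) ^ k)" by (intro summable_mult summable_geometric) simp
    moreover have "exp (- 1 :: real) ^ k = exp (- real k)" for k by (simp add: exp_of_nat_mult[symmetric])
    ultimately have "summable (\<lambda>k. 2 * exp (- real k))" by simp
    then show ?thesis by (subst suminf_ennreal_eq[OF _ summable_sums]) auto
  qed
  finally show ?thesis .
qed

text \<open>
  Over the complex numbers \<open>q\<close> is a product of factors \<open>t - z\<close>, and \<open>|t - z| \<ge> |t - Re z|\<close> for
  real \<open>t\<close>. The bound depends on \<open>q\<close> only through its degree.
\<close>

lemma nn_integral_neg_log_poly:
  fixes q :: "real poly"
  assumes "lead_coeff q = 1"
  shows "(\<integral>\<^sup>+t. neg_log (poly q t) \<partial>lborel) \<le> of_nat (degree q) * (\<integral>\<^sup>+u. neg_log u \<partial>lborel)"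
proof -
  let ?Q = "map_poly complex_of_real q"
  have "?Q \<noteq> 0" using assms by (auto simp: map_poly_eq_0_iff)
  then obtain A where A: "size A = degree ?Q" "?Q = smult (lead_coeff ?Q) (\<Prod>x\<in>#A. [:- x, 1:])"
    using alg_closed_imp_factorization by blast
  have lc: "lead_coeff ?Q = 1" using assms by (simp add: coeff_map_poly degree_map_poly)
  have dq: "size A = degree q" using A(1) by (simp add: degree_map_poly)
  have "norm (poly (\<Prod>x\<in>#A. [:- x, 1:]) (complex_of_real t)) = \<bar>poly q t\<bar>" for t
  proof -
    have "poly ?Q (complex_of_real t) = complex_of_real (poly q t)"
      by (induction q) (simp_all add: map_poly_pCons)
    then show ?thesis using A(2) unfolding lc by simp
  qed
  then have "neg_log (poly q t) = neg_log (norm (poly (\<Prod>x\<in>#A. [:- x, 1:]) (complex_of_real t)))" for t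
    by (simp add: neg_log_def)
  moreover have "neg_log (norm (poly (\<Prod>x\<in>#A. [:- x, 1:]) (complex_of_real t))) \<le> (\<Sum>x\<in>#A. neg_log (t - Re x))" for t
  proof (induction A)
    case (add x A)
    have "neg_log (norm (poly (\<Prod>x\<in>#add_mset x A. [:- x, 1:]) (complex_of_real t)))
      = neg_log (norm (complex_of_real t - x) * norm (poly (\<Prod>x\<in>#A. [:- x, 1:]) (complex_of_real t)))"
      by (simp add: norm_mult[symmetric] algebra_simps)
    also have "\<dots> \<le> neg_log (norm (complex_of_real t - x)) + neg_log (norm (poly (\<Prod>x\<in>#A. [:- x, 1:]) (complex_of_real t)))"
      by (rule neg_log_mult_le)
    also have "neg_log (norm (complex_of_real t - x)) \<le> neg_log (t - Re x)"
      using abs_Re_le_cmod[of "complex_of_real t - x"] by (intro neg_log_antimono) simp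
    finally show ?case using add by (simp add: add_mono order_trans)
  qed (simp add: neg_log_def)
  ultimately have "(\<integral>\<^sup>+t. neg_log (poly q t) \<partial>lborel) \<le> (\<integral>\<^sup>+t. (\<Sum>x\<in>#A. neg_log (t - Re x)) \<partial>lborel)"
    by (intro nn_integral_mono) simp
  also have "\<dots> = of_nat (size A) * (\<integral>\<^sup>+u. neg_log u \<partial>lborel)"
  proof (induction A)
    case (add x A)
    have "(\<integral>\<^sup>+t. neg_log (t - Re x) \<partial>lborel) = (\<integral>\<^sup>+u. neg_log u \<partial>lborel)"
      using nn_integral_real_affine[of neg_log 1 "- Re x"] by simp
    moreover have [measurable]: "(\<lambda>t. \<Sum>x\<in>#A. neg_log (t - Re x)) \<in> borel_measurable borel"
      by (induction A) auto
    ultimately show ?case using add by (simp add: nn_integral_add distrib_right)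
  qed simp
  finally show ?thesis unfolding dq .
qed

lemma nn_integral_translation:
  fixes F :: "'a::euclidean_space \<Rightarrow> ennreal"
  assumes [measurable]: "F \<in> borel_measurable borel"
  shows "(\<integral>\<^sup>+x. F (x + a) \<partial>lborel) = (\<integral>\<^sup>+x. F x \<partial>lborel)"
proof -
  have "(\<integral>\<^sup>+x. F x \<partial>distr lborel borel ((+) a)) = (\<integral>\<^sup>+x. F (a + x) \<partial>lborel)"
    by (rule nn_integral_distr) auto
  then show ?thesis by (simp add: lborel_distr_plus add.commute)
qed

text \<open>
  \<open>(Z + t J)\<^sup>T (Z + t J) = Z\<^sup>T Z + t (Z\<^sup>T J + J\<^sup>T Z) + t\<^sup>2 I\<close>.
\<close>

lemma det_gram_shift_poly:
  fixes Z J :: "real^'p^'n"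
  assumes J: "gram J = mat 1"
  obtains q :: "real poly" where "lead_coeff q = 1" "degree q = 2 * CARD('p)"
    "\<And>t. poly q t = det (gram (Z + t *\<^sub>R J))"
proof -
  define B where "B = transpose Z ** Z"
  define C where "C = transpose Z ** J + transpose J ** Z"
  define M :: "real poly^'p^'p" where "M = (\<chi> i j. [:B $ i $ j, C $ i $ j, mat 1 $ i $ j:])"
  have deg: "degree (M $ i $ j) \<le> 2" for i j by (simp add: M_def)
  have top: "coeff (det M) (2 * CARD('p)) = 1"
  proof -
    have "(\<chi> i j. coeff (M $ i $ j) 2) = (mat 1 :: real^'p^'p)" by (simp add: M_def vec_eq_iff numeral_2_eq_2)
    then show ?thesis using det_poly_matrix_top(1)[of M 2, OF deg] by simp
  qed
  then have d: "degree (det M) = 2 * CARD('p)"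
    using det_poly_matrix_top(2)[of M 2, OF deg] le_degree[of "det M" "2 * CARD('p)"] by simp
  show thesis
  proof (rule that[of "det M"])
    show "lead_coeff (det M) = 1" unfolding d by (rule top)
    show "degree (det M) = 2 * CARD('p)" by (rule d)
    fix t
    have "gram (Z + t *\<^sub>R J) = B + t *\<^sub>R C + t\<^sup>2 *\<^sub>R mat 1"
      unfolding B_def C_def J[symmetric]
      by (simp add: transpose_plus transpose_scalar matrix_mult_bilinear power2_eq_square algebra_simps)
    then have "(\<chi> i j. poly (M $ i $ j) t) = gram (Z + t *\<^sub>R J)"
      by (simp add: M_def vec_eq_iff power2_eq_square algebra_simps)
    then show "poly (det M) t = det (gram (Z + t *\<^sub>R J))" by (simp add: poly_det)
  qed
qed

lemma exists_isometry_matrix: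
  assumes "CARD('p::finite) \<le> CARD('n::finite)"
  obtains J :: "real^'p^'n" where "gram J = mat 1"
proof -
  obtain f :: "'p \<Rightarrow> 'n" where f: "inj f" using assms card_le_inj[of "UNIV :: 'p set" "UNIV :: 'n set"] by auto
  define J :: "real^'p^'n" where "J = (\<chi> i j. if f j = i then 1 else 0)"
  have "gram J = mat 1"
    using sum_if_eq_mult[of "f _" 1] f
    by (auto simp: J_def matrix_matrix_mult_def transpose_def vec_eq_iff mat_def inj_def)
  then show thesis by (rule that)
qed

text \<open>
  The integral is unchanged when \<open>Z\<close> is replaced by \<open>Z + t J\<close> in both the integrand and the
  density. For \<open>t \<in> [0, 1]\<close> the shifted density is dominated by one Gaussian function that
  does not depend on \<open>t\<close>; after averaging over \<open>t\<close> and exchanging the integrals, the inner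
  integral is that of a monic polynomial of degree \<open>2 p\<close>.
\<close>

lemma nn_integral_neg_log_det_gram:
  fixes \<Theta> :: "real^'p^'n"
  assumes \<Sigma>: "pos_def_matrix \<Sigma>" and le: "CARD('p) \<le> CARD('n)"
  shows "(\<integral>\<^sup>+Z. neg_log (det (gram Z)) \<partial>matrix_normal \<Theta> \<Sigma>) < \<infinity>"
proof -
  obtain J :: "real^'p^'n" where J: "gram J = mat 1" by (rule exists_isometry_matrix[OF le])
  define g where "g = (\<lambda>Z :: real^'p^'n. neg_log (det (gram Z)))"
  have [measurable]: "g \<in> borel_measurable borel" unfolding g_def by measurable
  obtain c C where c: "0 < c" "\<And>Y. gauss_weight \<Theta> (matrix_inv \<Sigma>) Y \<le> C * exp (- c * (norm Y)\<^sup>2)"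
    by (rule gauss_weight_decay[OF pos_def_matrix_inverse[OF \<Sigma>], of \<Theta>]) blast
  define k where "k = (2 * pi) powr (- (real CARD('n) * real CARD('p) / 2)) * det \<Sigma> powr (- (real CARD('n) / 2))"
  have k0: "0 \<le> k" by (simp add: k_def)
  have C0: "0 \<le> C" using order_trans[OF exp_ge_zero c(2)[of 0]] by simp
  define E where "E = k * C * exp (c * (norm J)\<^sup>2)"
  have E0: "0 \<le> E" using k0 C0 by (simp add: E_def)
  have dens: "matrix_normal_density \<Theta> \<Sigma> (Z + t *\<^sub>R J) \<le> E * exp (- (c / 2) * (norm Z)\<^sup>2)" if t: "t \<in> {0..1}" for t Z
  proof -
    have "norm Z \<le> norm (Z + t *\<^sub>R J) + norm (t *\<^sub>R J)" using norm_triangle_ineq4[of "Z + t *\<^sub>R J" "t *\<^sub>R J"] by simp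
    also have "norm (t *\<^sub>R J) \<le> norm J" using t by (simp add: mult_left_le_one_le)
    finally have "(norm Z)\<^sup>2 \<le> (norm (Z + t *\<^sub>R J) + norm J)\<^sup>2" by (intro power_mono) auto
    also have "\<dots> \<le> 2 * (norm (Z + t *\<^sub>R J))\<^sup>2 + 2 * (norm J)\<^sup>2"
      using sum_squares_bound[of "norm (Z + t *\<^sub>R J)" "norm J"] by (simp add: power2_sum)
    finally have "c * (norm Z)\<^sup>2 \<le> c * (2 * (norm (Z + t *\<^sub>R J))\<^sup>2 + 2 * (norm J)\<^sup>2)" using c(1) by (intro mult_left_mono) auto
    then have "- c * (norm (Z + t *\<^sub>R J))\<^sup>2 \<le> c * (norm J)\<^sup>2 + - (c / 2) * (norm Z)\<^sup>2" by (simp add: distrib_left)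
    then have "exp (- c * (norm (Z + t *\<^sub>R J))\<^sup>2) \<le> exp (c * (norm J)\<^sup>2) * exp (- (c / 2) * (norm Z)\<^sup>2)"
      by (simp add: exp_add[symmetric])
    then have "k * (C * exp (- c * (norm (Z + t *\<^sub>R J))\<^sup>2)) \<le> k * (C * (exp (c * (norm J)\<^sup>2) * exp (- (c / 2) * (norm Z)\<^sup>2)))"
      using k0 C0 by (intro mult_left_mono) auto
    moreover have "matrix_normal_density \<Theta> \<Sigma> (Z + t *\<^sub>R J) \<le> k * (C * exp (- c * (norm (Z + t *\<^sub>R J))\<^sup>2))"
      unfolding matrix_normal_density_eq k_def[symmetric] using k0 by (intro mult_left_mono c) auto
    ultimately show ?thesis by (simp add: E_def mult_ac)
  qed
  \<comment> \<open>The Gaussian function that dominates all shifted densities.\<close>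
  define W where "W = (\<lambda>Z :: real^'p^'n. ennreal (E * exp (- (c / 2) * (norm Z)\<^sup>2)))"
  have [measurable]: "W \<in> borel_measurable borel" unfolding W_def by measurable
  let ?I = "(\<integral>\<^sup>+Z. g Z * ennreal (matrix_normal_density \<Theta> \<Sigma> Z) \<partial>lborel)"
  have "(\<integral>\<^sup>+Z. g Z \<partial>matrix_normal \<Theta> \<Sigma>) = ?I"
    unfolding matrix_normal_def by (subst nn_integral_density) (auto simp: mult.commute)
  \<comment> \<open>A constant is its own average over \<open>[0, 1]\<close>.\<close>
  also have "?I = (\<integral>\<^sup>+(t::real). indicator {0..1} t * ?I \<partial>lborel)"
    by (subst nn_integral_multc) auto
  also have "\<dots> \<le> (\<integral>\<^sup>+t. (\<integral>\<^sup>+Z. g (Z + t *\<^sub>R J) * W Z \<partial>lborel) \<partial>lborel)"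
  proof (rule nn_integral_mono)
    fix t :: real
    show "indicator {0..1} t * ?I \<le> (\<integral>\<^sup>+Z. g (Z + t *\<^sub>R J) * W Z \<partial>lborel)"
    proof (cases "t \<in> {0..1}")
      case True
      have "?I = (\<integral>\<^sup>+Z. g (Z + t *\<^sub>R J) * ennreal (matrix_normal_density \<Theta> \<Sigma> (Z + t *\<^sub>R J)) \<partial>lborel)"
        by (rule nn_integral_translation[symmetric]) measurable
      also have "\<dots> \<le> (\<integral>\<^sup>+Z. g (Z + t *\<^sub>R J) * W Z \<partial>lborel)"
        unfolding W_def by (intro nn_integral_mono mult_left_mono ennreal_leI dens True) auto
      finally show ?thesis using True by simp
    qed simp
  qed
  also have "\<dots> = (\<integral>\<^sup>+Z. (\<integral>\<^sup>+t. g (Z + t *\<^sub>R J) * W Z \<partial>lborel) \<partial>lborel)"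
    by (rule lborel_pair.Fubini') measurable
  also have "\<dots> \<le> (\<integral>\<^sup>+Z. (of_nat (2 * CARD('p)) * (\<integral>\<^sup>+u. neg_log u \<partial>lborel)) * W Z \<partial>lborel)"
  proof (rule nn_integral_mono)
    fix Z :: "real^'p^'n"
    obtain q where q: "lead_coeff q = 1" "degree q = 2 * CARD('p)"
      "\<And>t. poly q t = det (gram (Z + t *\<^sub>R J))"
      by (rule det_gram_shift_poly[OF J, of Z]) blast
    have [measurable]: "poly q \<in> borel_measurable borel"
      by (intro borel_measurable_continuous_onI continuous_intros)
    have "(\<integral>\<^sup>+t. g (Z + t *\<^sub>R J) * W Z \<partial>lborel) = (\<integral>\<^sup>+t. neg_log (poly q t) \<partial>lborel) * W Z"
      unfolding g_def q(3)[symmetric] by (rule nn_integral_multc) measurable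
    also have "\<dots> \<le> (of_nat (2 * CARD('p)) * (\<integral>\<^sup>+u. neg_log u \<partial>lborel)) * W Z"
      using nn_integral_neg_log_poly[OF q(1)] unfolding q(2) by (intro mult_right_mono) auto
    finally show "(\<integral>\<^sup>+t. g (Z + t *\<^sub>R J) * W Z \<partial>lborel) \<le> (of_nat (2 * CARD('p)) * (\<integral>\<^sup>+u. neg_log u \<partial>lborel)) * W Z" .
  qed
  also have "\<dots> = (of_nat (2 * CARD('p)) * (\<integral>\<^sup>+u. neg_log u \<partial>lborel)) * (\<integral>\<^sup>+Z. W Z \<partial>lborel)"
    by (rule nn_integral_cmult) measurable
  also have "\<dots> < \<infinity>"
  proof -
    have "(\<integral>\<^sup>+Z. W Z \<partial>lborel) = ennreal E * ennreal (sqrt (pi / (c / 2)) ^ DIM(real^'p^'n))"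
      unfolding W_def using nn_integral_gauss[of "c / 2", where 'a = "real^'p^'n"] c(1) E0
      by (simp add: ennreal_mult nn_integral_cmult)
    then show ?thesis using nn_integral_neg_log_finite
      by (simp add: ennreal_mult_less_top of_nat_less_top)
  qed
  finally show ?thesis unfolding g_def .
qed

lemma AE_gram_invertible:
  fixes \<Theta> :: "real^'p^'n"
  assumes "pos_def_matrix \<Sigma>" "CARD('p) \<le> CARD('n)"
  shows "AE Z in matrix_normal \<Theta> \<Sigma>. invertible (gram Z)"
proof -
  have "AE Z in matrix_normal \<Theta> \<Sigma>. neg_log (det (gram Z)) \<noteq> \<infinity>"
    using nn_integral_neg_log_det_gram[OF assms, of \<Theta>] by (intro nn_integral_PInf_AE) auto
  then show ?thesis by eventually_elim (auto simp: neg_log_def invertible_det_nz)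
qed

text \<open>
  The negative part is \<open>nn_integral_neg_log_det_gram\<close>; the positive part is bounded by
  \<open>log |S| \<le> tr S - p\<close>, which is an instance of the nonnegativity of the loss.
\<close>

lemma integrable_ln_det_gram:
  fixes \<Theta> :: "real^'p^'n"
  assumes \<Sigma>: "pos_def_matrix \<Sigma>" and le: "CARD('p) \<le> CARD('n)"
  shows "integrable (matrix_normal \<Theta> \<Sigma>) (\<lambda>Z. ln (det (gram Z)))"
proof (rule integrableI_bounded)
  show "(\<lambda>Z. ln (det (gram Z))) \<in> borel_measurable (matrix_normal \<Theta> \<Sigma>)" by measurable
  have trI: "integrable (matrix_normal \<Theta> \<Sigma>) (\<lambda>Z. (norm Z)\<^sup>2)"
  proof (rule integrable_matrix_normal_polynomial[OF \<Sigma>, of _ 1])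
    show "\<bar>(norm Y)\<^sup>2\<bar> \<le> 1 * (1 + (norm Y)\<^sup>2)\<^sup>2" for Y :: "real^'p^'n"
    proof -
      have "1 + (norm Y)\<^sup>2 \<le> (1 + (norm Y)\<^sup>2)\<^sup>2" by (rule self_le_power) auto
      then have "(norm Y)\<^sup>2 \<le> (1 + (norm Y)\<^sup>2)\<^sup>2" by linarith
      then show ?thesis by simp
    qed
  qed measurable
  have "(\<integral>\<^sup>+Z. norm (ln (det (gram Z))) \<partial>matrix_normal \<Theta> \<Sigma>)
    \<le> (\<integral>\<^sup>+Z. neg_log (det (gram Z)) + ennreal ((norm Z)\<^sup>2) \<partial>matrix_normal \<Theta> \<Sigma>)"
  proof (intro nn_integral_mono_AE)
    show "AE Z in matrix_normal \<Theta> \<Sigma>. ennreal (norm (ln (det (gram Z)))) \<le> neg_log (det (gram Z)) + ennreal ((norm Z)\<^sup>2)"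
      using AE_gram_invertible[OF \<Sigma> le, of \<Theta>]
    proof eventually_elim
      case (elim Z)
      have pd: "pos_def_matrix (gram Z)" by (rule pos_def_matrix_gram[OF elim])
      have "0 \<le> kl_formula (0 :: real^'p^'n) (gram Z) 0 (mat 1)"
        by (rule kl_formula_nonneg[OF pos_def_matrix_one pd])
      moreover have "matrix_inv (mat 1) = (mat 1 :: real^'p^'p)" by (rule matrix_inv_eqI) simp
      moreover have "trace (gram Z) = (norm Z)\<^sup>2"
        by (simp add: inner_matrix_eq_trace[symmetric] power2_norm_eq_inner)
      ultimately have "ln (det (gram Z)) \<le> (norm Z)\<^sup>2"
        by (simp add: kl_formula_def zero_le_mult_iff)
      then have "norm (ln (det (gram Z))) \<le> max 0 (- ln (det (gram Z))) + (norm Z)\<^sup>2"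
        by (auto simp: abs_if max_def)
      then have "ennreal (norm (ln (det (gram Z)))) \<le> ennreal (max 0 (- ln (det (gram Z)))) + ennreal ((norm Z)\<^sup>2)"
        by (metis ennreal_leI ennreal_plus max.cobounded1 zero_le_power2)
      moreover have "neg_log (det (gram Z)) = ennreal (max 0 (- ln (det (gram Z))))"
        using pos_def_matrix_det_pos[OF pd] by (simp add: neg_log_def max_def ennreal_neg)
      ultimately show ?case by simp
    qed
  qed
  also have "\<dots> = (\<integral>\<^sup>+Z. neg_log (det (gram Z)) \<partial>matrix_normal \<Theta> \<Sigma>) + (\<integral>\<^sup>+Z. ennreal ((norm Z)\<^sup>2) \<partial>matrix_normal \<Theta> \<Sigma>)"
    by (rule nn_integral_add) measurable
  also have "\<dots> < \<infinity>"
    using nn_integral_neg_log_det_gram[OF \<Sigma> le, of \<Theta>] trI by (simp add: nn_integral_eq_integral)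
  finally show "(\<integral>\<^sup>+Z. norm (ln (det (gram Z))) \<partial>matrix_normal \<Theta> \<Sigma>) < \<infinity>" .
qed

section \<open>The risk as an integral over two normal matrices\<close>

text \<open>
  Unlike the definition, the right-hand side is visibly a Borel condition: two closed ones and
  an open one.
\<close>

lemma pos_def_matrix_iff_semidef:
  fixes S :: "real^'p^'p"
  shows "pos_def_matrix S \<longleftrightarrow> transpose S = S \<and> (\<forall>x. 0 \<le> x \<bullet> (S *v x)) \<and> invertible S"
proof (intro iffI conjI)
  assume *: "transpose S = S \<and> (\<forall>x. 0 \<le> x \<bullet> (S *v x)) \<and> invertible S"
  then have S: "transpose S = S" "\<And>x. 0 \<le> x \<bullet> (S *v x)" "invertible S" by auto
  obtain B :: "real^'p^'p" and r where B: "invertible B" "mat 1 = transpose B ** B" "S = transpose B ** diagonal r ** B"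
    by (rule simultaneous_diagonalization[OF pos_def_matrix_one S(1)])
  have "0 < r $ i" for i
  proof -
    obtain x where "x \<bullet> (S *v x) = r $ i" unfolding B(3) by (rule quadratic_form_diagonal_coeff[OF B(1)])
    then have "0 \<le> r $ i" using S(2)[of x] by simp
    moreover have "(\<Prod>i\<in>UNIV. r $ i) \<noteq> 0"
      using S(3) unfolding invertible_det_nz B(3) det_congruence_diagonal[OF B(2)] .
    then have "r $ i \<noteq> 0" by auto
    ultimately show ?thesis by simp
  qed
  then show "pos_def_matrix S" unfolding B(3) pos_def_matrix_diagonal[OF B(1)] by blast
next
  assume S: "pos_def_matrix S"
  show "transpose S = S" by (rule pos_def_matrix_symmetric[OF S])
  show "invertible S" by (rule pos_def_matrix_invertible[OF S])
  show "\<forall>x. 0 \<le> x \<bullet> (S *v x)"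
  proof
    fix x show "0 \<le> x \<bullet> (S *v x)" using S by (cases "x = 0") (auto simp: pos_def_matrix_def less_imp_le)
  qed
qed

lemma continuous_on_matrix_vector_mult: "continuous_on UNIV (\<lambda>S :: real^'p^'p. S *v x)"
  unfolding matrix_mult_dot by (intro continuous_intros)

lemma sets_pos_def_matrix [measurable]: "{S :: real^'p^'p. pos_def_matrix S} \<in> sets borel"
proof -
  have "{S :: real^'p^'p. pos_def_matrix S} = {S. transpose S = S} \<inter> (\<Inter>x. {S. 0 \<le> x \<bullet> (S *v x)}) \<inter> {S. invertible S}"
    by (auto simp: pos_def_matrix_iff_semidef)
  moreover have "closed {S :: real^'p^'p. transpose S = S}"
    by (intro closed_Collect_eq continuous_intros)
  moreover have "closed (\<Inter>x. {S :: real^'p^'p. 0 \<le> x \<bullet> (S *v x)})"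
    by (intro closed_INT ballI closed_Collect_le continuous_intros continuous_on_matrix_vector_mult)
  ultimately show ?thesis using open_invertible[where 'p='p] by (auto intro: borel_closed borel_open)
qed

lemma pred_pos_def_matrix [measurable]:
  "Measurable.pred borel (pos_def_matrix :: real^'p^'p \<Rightarrow> bool)"
  using sets_pos_def_matrix by (simp add: pred_def)

lemma AE_gram_pos_def:
  fixes \<Theta> :: "real^'p^'n"
  assumes "pos_def_matrix \<Sigma>" "CARD('p) \<le> CARD('n)"
  shows "AE Z in matrix_normal \<Theta> \<Sigma>. pos_def_matrix (gram Z)"
  using AE_gram_invertible[OF assms] by eventually_elim (rule pos_def_matrix_gram)

text \<open>
  Since the loss is only known in closed form where \<open>S\<close> and \<open>X\<^sup>T X\<close> are positive definite, it is first
  replaced by a measurable function that agrees with it almost everywhere; then the Wishart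
  distribution is unfolded as the law of \<open>Z\<^sup>T Z\<close>.
\<close>

lemma kl_risk_eq:
  fixes \<Theta> :: "real^'p^'m" and \<delta> :: "real^'p^'m \<Rightarrow> real^'p^'p \<Rightarrow> (real^'p^'m) \<times> (real^'p^'p)"
  assumes \<Sigma>: "pos_def_matrix \<Sigma>" and pm: "CARD('p) \<le> CARD('m)" and pn: "CARD('p) \<le> CARD('n)"
    and h [measurable]: "(\<lambda>(X, S). h X S) \<in> borel_measurable (borel \<Otimes>\<^sub>M borel)"
    and eq: "\<And>X S. pos_def_matrix (gram X) \<Longrightarrow> pos_def_matrix S \<Longrightarrow> kl_loss (\<delta> X S) \<Theta> \<Sigma> = h X S"
  shows "kl_risk TYPE('n::finite) \<delta> \<Theta> \<Sigma> = (\<integral>\<^sup>+(X, Z). ennreal (h X (gram Z))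
     \<partial>(matrix_normal \<Theta> \<Sigma> \<Otimes>\<^sub>M matrix_normal (0 :: real^'p^'n) \<Sigma>))"
proof -
  let ?MX = "matrix_normal \<Theta> \<Sigma>" and ?MZ = "matrix_normal (0 :: real^'p^'n) \<Sigma>"
  let ?W = "wishart TYPE('n) \<Sigma>"
  interpret MX: prob_space ?MX by (rule prob_space_matrix_normal[OF \<Sigma>])
  interpret MZ: prob_space ?MZ by (rule prob_space_matrix_normal[OF \<Sigma>])
  have [measurable_cong, simp]: "sets ?W = sets borel" by (simp add: wishart_def)
  have gm [measurable]: "(\<lambda>Z :: real^'p^'n. transpose Z ** Z) \<in> ?MZ \<rightarrow>\<^sub>M borel" by measurable
  interpret W: prob_space ?W unfolding wishart_def by (rule MZ.prob_space_distr[OF gm])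
  interpret XW: pair_sigma_finite ?MX ?W ..
  have W_ae: "AE S in ?W. pos_def_matrix S"
    unfolding wishart_def
    by (subst AE_distr_iff) (use AE_gram_pos_def[OF \<Sigma> pn, of 0] in auto)
  have "AE X in ?MX. AE S in ?W. pos_def_matrix (gram X) \<and> pos_def_matrix S"
    using AE_gram_pos_def[OF \<Sigma> pm, of \<Theta>]
  proof eventually_elim
    case (elim X)
    show ?case using W_ae by eventually_elim (use elim in simp)
  qed
  then have ae: "AE p in ?MX \<Otimes>\<^sub>M ?W. pos_def_matrix (transpose (fst p) ** fst p) \<and> pos_def_matrix (snd p)"
  proof (intro XW.AE_pair_measure)
    show "{p \<in> space (?MX \<Otimes>\<^sub>M ?W). pos_def_matrix (transpose (fst p) ** fst p) \<and> pos_def_matrix (snd p)}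
      \<in> sets (?MX \<Otimes>\<^sub>M ?W)" by measurable
  qed simp
  have "kl_risk TYPE('n) \<delta> \<Theta> \<Sigma> = (\<integral>\<^sup>+(X, S). ennreal (h X S) \<partial>(?MX \<Otimes>\<^sub>M ?W))"
    unfolding kl_risk_def by (rule nn_integral_cong_AE) (use ae in \<open>eventually_elim, auto simp: eq\<close>)
  also have "\<dots> = (\<integral>\<^sup>+X. \<integral>\<^sup>+S. ennreal (h X S) \<partial>?W \<partial>?MX)"
    by (subst W.nn_integral_fst[symmetric]) (auto intro: measurable)
  also have "\<dots> = (\<integral>\<^sup>+X. \<integral>\<^sup>+Z. ennreal (h X (gram Z)) \<partial>?MZ \<partial>?MX)"
    unfolding wishart_def by (intro nn_integral_cong nn_integral_distr) (auto intro: measurable)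
  also have "\<dots> = (\<integral>\<^sup>+(X, Z). ennreal (h X (gram Z)) \<partial>(?MX \<Otimes>\<^sub>M ?MZ))"
    by (subst MZ.nn_integral_fst[symmetric]) (auto intro: measurable)
  finally show ?thesis .
qed

section \<open>The estimators at a fixed sample\<close>

text \<open>
  The matrix \<open>Q = I - R\<close>, where \<open>R\<close> is the shrinkage factor. It is expressed by \<open>Z\<close> instead
  of \<open>S\<close> so that Stein's identity applies to it directly.
\<close>

definition shrink_complement :: "real \<Rightarrow> real^'p^'m \<Rightarrow> real^'p^'n \<Rightarrow> real^'p^'p" where
  "shrink_complement \<beta> X Z = ridge (\<beta> *\<^sub>R gram X) Z"

text \<open>
  A sample outside the null set where \<open>S\<close> or \<open>X\<^sup>T X\<close> is singular.
\<close>

locale shrinkage_sample =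
  fixes \<beta> :: real and X :: "real^'p^'m" and Z :: "real^'p^'n"
  assumes \<beta>: "0 < \<beta>" and T: "pos_def_matrix (gram X)" and S: "pos_def_matrix (gram Z)"
begin

abbreviation "Q \<equiv> shrink_complement \<beta> X Z"
abbreviation "R \<equiv> mat 1 - shrink_complement \<beta> X Z"

lemma \<beta>T: "pos_def_matrix (\<beta> *\<^sub>R gram X)" by (rule pos_def_matrix_scaleR[OF T \<beta>])

lemma R_eq: "R = ridge_inv (\<beta> *\<^sub>R gram X) Z ** gram Z"
  unfolding shrink_complement_def ridge_inv_gram[OF \<beta>T] ..

lemma shrink_factor_eq: "shrink_factor \<beta> X (gram Z) = R"
  unfolding shrink_factor_def
proof (rule matrix_inv_eqI)
  let ?S = "transpose Z ** Z" and ?A = "transpose Z ** Z + \<beta> *\<^sub>R gram X"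
  have inv: "invertible ?S" by (rule pos_def_matrix_invertible[OF S])
  have invA: "invertible ?A" by (rule pos_def_matrix_invertible[OF ridge_pos_def[OF \<beta>T]])
  have "mat 1 + \<beta> *\<^sub>R (matrix_inv ?S ** gram X) = matrix_inv ?S ** ?A"
    by (simp only: matrix_mult_bilinear matrix_inv_left[OF inv])
  then have "(mat 1 + \<beta> *\<^sub>R (matrix_inv ?S ** gram X)) ** R = matrix_inv ?S ** (?A ** matrix_inv ?A) ** ?S"
    by (simp only: R_eq ridge_inv_def matrix_mul_assoc)
  then show "(mat 1 + \<beta> *\<^sub>R (matrix_inv ?S ** gram X)) ** R = mat 1"
    by (simp only: matrix_inv_right[OF invA] matrix_mul_rid matrix_inv_left[OF inv])
qed

text \<open>
  \<open>(X\<^sup>T X + \<beta>\<^sup>-\<^sup>1 S)\<^sup>-\<^sup>1 \<beta>\<^sup>-\<^sup>1 S = (S + \<beta> X\<^sup>T X)\<^sup>-\<^sup>1 S\<close>. So \<open>R\<close> has the form to which the Stein identity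
  in \<open>X\<close>, for fixed \<open>Z\<close>, applies.
\<close>

lemma ridge_X_eq: "ridge ((1 / \<beta>) *\<^sub>R gram Z) X = R"
proof -
  let ?S = "transpose Z ** Z" and ?A = "transpose Z ** Z + \<beta> *\<^sub>R gram X"
  have invA: "invertible ?A" by (rule pos_def_matrix_invertible[OF ridge_pos_def[OF \<beta>T]])
  have "transpose X ** X + (1 / \<beta>) *\<^sub>R ?S = (1 / \<beta>) *\<^sub>R ?A"
    using \<beta> by (simp add: scaleR_add_right add.commute)
  moreover have "matrix_inv ((1 / \<beta>) *\<^sub>R ?A) = \<beta> *\<^sub>R matrix_inv ?A"
    by (rule matrix_inv_eqI) (use \<beta> in \<open>simp add: matrix_mult_bilinear(7,8) matrix_inv_right[OF invA]\<close>)
  ultimately show ?thesis unfolding R_eq ridge_def ridge_inv_def using \<beta>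
    by (simp add: matrix_mult_bilinear(7,8))
qed

lemma sample_eigenvalues:
  obtains B :: "real^'p^'p" and r where "invertible B" "\<And>i. 0 < r $ i" "\<And>i. r $ i \<le> 1"
    "gram Z = transpose B ** diagonal r ** B"
    "\<beta> *\<^sub>R gram X = transpose B ** diagonal (\<chi> i. 1 - r $ i) ** B"
    "R = matrix_inv B ** diagonal r ** B" "Q = matrix_inv B ** diagonal (\<chi> i. 1 - r $ i) ** B"
proof -
  have semi: "0 \<le> x \<bullet> ((\<beta> *\<^sub>R gram X) *v x)" for x
    using \<beta>T unfolding pos_def_matrix_iff_semidef by blast
  obtain B :: "real^'p^'p" and r where B: "invertible B"
    "transpose Z ** Z + \<beta> *\<^sub>R gram X = transpose B ** B"
    "gram Z = transpose B ** diagonal r ** B"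
    "\<beta> *\<^sub>R gram X = transpose B ** diagonal (\<chi> i. 1 - r $ i) ** B"
    and r: "\<And>i. 0 < r $ i" "\<And>i. r $ i \<le> 1"
    by (rule pencil_diagonalization[OF S pos_def_matrix_symmetric[OF \<beta>T] semi]) blast
  show thesis
  proof (rule that[OF B(1) r B(3,4)])
    show "R = matrix_inv B ** diagonal r ** B"
      unfolding R_eq ridge_inv_def B(2) unfolding B(3) by (rule matrix_inv_gram_mult_diagonal[OF B(1)])
    show "Q = matrix_inv B ** diagonal (\<chi> i. 1 - r $ i) ** B"
      unfolding shrink_complement_def ridge_def ridge_inv_def B(2)
      unfolding B(4) by (rule matrix_inv_gram_mult_diagonal[OF B(1)])
  qed
qed

end

lemma trace_congruence_diagonal:
  fixes B :: "real^'p^'p"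
  shows "trace (transpose B ** diagonal d ** B) = (\<Sum>i\<in>UNIV. d $ i * (norm (B $ i))\<^sup>2)"
proof -
  have dB: "(diagonal d ** B) $ i = d $ i *\<^sub>R B $ i" for i
    by (simp add: diagonal_def matrix_matrix_mult_def vec_eq_iff sum_if_eq_mult)
  have "trace (transpose B ** diagonal d ** B) = B \<bullet> (diagonal d ** B)"
    by (simp add: inner_matrix_eq_trace matrix_mul_assoc)
  also have "\<dots> = (\<Sum>i\<in>UNIV. B $ i \<bullet> (d $ i *\<^sub>R B $ i))" by (simp only: inner_vec_def dB)
  finally show ?thesis by (simp add: power2_norm_eq_inner)
qed

text \<open>
  \<open>|Y N|\<^sup>2 = tr (N\<^sup>T Y\<^sup>T Y N)\<close>, and the congruence by \<open>B\<close> makes this matrix diagonal.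
\<close>

lemma norm_mult_similar_diagonal:
  fixes B :: "real^'p^'p" and Y :: "real^'p^'k"
  assumes B: "invertible B" and Y: "gram Y = transpose B ** diagonal r ** B"
  shows "(norm (Y ** (matrix_inv B ** diagonal d ** B)))\<^sup>2 = (\<Sum>i\<in>UNIV. (d $ i)\<^sup>2 * r $ i * (norm (B $ i))\<^sup>2)"
proof -
  let ?N = "matrix_inv B ** diagonal d ** B"
  have dt: "transpose (diagonal d) = diagonal d" by (auto simp: diagonal_def transpose_def vec_eq_iff)
  have BBt: "transpose (matrix_inv B) ** transpose B = mat 1"
    by (metis matrix_inv_right[OF B] matrix_transpose_mul transpose_mat)
  have "(norm (Y ** ?N))\<^sup>2 = trace (transpose ?N ** gram Y ** ?N)"
    by (simp add: power2_norm_eq_inner inner_matrix_eq_trace matrix_transpose_mul matrix_mul_assoc)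
  also have "transpose ?N ** gram Y ** ?N
    = transpose B ** diagonal d ** (transpose (matrix_inv B) ** transpose B) ** diagonal r ** (B ** matrix_inv B) ** diagonal d ** B"
    unfolding Y by (simp add: matrix_transpose_mul matrix_mul_assoc dt)
  also have "\<dots> = transpose B ** (diagonal d ** diagonal r ** diagonal d) ** B"
    unfolding BBt matrix_inv_right[OF B] by (simp add: matrix_mul_assoc)
  also have "diagonal d ** diagonal r ** diagonal d = diagonal (\<chi> i. (d $ i)\<^sup>2 * r $ i)"
    by (simp add: diagonal_mult power2_eq_square mult_ac)
  finally show ?thesis by (simp add: trace_congruence_diagonal)
qed

context shrinkage_sample
begin

text \<open>
  These bounds dominate all random terms of the difference of the losses by moments of \<open>X\<close> and
  \<open>Z\<close>. For the last one, \<open>\<beta> X\<^sup>T X\<close> has the entries \<open>1 - r\<^sub>i\<close> where \<open>Z\<^sup>T Z\<close> has \<open>r\<^sub>i\<close>, and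
  \<open>r\<^sub>i\<^sup>2 (1 - r\<^sub>i) \<le> r\<^sub>i\<close>.
\<close>

lemma norm_Z_Q: "norm (Z ** Q) \<le> norm Z" and norm_Z_QQ: "norm (Z ** Q ** Q) \<le> norm Z"
  and norm_X_R: "norm (X ** R) \<le> sqrt (1 / \<beta>) * norm Z"
proof -
  obtain B :: "real^'p^'p" and r where B: "invertible B" and r: "\<And>i. 0 < r $ i" "\<And>i. r $ i \<le> 1"
    and gram: "gram Z = transpose B ** diagonal r ** B"
      "\<beta> *\<^sub>R gram X = transpose B ** diagonal (\<chi> i. 1 - r $ i) ** B"
    and RQ: "R = matrix_inv B ** diagonal r ** B" "Q = matrix_inv B ** diagonal (\<chi> i. 1 - r $ i) ** B"
    by (rule sample_eigenvalues) blast
  have nZ: "(norm Z)\<^sup>2 = (\<Sum>i\<in>UNIV. r $ i * (norm (B $ i))\<^sup>2)"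
    using trace_congruence_diagonal[of B r] unfolding gram(1)[symmetric]
    by (simp add: inner_matrix_eq_trace[symmetric] power2_norm_eq_inner)
  have QQ: "Q ** Q = matrix_inv B ** diagonal (\<chi> i. (1 - r $ i) * (1 - r $ i)) ** B"
    unfolding RQ(2) similar_diagonal_mult[OF B] by simp
  have le: "(norm (Z ** (matrix_inv B ** diagonal d ** B)))\<^sup>2 \<le> (norm Z)\<^sup>2" if "\<And>i. (d $ i)\<^sup>2 \<le> 1" for d
    unfolding norm_mult_similar_diagonal[OF B gram(1)] nZ
    using that r by (intro sum_mono mult_right_mono mult_left_le_one_le) (auto simp: less_imp_le)
  have sq: "(1 - r $ i)\<^sup>2 \<le> 1" for i using r[of i] by (simp add: power_le_one)
  show "norm (Z ** Q) \<le> norm Z" unfolding RQ(2)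
    by (rule power2_le_imp_le[OF le]) (use sq in auto)
  have "((1 - r $ i) * (1 - r $ i))\<^sup>2 \<le> 1" for i
    using sq[of i] r[of i] by (simp add: power2_eq_square[symmetric] power_le_one)
  then have "norm (Z ** (Q ** Q)) \<le> norm Z" unfolding QQ
    by (intro power2_le_imp_le[OF le]) auto
  then show "norm (Z ** Q ** Q) \<le> norm Z" by (simp add: matrix_mul_assoc)
  have gX: "transpose (sqrt \<beta> *\<^sub>R X) ** (sqrt \<beta> *\<^sub>R X) = transpose B ** diagonal (\<chi> i. 1 - r $ i) ** B"
    unfolding gram(2)[symmetric] using \<beta> by (simp add: transpose_scalar matrix_mult_bilinear)
  have "\<beta> * (norm (X ** R))\<^sup>2 = (norm ((sqrt \<beta> *\<^sub>R X) ** R))\<^sup>2"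
    using \<beta> by (simp add: matrix_mult_bilinear(7) power_mult_distrib)
  also have "\<dots> = (\<Sum>i\<in>UNIV. ((r $ i)\<^sup>2 * (1 - r $ i)) * (norm (B $ i))\<^sup>2)"
    unfolding RQ(1) norm_mult_similar_diagonal[OF B gX] by simp
  also have "\<dots> \<le> (norm Z)\<^sup>2" unfolding nZ
  proof (intro sum_mono mult_right_mono)
    fix i
    have "(r $ i) * (r $ i * (1 - r $ i)) \<le> r $ i * 1"
      using r[of i] by (intro mult_left_mono mult_le_one) auto
    then show "(r $ i)\<^sup>2 * (1 - r $ i) \<le> r $ i" by (simp add: power2_eq_square mult.assoc)
  qed simp
  finally have "(norm (X ** R))\<^sup>2 \<le> (sqrt (1 / \<beta>) * norm Z)\<^sup>2"
    using \<beta> by (simp add: power_mult_distrib field_simps)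
  then show "norm (X ** R) \<le> sqrt (1 / \<beta>) * norm Z" by (rule power2_le_imp_le) (use \<beta> in simp)
qed

text \<open>
  \<open>\<beta> R\<^sup>T X\<^sup>T X R = S A\<^sup>-\<^sup>1 (\<beta> X\<^sup>T X) R = S Q (I - Q)\<close>. This trades the quadratic form in \<open>X R\<close> for one
  in which Stein's identity in \<open>Z\<close> can be used.
\<close>

lemma quadratic_X_R:
  "((X ** R) ** M) \<bullet> (X ** R) = (1 / \<beta>) * ((Z ** M) \<bullet> (Z ** Q) - (Z ** M) \<bullet> (Z ** Q ** Q))"
  if M: "transpose M = M"
proof -
  let ?Ai = "ridge_inv (\<beta> *\<^sub>R gram X) Z"
  have Rt: "transpose R = (gram Z) ** ?Ai"
    unfolding R_eq by (simp add: matrix_transpose_mul ridge_inv_symmetric[OF \<beta>T] transpose_gram matrix_mul_assoc)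
  have "(gram Z) ** Q = (gram Z) ** ?Ai ** (\<beta> *\<^sub>R gram X)"
    by (simp only: shrink_complement_def ridge_def matrix_mul_assoc)
  then have "transpose R ** (\<beta> *\<^sub>R gram X) = (gram Z) ** Q"
    by (simp only: Rt)
  then have b: "\<beta> *\<^sub>R (transpose R ** gram X) = (gram Z) ** Q"
    by (simp only: matrix_mult_bilinear(8))
  have "\<beta> *\<^sub>R (transpose R ** gram X ** R) = (gram Z) ** Q ** R"
    unfolding b[symmetric] by (rule matrix_mult_bilinear(7)[symmetric])
  also have "\<dots> = (gram Z) ** (Q - Q ** Q)"
    by (simp only: matrix_mult_bilinear(4) matrix_mul_rid matrix_mul_assoc)
  finally have "(1 / \<beta>) *\<^sub>R (\<beta> *\<^sub>R (transpose R ** gram X ** R)) = (1 / \<beta>) *\<^sub>R (gram Z ** (Q - Q ** Q))"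
    by (rule arg_cong)
  then have 1: "transpose R ** gram X ** R = (1 / \<beta>) *\<^sub>R (gram Z ** (Q - Q ** Q))"
    using \<beta> by simp
  have "((X ** R) ** M) \<bullet> (X ** R) = (X ** R) \<bullet> ((X ** R) ** M)" by (rule inner_commute)
  also have "\<dots> = trace (transpose R ** gram X ** R ** M)"
    by (simp add: inner_matrix_eq_trace matrix_transpose_mul matrix_mul_assoc)
  also have "\<dots> = (1 / \<beta>) * trace (gram Z ** (Q - Q ** Q) ** M)"
    unfolding 1 by (simp add: matrix_mult_bilinear(7) trace_linear)
  also have "trace (gram Z ** (Q - Q ** Q) ** M) = trace (M ** (gram Z ** (Q - Q ** Q)))"
    by (rule trace_mul_sym)
  also have "\<dots> = (Z ** M) \<bullet> (Z ** (Q - Q ** Q))"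
    by (simp add: inner_matrix_eq_trace matrix_transpose_mul M matrix_mul_assoc)
  finally show ?thesis by (simp add: matrix_mult_bilinear inner_diff_right matrix_mul_assoc)
qed

end

section \<open>The scalar inequality behind the domination\<close>

text \<open>
  With \<open>s\<^sup>2 = 1 - x\<close> the claim is \<open>- 2 log s \<le> 1/s - s\<close>, and the difference of the two sides has
  the derivative \<open>- (1/s - 1)\<^sup>2\<close>.
\<close>

lemma minus_ln_le_div_sqrt:
  fixes x :: real assumes "0 \<le> x" "x < 1"
  shows "- ln (1 - x) \<le> x / sqrt (1 - x)"
proof -
  define s where "s = sqrt (1 - x)"
  have s: "0 < s" "s \<le> 1" "1 - x = s * s" using assms by (auto simp: s_def)
  define f where "f = (\<lambda>s::real. 1 / s - s + 2 * ln s)"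
  have "f 1 \<le> f s"
  proof (rule DERIV_nonpos_imp_nonincreasing[of s 1 f])
    show "s \<le> 1" by fact
    fix y assume y: "s \<le> y" "y \<le> 1"
    then have "(f has_real_derivative (- (1 / y\<^sup>2) - 1 + 2 * (1 / y))) (at y)" unfolding f_def
      using s by (auto intro!: derivative_eq_intros simp: power2_eq_square)
    moreover have "- (1 / y\<^sup>2) - 1 + 2 * (1 / y) = - (1 / y - 1)\<^sup>2"
      by (simp add: power2_eq_square algebra_simps)
    ultimately show "\<exists>z. (f has_real_derivative z) (at y) \<and> z \<le> 0" by (metis neg_le_0_iff_le zero_le_power2)
  qed
  moreover have "f 1 = 0" by (simp add: f_def)
  ultimately have "- 2 * ln s \<le> 1 / s - s" by (simp add: f_def)
  moreover have "ln (1 - x) = 2 * ln s" using s by (simp add: ln_mult)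
  moreover have "x / s = 1 / s - s" using s(1,3) by (simp add: field_simps)
  ultimately show ?thesis unfolding s_def[symmetric] by simp
qed

text \<open>
  By the previous lemma it suffices to bound \<open>(1 - x)\<^sup>-\<^sup>1\<^sup>/\<^sup>2 - 1\<close> at \<open>x = \<alpha> r\<close> by \<open>r\<close> times its value at
  \<open>x = \<alpha>\<close>; this function of \<open>x\<close> is convex and vanishes at \<open>0\<close>.
\<close>

lemma minus_ln_one_minus_le:
  fixes \<alpha> r :: real
  assumes "0 < \<alpha>" "\<alpha> < 1" "0 \<le> r" "r \<le> 1"
  shows "- ln (1 - \<alpha> * r) \<le> \<alpha> * r + \<alpha> * (1 / sqrt (1 - \<alpha>) - 1) * r\<^sup>2"
proof -
  define x where "x = \<alpha> * r"
  have "x \<le> \<alpha>" using assms mult_left_mono[of r 1 \<alpha>] by (simp add: x_def)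
  moreover have "0 \<le> x" using assms by (simp add: x_def)
  ultimately have x: "0 \<le> x" "x \<le> \<alpha>" "x < 1" using assms by linarith+
  define s where "s = sqrt (1 - x)"
  define s0 where "s0 = sqrt (1 - \<alpha>)"
  have s: "0 < s0" "s0 \<le> s" "s \<le> 1" "s * s = 1 - x" "s0 * s0 = 1 - \<alpha>" "0 < s"
    using assms x by (auto simp: s_def s0_def)
  have factor: "1 / u - 1 = (1 - u * u) / (u * (1 + u))" if "0 < u" for u :: real
  proof -
    have "1 / u - 1 = (1 - u) / u" using that by (simp add: field_simps)
    also have "\<dots> = ((1 - u) * (1 + u)) / (u * (1 + u))"
      using that by (intro mult_divide_mult_cancel_right[symmetric]) auto
    finally show ?thesis by (simp add: algebra_simps)
  qed
  have "1 / s - 1 = (1 - s * s) / (s * (1 + s))" using s by (intro factor)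
  also have "\<dots> = x / (s * (1 + s))" using s by simp
  also have "\<dots> \<le> x / (s0 * (1 + s0))"
    using s x by (intro divide_left_mono mult_mono mult_pos_pos add_pos_pos add_mono) auto
  also have "\<dots> = r * ((1 - s0 * s0) / (s0 * (1 + s0)))" using s by (simp add: x_def)
  also have "(1 - s0 * s0) / (s0 * (1 + s0)) = 1 / s0 - 1" using s by (intro factor[symmetric])
  finally have "x * (1 / s - 1) \<le> x * (r * (1 / s0 - 1))" using x by (intro mult_left_mono) auto
  moreover have "- ln (1 - x) \<le> x * (1 / s)" using minus_ln_le_div_sqrt[of x] x unfolding s_def by simp
  ultimately show ?thesis unfolding x_def s0_def by (simp add: algebra_simps power2_eq_square)
qed

text \<open>
  Let \<open>\<lambda> = (1 - \<alpha>)\<^sup>-\<^sup>1\<^sup>/\<^sup>2 - 1\<close> and \<open>y = 1 - (p - 1) / m\<close>. If the conclusion failed, then \<open>\<lambda> \<ge> 2 y\<close> and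
  \<open>\<alpha> / (2 (1 - \<alpha>)) = \<lambda> (\<lambda> + 2) / 2 \<ge> 2 y (y + 1)\<close>, while the assumption bounds the left-hand
  side by \<open>2 (y - 2 / m) + 2 / n\<close> strictly, and \<open>n \<ge> p\<close>. Together they give
  \<open>p y\<^sup>2 + 2 p / m < 1\<close>, which is impossible in view of \<open>y = 1 - (p - 1) / m\<close>.
\<close>

lemma shrinkage_parameter_bound:
  fixes \<alpha> \<beta> :: real and n m p :: nat
  assumes "1 \<le> p" "p \<le> n" "p \<le> m" "0 < \<alpha>" "0 < \<beta>" "\<alpha> < 1"
    and bound: "(real n + real p + 1) * \<alpha> + real m * \<alpha> * \<beta> / (2 * (1 - \<alpha>))
           \<le> 2 * (real m - real p - 1) * \<beta> + 2 * (real m / real n) * \<beta>"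
  shows "real m * (1 / sqrt (1 - \<alpha>) - 1) < 2 * (real m - real p + 1)"
proof (rule ccontr)
  define l where "l = 1 / sqrt (1 - \<alpha>) - 1"
  define v where "v = 1 / real m"
  have m: "1 \<le> m" "1 \<le> n" using assms by auto
  assume "\<not> ?thesis"
  then have l: "2 * (1 - (real p - 1) * v) \<le> l" using m unfolding l_def[symmetric] v_def
    by (simp add: field_simps)
  have "(l + 1)\<^sup>2 = 1 / (1 - \<alpha>)" using assms by (simp add: l_def power_divide)
  moreover have "l * (l + 2) = (l + 1)\<^sup>2 - 1" by (simp add: power2_eq_square algebra_simps)
  moreover have "1 / (1 - \<alpha>) - 1 = \<alpha> / (1 - \<alpha>)" using assms(6) by (simp add: field_simps)
  ultimately have "l * (l + 2) = \<alpha> / (1 - \<alpha>)" by simp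
  then have al: "\<alpha> / (2 * (1 - \<alpha>)) = l * (l + 2) / 2" by simp
  define y where "y = 1 - (real p - 1) * v"
  have y0: "0 < y" using assms m unfolding y_def v_def by (simp add: field_simps)
  have "(2 * y) * (2 * y + 2) \<le> l * (l + 2)" using l y0 unfolding y_def[symmetric]
    by (intro mult_mono) auto
  then have 1: "2 * y * (y + 1) \<le> \<alpha> / (2 * (1 - \<alpha>))" unfolding al by (simp add: algebra_simps)
  have "(real n + real p + 1) * \<alpha> > 0" using assms by (simp add: add_nonneg_pos)
  with bound have "(real m * (\<alpha> / (2 * (1 - \<alpha>)))) * \<beta> < (2 * (real m - real p - 1) + 2 * (real m / real n)) * \<beta>"
    by (simp add: algebra_simps)
  then have "real m * (\<alpha> / (2 * (1 - \<alpha>))) < 2 * (real m - real p - 1) + 2 * (real m / real n)"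
    using assms by (simp only: mult_less_cancel_right_pos)
  then have "\<alpha> / (2 * (1 - \<alpha>)) < v * (2 * (real m - real p - 1) + 2 * (real m / real n))"
    using m unfolding v_def by (simp add: field_simps)
  also have "\<dots> = 2 * (y - 2 * v) + 2 / real n" using m unfolding v_def y_def by (simp add: field_simps)
  also have "\<dots> \<le> 2 * (y - 2 * v) + 2 / real p" using assms by (simp add: divide_left_mono)
  finally have "y\<^sup>2 + 2 * v < 1 / real p" using 1 by (simp add: power2_eq_square algebra_simps)
  then have "real p * y\<^sup>2 + 2 * real p * v < 1" using assms by (simp add: field_simps)
  moreover have "1 \<le> real p * y\<^sup>2 + 2 * real p * v"
  proof (cases "p = 1")
    case True
    then show ?thesis using m by (simp add: y_def v_def)
  next
    case False
    define k where "k = real p - 1"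
    have k: "1 \<le> k" using False assms by (simp add: k_def)
    define w where "w = k * v"
    have py: "real p = k + 1" "y = 1 - w" by (auto simp: k_def w_def y_def)
    \<comment> \<open>With \<open>w = k v\<close>, completing the square shows that \<open>p y\<^sup>2 + 2 p v - 1\<close> is nonnegative.\<close>
    have "k * (real p * y\<^sup>2 + 2 * real p * v - 1) = k * (k + 1) * (1 - w)\<^sup>2 + 2 * (k + 1) * w - k"
      unfolding py by (simp add: w_def algebra_simps)
    also have "k * (k + 1) * (1 - w)\<^sup>2 + 2 * (k + 1) * w - k = k\<^sup>2 * (1 - w)\<^sup>2 + k * w\<^sup>2 + 2 * w"
      by (simp add: power2_eq_square algebra_simps)
    also have "\<dots> \<ge> 0" using k by (simp add: w_def v_def)
    finally show ?thesis using k by (simp add: zero_le_mult_iff)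
  qed
  ultimately show False by simp
qed

text \<open>
  Put \<open>t\<^sub>1 = \<Sum> r\<^sub>i\<close>, \<open>t\<^sub>2 = \<Sum> r\<^sub>i\<^sup>2\<close>, \<open>w\<^sub>1 = t\<^sub>1 - t\<^sub>2\<close> and divide by \<open>\<alpha>\<close>. The assumption bounds the factor
  \<open>(\<alpha>/\<beta>) (n + p + 1)\<close> of \<open>w\<^sub>1\<close> by \<open>2 (m - p - 1) + 2 m / n\<close>. Up to nonpositive terms, the
  contributions of order \<open>m / n\<close> then add up to \<open>(m / n) (w\<^sub>1 - t\<^sub>1 (p - t\<^sub>1))\<close>, which is at most \<open>0\<close>, since
  \<open>\<Sum> r\<^sub>i (1 - r\<^sub>i) \<le> (\<Sum> r\<^sub>i) (\<Sum> (1 - r\<^sub>i))\<close>. The rest is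
  \<open>m \<lambda> t\<^sub>2 - 2 (m - p) t\<^sub>2 - 2 t\<^sub>1\<^sup>2\<close>, and \<open>t\<^sub>1\<^sup>2 \<ge> t\<^sub>2\<close> reduces the claim to
  \<open>m \<lambda> < 2 (m - p + 1)\<close>.
\<close>

lemma risk_kernel_eigenvalues_negative:
  fixes \<alpha> \<beta> :: real and n m p :: nat and r :: "'p::finite \<Rightarrow> real"
  assumes p_def: "p = CARD('p)" and pn: "p \<le> n" "p \<le> m" and ab: "0 < \<alpha>" "0 < \<beta>" "\<alpha> < 1"
    and bound: "(real n + real p + 1) * \<alpha> + real m * \<alpha> * \<beta> / (2 * (1 - \<alpha>))
           \<le> 2 * (real m - real p - 1) * \<beta> + 2 * (real m / real n) * \<beta>"
    and r: "\<And>i. 0 < r i" "\<And>i. r i \<le> 1"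
  defines "t1 \<equiv> \<Sum>i\<in>UNIV. r i" and "t2 \<equiv> \<Sum>i\<in>UNIV. (r i)\<^sup>2"
    and "w1 \<equiv> \<Sum>i\<in>UNIV. r i * (1 - r i)" and "w2 \<equiv> \<Sum>i\<in>UNIV. (r i)\<^sup>2 * (1 - r i)"
  shows "real m * (- (\<alpha> / real n) * ((real n + real p + 1) * t1 - t2 - t1\<^sup>2) - (\<Sum>i\<in>UNIV. ln (1 - \<alpha> * r i)))
    - 2 * \<alpha> * ((real m - real p - 1) * t1 + t2 + t1\<^sup>2)
    + (\<alpha>\<^sup>2 / \<beta>) * ((real n + real p + 1) * w1 - 2 * w2 - 2 * t1 * w1) < 0"
proof -
  define l where "l = 1 / sqrt (1 - \<alpha>) - 1"
  define L where "L = (\<Sum>i\<in>UNIV. - ln (1 - \<alpha> * r i))"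
  define a where "a = \<alpha> / \<beta>"
  define c where "c = \<alpha> / (2 * (1 - \<alpha>))"
  define q where "q = real m / real n"
  have a0: "0 < a" "0 < c" using ab by (auto simp: a_def c_def)
  have p1: "1 \<le> p" unfolding p_def by (simp add: Suc_leI)
  then have n0: "0 < n" "0 < m" using pn by auto
  have lm: "real m * l < 2 * (real m - real p + 1)" unfolding l_def
    by (rule shrinkage_parameter_bound[OF p1 pn ab bound])
  have bound': "a * (real n + real p + 1) + real m * c \<le> 2 * (real m - real p - 1) + 2 * q"
  proof -
    have "(a * (real n + real p + 1) + real m * c) * \<beta> \<le> (2 * (real m - real p - 1) + 2 * (real m / real n)) * \<beta>"
    proof -
      have "a * \<beta> = \<alpha>" using ab by (simp add: a_def)
      then have "(a * (real n + real p + 1) + real m * c) * \<beta> = (real n + real p + 1) * \<alpha> + real m * \<alpha> * \<beta> / (2 * (1 - \<alpha>))"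
        by (simp add: c_def algebra_simps flip: \<open>a * \<beta> = \<alpha>\<close>)
      then show ?thesis using bound by (simp add: distrib_right)
    qed
    then show ?thesis unfolding q_def using ab by (simp only: mult_le_cancel_right_pos)
  qed
  have t20: "0 < t2" unfolding t2_def by (rule sum_pos) (use r in \<open>auto simp: less_imp_neq[symmetric]\<close>)
  have t10: "0 < t1" unfolding t1_def by (rule sum_pos) (use r in auto)
  have w1: "w1 = t1 - t2" unfolding w1_def t1_def t2_def
    by (simp add: sum_subtractf algebra_simps power2_eq_square)
  have w0: "0 \<le> w1" "0 \<le> w2" unfolding w1_def w2_def using r
    by (auto intro!: sum_nonneg mult_nonneg_nonneg simp: less_imp_le)
  have L: "L \<le> \<alpha> * t1 + \<alpha> * l * t2"
  proof -
    have "L \<le> (\<Sum>i\<in>UNIV. \<alpha> * r i + \<alpha> * l * (r i)\<^sup>2)" unfolding L_def l_def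
      by (intro sum_mono minus_ln_one_minus_le) (use ab r in \<open>auto simp: less_imp_le\<close>)
    then show ?thesis by (simp add: t1_def t2_def sum.distrib sum_distrib_left)
  qed
  have t1t2: "t2 \<le> t1\<^sup>2"
  proof -
    have "t2 = (\<Sum>i\<in>UNIV. r i * r i)" by (simp add: t2_def power2_eq_square)
    also have "\<dots> \<le> (\<Sum>i\<in>UNIV. r i * t1)"
      by (intro sum_mono mult_left_mono) (use r in \<open>auto simp: t1_def less_imp_le intro!: member_le_sum\<close>)
    finally show ?thesis by (simp add: t1_def power2_eq_square sum_distrib_right)
  qed
  have w1_le: "w1 \<le> t1 * (real p - t1)"
  proof -
    have pt: "real p - t1 = (\<Sum>i\<in>UNIV. 1 - r i)" by (simp add: p_def t1_def sum_subtractf)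
    have "w1 \<le> (\<Sum>i\<in>UNIV. r i * (real p - t1))" unfolding w1_def pt
      by (intro sum_mono mult_left_mono) (use r in \<open>auto simp: less_imp_le intro!: member_le_sum\<close>)
    then show ?thesis by (simp add: t1_def sum_distrib_right)
  qed
  have aw: "a * (real n + real p + 1) * w1 \<le> (2 * (real m - real p - 1) + 2 * q - real m * c) * w1"
    by (rule mult_right_mono) (use bound' w0 in auto)
  have aw2: "0 \<le> a * (2 * w2 + 2 * t1 * w1)" using a0 w0 t10 by simp
  have mn: "q * w1 \<le> q * (t1 * (real p - t1))" by (intro mult_left_mono w1_le) (auto simp: q_def)
  have cw: "0 \<le> real m * c * w1" using a0 w0 by simp
  have lt: "real m * l * t2 < 2 * (real m - real p + 1) * t2"
    using lm t20 by simp
  have L': "real m * (L / \<alpha> - t1) \<le> real m * (l * t2)"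
  proof (rule mult_left_mono)
    have "L / \<alpha> \<le> t1 + l * t2" using L ab by (simp add: divide_le_eq algebra_simps)
    then show "L / \<alpha> - t1 \<le> l * t2" by simp
  qed simp
  \<comment> \<open>The claim divided by \<open>\<alpha>\<close>, with \<open>- log\<close> collected in \<open>L\<close>, \<open>a = \<alpha> / \<beta>\<close> and \<open>q = m / n\<close>.\<close>
  define E where "E = - q * ((real p + 1) * t1 - t2 - t1\<^sup>2) + real m * (L / \<alpha> - t1)
    - 2 * ((real m - real p - 1) * t1 + t2 + t1\<^sup>2) + a * (real n + real p + 1) * w1 - a * (2 * w2 + 2 * t1 * w1)"
  have "E \<le> q * (w1 - t1 * (real p - t1)) + real m * (l * t2) - 2 * ((real m - p) * t2 + t1\<^sup>2)"
    using aw aw2 L' cw unfolding E_def w1 by (simp add: algebra_simps power2_eq_square)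
  also have "\<dots> \<le> real m * (l * t2) - 2 * ((real m - p) * t2 + t2)"
    using mn t1t2 by (simp add: algebra_simps)
  also have "\<dots> < 0" using lt by (simp add: algebra_simps)
  finally have "E < 0" .
  then have "\<alpha> * E < 0" using ab by (simp add: mult_pos_neg)
  moreover have "real m * (- (\<alpha> / real n) * ((real n + real p + 1) * t1 - t2 - t1\<^sup>2) + L)
    - 2 * \<alpha> * ((real m - real p - 1) * t1 + t2 + t1\<^sup>2)
    + (\<alpha>\<^sup>2 / \<beta>) * ((real n + real p + 1) * w1 - 2 * w2 - 2 * t1 * w1) = \<alpha> * E"
    unfolding E_def a_def q_def using ab n0 by (simp add: field_simps power2_eq_square)
  moreover have "(\<Sum>i\<in>UNIV. ln (1 - \<alpha> * r i)) = - L" unfolding L_def by (simp add: sum_negf)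
  ultimately show ?thesis by simp
qed

section \<open>The difference of the losses\<close>

context shrinkage_sample
begin

lemma Sigma_0_pos_def: "0 < n \<Longrightarrow> pos_def_matrix (Sigma_0 n (gram Z))"
  unfolding Sigma_0_def by (intro pos_def_matrix_scaleR S) simp

lemma Sigma_G2_eq: "Sigma_G2 n \<alpha> \<beta> X (gram Z) = Sigma_0 n (gram Z) ** (mat 1 - \<alpha> *\<^sub>R R)"
  unfolding Sigma_G2_def shrink_factor_eq by (simp only: matrix_mult_bilinear matrix_mul_rid)

lemma det_one_minus_scaled:
  fixes B :: "real^'p^'p"
  assumes "R = matrix_inv B ** diagonal r ** B" "invertible B"
  shows "mat 1 - \<alpha> *\<^sub>R R = matrix_inv B ** diagonal (\<chi> i. 1 - \<alpha> * r $ i) ** B"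
    and "det (mat 1 - \<alpha> *\<^sub>R R) = (\<Prod>i\<in>UNIV. 1 - \<alpha> * r $ i)"
proof -
  have "diagonal (\<chi> i. 1 - \<alpha> * r $ i) = diagonal (\<chi> i. 1) - \<alpha> *\<^sub>R diagonal r"
    by (simp add: diagonal_def vec_eq_iff)
  then show 1: "mat 1 - \<alpha> *\<^sub>R R = matrix_inv B ** diagonal (\<chi> i. 1 - \<alpha> * r $ i) ** B"
    unfolding assms(1) by (simp only: matrix_mult_bilinear diagonal_one matrix_mul_rid matrix_inv_left[OF assms(2)])
  have "det (matrix_inv B) * det B = 1" by (metis det_I det_mul matrix_inv_left[OF assms(2)])
  then show "det (mat 1 - \<alpha> *\<^sub>R R) = (\<Prod>i\<in>UNIV. 1 - \<alpha> * r $ i)"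
    unfolding 1 by (simp add: det_mul det_diagonal_eq mult_ac)
qed

lemma Sigma_G2_pos_def:
  assumes "0 < n" "0 < \<alpha>" "\<alpha> < 1"
  shows "pos_def_matrix (Sigma_G2 n \<alpha> \<beta> X (gram Z))"
proof -
  obtain B :: "real^'p^'p" and r where B: "invertible B" and r: "\<And>i. 0 < r $ i" "\<And>i. r $ i \<le> 1"
    and gram: "gram Z = transpose B ** diagonal r ** B"
    and R: "R = matrix_inv B ** diagonal r ** B"
    by (rule sample_eigenvalues) blast
  have "(gram Z) ** (mat 1 - \<alpha> *\<^sub>R R)
    = transpose B ** diagonal r ** (B ** matrix_inv B) ** diagonal (\<chi> i. 1 - \<alpha> * r $ i) ** B"
    unfolding gram det_one_minus_scaled(1)[OF R B] by (simp only: matrix_mul_assoc)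
  also have "\<dots> = transpose B ** (diagonal r ** diagonal (\<chi> i. 1 - \<alpha> * r $ i)) ** B"
    by (simp only: matrix_inv_right[OF B] matrix_mul_rid matrix_mul_assoc)
  also have "diagonal r ** diagonal (\<chi> i. 1 - \<alpha> * r $ i) = diagonal (\<chi> i. r $ i * (1 - \<alpha> * r $ i))"
    by (simp add: diagonal_mult)
  also have "pos_def_matrix (transpose B ** diagonal (\<chi> i. r $ i * (1 - \<alpha> * r $ i)) ** B)"
    unfolding pos_def_matrix_diagonal[OF B]
  proof
    fix i
    have "\<alpha> * r $ i \<le> \<alpha> * 1" using assms r[of i] by (intro mult_left_mono) auto
    then have "\<alpha> * r $ i < 1" using assms by linarith
    then show "0 < (\<chi> i. r $ i * (1 - \<alpha> * r $ i)) $ i" using r(1)[of i] by simp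
  qed
  finally have "pos_def_matrix (inverse (real n) *\<^sub>R (gram Z ** (mat 1 - \<alpha> *\<^sub>R R)))"
    using assms by (intro pos_def_matrix_scaleR) auto
  then show ?thesis unfolding Sigma_G2_eq Sigma_0_def by (simp only: matrix_mult_bilinear(7))
qed

text \<open>
  All products with \<open>\<Sigma>\<^sup>-\<^sup>1\<close> are brought into the form to which Stein's identity applies, in \<open>Z\<close> or
  in \<open>X\<close>.
\<close>

lemma kl_formula_difference:
  fixes \<Theta> :: "real^'p^'m"
  assumes n: "0 < n" and \<alpha>: "0 < \<alpha>" "\<alpha> < 1" and \<Sigma>: "pos_def_matrix \<Sigma>"
  shows "kl_formula (Theta_G \<alpha> \<beta> X (gram Z)) (Sigma_G2 n \<alpha> \<beta> X (gram Z)) \<Theta> \<Sigma>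
      - kl_formula X (Sigma_0 n (gram Z)) \<Theta> \<Sigma>
    = real CARD('m) / 2 * (- (\<alpha> / n) * ((Z ** matrix_inv \<Sigma>) \<bullet> Z - (Z ** matrix_inv \<Sigma>) \<bullet> (Z ** Q))
        - ln (det (mat 1 - \<alpha> *\<^sub>R R)))
      - \<alpha> * (((X - \<Theta>) ** matrix_inv \<Sigma>) \<bullet> (X ** R))
      + \<alpha>\<^sup>2 / (2 * \<beta>) * ((Z ** matrix_inv \<Sigma>) \<bullet> (Z ** Q) - (Z ** matrix_inv \<Sigma>) \<bullet> (Z ** Q ** Q))"
proof -
  let ?I = "matrix_inv \<Sigma>" and ?S0 = "Sigma_0 n (gram Z)" and ?SG = "Sigma_G2 n \<alpha> \<beta> X (gram Z)"
  note It = pos_def_matrix_symmetric[OF pos_def_matrix_inverse[OF \<Sigma>]]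
  have tr: "trace (?I ** ?SG) = trace (?I ** ?S0) - (\<alpha> / n) * ((Z ** ?I) \<bullet> Z - (Z ** ?I) \<bullet> (Z ** Q))"
  proof -
    have "trace (?I ** ?SG) = trace (?I ** ?S0) - (\<alpha> / n) * trace (?I ** gram Z ** R)"
      unfolding Sigma_G2_eq Sigma_0_def
      by (simp only: matrix_mult_bilinear matrix_mul_rid matrix_mul_assoc trace_linear)
         (simp add: divide_inverse algebra_simps)
    also have "trace (?I ** gram Z ** R) = (Z ** ?I) \<bullet> (Z ** R)"
      by (simp only: inner_matrix_eq_trace matrix_transpose_mul It matrix_mul_assoc)
    also have "\<dots> = (Z ** ?I) \<bullet> Z - (Z ** ?I) \<bullet> (Z ** Q)"
      by (simp only: matrix_mult_bilinear matrix_mul_rid inner_diff_right)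
    finally show ?thesis .
  qed
  have ld: "ln (det ?SG) = ln (det ?S0) + ln (det (mat 1 - \<alpha> *\<^sub>R R))"
  proof -
    have 0: "0 < det ?S0" by (intro pos_def_matrix_det_pos Sigma_0_pos_def n)
    have "0 < det ?SG" by (intro pos_def_matrix_det_pos Sigma_G2_pos_def n \<alpha>)
    then have "0 < det (mat 1 - \<alpha> *\<^sub>R R)" using 0 unfolding Sigma_G2_eq det_mul by (simp add: zero_less_mult_iff)
    then show ?thesis unfolding Sigma_G2_eq det_mul using 0 by (intro ln_mult_pos)
  qed
  define D where "D = X - \<Theta>"
  have D: "Theta_G \<alpha> \<beta> X (gram Z) - \<Theta> = D - \<alpha> *\<^sub>R (X ** R)"
    unfolding Theta_G_def shrink_factor_eq D_def by simp
  have D_sym: "((X ** R) ** ?I) \<bullet> D = (D ** ?I) \<bullet> (X ** R)"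
    by (rule inner_matrix_symmetric[OF It])
  have q: "((Theta_G \<alpha> \<beta> X (gram Z) - \<Theta>) ** ?I) \<bullet> (Theta_G \<alpha> \<beta> X (gram Z) - \<Theta>)
    = ((X - \<Theta>) ** ?I) \<bullet> (X - \<Theta>) - 2 * \<alpha> * (((X - \<Theta>) ** ?I) \<bullet> (X ** R)) + \<alpha>\<^sup>2 * (((X ** R) ** ?I) \<bullet> (X ** R))"
    unfolding D D_def[symmetric]
    by (simp only: matrix_mult_bilinear(3,7) inner_diff_left inner_diff_right inner_scaleR_left inner_scaleR_right D_sym)
       (simp add: power2_eq_square algebra_simps)
  show ?thesis unfolding kl_formula_def tr ld q quadratic_X_R[OF It]
    by (simp add: diff_divide_distrib add_divide_distrib algebra_simps)
qed

lemma traces_of_powers: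
  fixes B :: "real^'p^'p"
  assumes B: "invertible B" and Q: "Q = matrix_inv B ** diagonal (\<chi> i. 1 - r $ i) ** B"
    and R: "R = matrix_inv B ** diagonal r ** B"
  defines "t1 \<equiv> \<Sum>i\<in>UNIV. r $ i" and "t2 \<equiv> \<Sum>i\<in>UNIV. (r $ i)\<^sup>2" and "t3 \<equiv> \<Sum>i\<in>UNIV. (r $ i)^3"
  shows "trace Q = real CARD('p) - t1" "trace (Q ** Q) = real CARD('p) - 2 * t1 + t2"
    "trace (Q ** Q ** Q) = real CARD('p) - 3 * t1 + 3 * t2 - t3"
    "trace R = t1" "trace (R ** R) = t2"
proof -
  show "trace Q = real CARD('p) - t1"
    unfolding Q trace_similar_diagonal[OF B] by (simp add: t1_def sum_subtractf)
  show "trace R = t1"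
    unfolding R trace_similar_diagonal[OF B] by (simp add: t1_def)
  show "trace (R ** R) = t2"
    unfolding R similar_diagonal_mult[OF B] trace_similar_diagonal[OF B] by (simp add: t2_def power2_eq_square)
  show "trace (Q ** Q) = real CARD('p) - 2 * t1 + t2"
    unfolding Q similar_diagonal_mult[OF B] trace_similar_diagonal[OF B]
    by (simp add: t1_def t2_def power2_eq_square algebra_simps sum.distrib sum_subtractf sum_distrib_left)
  have "(1 - x) * (1 - x) * (1 - x) = 1 - 3 * x + 3 * x\<^sup>2 - x ^ 3" for x :: real
    by (simp add: power2_eq_square power3_eq_cube algebra_simps)
  then show "trace (Q ** Q ** Q) = real CARD('p) - 3 * t1 + 3 * t2 - t3"
    unfolding Q similar_diagonal_mult[OF B] trace_similar_diagonal[OF B]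
    by (simp add: t1_def t2_def t3_def sum.distrib sum_subtractf sum_distrib_left)
qed

end

text \<open>
  The divergence of \<open>Z \<mapsto> Z K\<close> for a sample with \<open>n\<close> rows, see \<open>stein_ridge\<close>.
\<close>

definition ridge_divergence :: "nat \<Rightarrow> real^'p^'p \<Rightarrow> real" where
  "ridge_divergence n K = real n * trace K - (trace K - trace (K ** K)) - (real CARD('p) - trace K) * trace K"

text \<open>
  The divergence of \<open>Z \<mapsto> Z K\<^sup>2\<close>, see \<open>stein_ridge_square\<close>.
\<close>

definition ridge_square_divergence :: "nat \<Rightarrow> real^'p^'p \<Rightarrow> real" where
  "ridge_square_divergence n K = real n * trace (K ** K) - 2 * (trace (K ** K) - trace (K ** K ** K))
     - (real CARD('p) - trace K) * trace (K ** K) - (trace K - trace (K ** K)) * trace K"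

text \<open>
  Twice the difference of the losses, with every term that depends on \<open>\<Theta>\<close> or \<open>\<Sigma>\<close> replaced by
  what Stein's identity gives for it. The term \<open>n p\<close> comes from \<open>E tr (\<Sigma>\<^sup>-\<^sup>1 S)\<close>.
\<close>

definition risk_kernel :: "nat \<Rightarrow> nat \<Rightarrow> real \<Rightarrow> real \<Rightarrow> real^'p^'p \<Rightarrow> real" where
  "risk_kernel m n \<alpha> \<beta> Q =
     real m * (- (\<alpha> / n) * (real n * real CARD('p) - ridge_divergence n Q) - ln (det (mat 1 - \<alpha> *\<^sub>R (mat 1 - Q))))
     - 2 * \<alpha> * ridge_divergence m (mat 1 - Q)
     + \<alpha>\<^sup>2 / \<beta> * (ridge_divergence n Q - ridge_square_divergence n Q)"

context shrinkage_sample
begin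

lemma risk_kernel_negative:
  assumes "CARD('p) \<le> n" "CARD('p) \<le> m" "0 < \<alpha>" "\<alpha> < 1"
    and "(real n + real CARD('p) + 1) * \<alpha> + real m * \<alpha> * \<beta> / (2 * (1 - \<alpha>))
           \<le> 2 * (real m - real CARD('p) - 1) * \<beta> + 2 * (real m / real n) * \<beta>"
  shows "risk_kernel m n \<alpha> \<beta> Q < 0"
proof -
  obtain B :: "real^'p^'p" and r where B: "invertible B" and r: "\<And>i. 0 < r $ i" "\<And>i. r $ i \<le> 1"
    and RQ: "R = matrix_inv B ** diagonal r ** B" "Q = matrix_inv B ** diagonal (\<chi> i. 1 - r $ i) ** B"
    by (rule sample_eigenvalues) blast
  define p where "p = real CARD('p)"
  define t1 where "t1 = (\<Sum>i\<in>UNIV. r $ i)"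
  define t2 where "t2 = (\<Sum>i\<in>UNIV. (r $ i)\<^sup>2)"
  define t3 where "t3 = (\<Sum>i\<in>UNIV. (r $ i)^3)"
  note tr = traces_of_powers[OF B RQ(2,1), folded t1_def t2_def t3_def p_def]
  have pos: "0 < 1 - \<alpha> * r $ i" for i
  proof -
    have "\<alpha> * r $ i \<le> \<alpha> * 1" using assms r[of i] by (intro mult_left_mono) auto
    then show ?thesis using assms by linarith
  qed
  have ld: "ln (det (mat 1 - \<alpha> *\<^sub>R R)) = (\<Sum>i\<in>UNIV. ln (1 - \<alpha> * r $ i))"
    unfolding det_one_minus_scaled(2)[OF RQ(1) B] using less_imp_neq[OF pos] by (intro ln_prod) auto
  have w1: "(\<Sum>i\<in>UNIV. r $ i * (1 - r $ i)) = t1 - t2"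
    by (simp add: t1_def t2_def power2_eq_square algebra_simps sum_subtractf)
  have w2: "(\<Sum>i\<in>UNIV. (r $ i)\<^sup>2 * (1 - r $ i)) = t2 - t3"
    by (simp add: t2_def t3_def power2_eq_square power3_eq_cube algebra_simps sum_subtractf)
  have "real m * (- (\<alpha> / n) * ((real n + p + 1) * t1 - t2 - t1\<^sup>2) - (\<Sum>i\<in>UNIV. ln (1 - \<alpha> * r $ i)))
    - 2 * \<alpha> * ((real m - p - 1) * t1 + t2 + t1\<^sup>2)
    + (\<alpha>\<^sup>2 / \<beta>) * ((real n + p + 1) * (t1 - t2) - 2 * (t2 - t3) - 2 * t1 * (t1 - t2)) < 0"
    using risk_kernel_eigenvalues_negative[OF refl assms(1,2,3) \<beta> assms(4,5), where r = "\<lambda>i. r $ i", OF r]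
    unfolding w1 w2 t1_def[symmetric] t2_def[symmetric] p_def[symmetric] .
  moreover have "real n * p - ridge_divergence n Q = (real n + p + 1) * t1 - t2 - t1\<^sup>2"
    unfolding ridge_divergence_def tr p_def[symmetric] by (simp add: power2_eq_square algebra_simps)
  moreover have "ridge_divergence m R = (real m - p - 1) * t1 + t2 + t1\<^sup>2"
    unfolding ridge_divergence_def tr p_def[symmetric] by (simp add: power2_eq_square algebra_simps)
  moreover have "ridge_divergence n Q - ridge_square_divergence n Q
    = (real n + p + 1) * (t1 - t2) - 2 * (t2 - t3) - 2 * t1 * (t1 - t2)"
    unfolding ridge_divergence_def ridge_square_divergence_def tr p_def[symmetric] by (simp add: algebra_simps)
  ultimately show ?thesis unfolding risk_kernel_def ld p_def[symmetric] by simp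
qed

text \<open>
  With the next two lemmas: the parameter-free terms are bounded, hence integrable.
\<close>

lemma trace_bounds:
  "\<bar>trace Q\<bar> \<le> CARD('p)" "\<bar>trace (Q ** Q)\<bar> \<le> CARD('p)" "\<bar>trace (Q ** Q ** Q)\<bar> \<le> CARD('p)"
  "\<bar>trace R\<bar> \<le> CARD('p)" "\<bar>trace (R ** R)\<bar> \<le> CARD('p)"
proof -
  obtain B :: "real^'p^'p" and r where B: "invertible B" and r: "\<And>i. 0 < r $ i" "\<And>i. r $ i \<le> 1"
    and RQ: "R = matrix_inv B ** diagonal r ** B" "Q = matrix_inv B ** diagonal (\<chi> i. 1 - r $ i) ** B"
    by (rule sample_eigenvalues) blast
  have bnd: "\<bar>\<Sum>i\<in>UNIV. d i\<bar> \<le> real CARD('p)" if "\<And>i. 0 \<le> d i" "\<And>i. d i \<le> 1" for d :: "'p \<Rightarrow> real"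
  proof -
    have "\<bar>\<Sum>i\<in>UNIV. d i\<bar> = (\<Sum>i\<in>UNIV. d i)" using that by (intro abs_of_nonneg sum_nonneg)
    also have "\<dots> \<le> (\<Sum>i\<in>(UNIV::'p set). 1)" using that by (intro sum_mono)
    finally show ?thesis by simp
  qed
  have r': "0 \<le> r $ i" "0 \<le> 1 - r $ i" "1 - r $ i \<le> 1" for i using r[of i] by auto
  show "\<bar>trace Q\<bar> \<le> CARD('p)" "\<bar>trace (Q ** Q)\<bar> \<le> CARD('p)" "\<bar>trace (Q ** Q ** Q)\<bar> \<le> CARD('p)"
    unfolding RQ(2) similar_diagonal_mult[OF B] trace_similar_diagonal[OF B]
    by (rule bnd; use r r' in \<open>auto intro!: mult_nonneg_nonneg mult_le_one simp del: diff_ge_0_iff_ge\<close>)+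
  show "\<bar>trace R\<bar> \<le> CARD('p)" "\<bar>trace (R ** R)\<bar> \<le> CARD('p)"
    unfolding RQ(1) similar_diagonal_mult[OF B] trace_similar_diagonal[OF B]
    by (rule bnd; use r r' in \<open>auto intro!: mult_nonneg_nonneg mult_le_one\<close>)+
qed

lemma ridge_divergence_bounds:
  fixes n :: nat
  defines "P \<equiv> real CARD('p)"
  shows "\<bar>ridge_divergence n Q\<bar> \<le> real n * P + 2 * P + 2 * P * P" "\<bar>ridge_divergence n R\<bar> \<le> real n * P + 2 * P + 2 * P * P"
    "\<bar>ridge_square_divergence n Q\<bar> \<le> real n * P + 4 * P + 4 * P * P"
proof -
  note b = trace_bounds[folded P_def]
  have P0: "0 \<le> P" by (simp add: P_def)
  have lin: "\<bar>real n * x\<bar> \<le> real n * P" if "\<bar>x\<bar> \<le> P" for x using that by (simp add: abs_mult mult_left_mono)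
  have prod: "\<bar>x * y\<bar> \<le> 2 * P * P" if "\<bar>x\<bar> \<le> 2 * P" "\<bar>y\<bar> \<le> P" for x y
    unfolding abs_mult using that P0 by (intro mult_mono) auto
  have diff: "\<bar>x - y\<bar> \<le> 2 * P" if "\<bar>x\<bar> \<le> P" "\<bar>y\<bar> \<le> P" for x y
    using abs_triangle_ineq4[of x y] that by linarith
  have P: "\<bar>P\<bar> \<le> P" using P0 by simp
  have sub: "\<bar>a - c\<bar> \<le> A + C" if "\<bar>a\<bar> \<le> A" "\<bar>c\<bar> \<le> C" for a c A C :: real
    using abs_triangle_ineq4[of a c] that by linarith
  show "\<bar>ridge_divergence n Q\<bar> \<le> real n * P + 2 * P + 2 * P * P"
    unfolding ridge_divergence_def P_def[symmetric] by (intro sub lin prod diff P b)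
  show "\<bar>ridge_divergence n R\<bar> \<le> real n * P + 2 * P + 2 * P * P"
    unfolding ridge_divergence_def P_def[symmetric] by (intro sub lin prod diff P b)
  have two: "\<bar>2 * (x - y)\<bar> \<le> 4 * P" if "\<bar>x\<bar> \<le> P" "\<bar>y\<bar> \<le> P" for x y
    using diff[OF that] by simp
  have "\<bar>ridge_square_divergence n Q\<bar> \<le> real n * P + 4 * P + 2 * P * P + 2 * P * P"
    unfolding ridge_square_divergence_def P_def[symmetric] by (intro sub lin prod diff two P b)
  then show "\<bar>ridge_square_divergence n Q\<bar> \<le> real n * P + 4 * P + 4 * P * P" by simp
qed

lemma ln_det_bound:
  assumes "0 < \<alpha>" "\<alpha> < 1"
  shows "\<bar>ln (det (mat 1 - \<alpha> *\<^sub>R R))\<bar> \<le> real CARD('p) * \<bar>ln (1 - \<alpha>)\<bar>"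
proof -
  obtain B :: "real^'p^'p" and r where B: "invertible B" and r: "\<And>i. 0 < r $ i" "\<And>i. r $ i \<le> 1"
    and RQ: "R = matrix_inv B ** diagonal r ** B" by (rule sample_eigenvalues) blast
  have pos: "1 - \<alpha> \<le> 1 - \<alpha> * r $ i" "1 - \<alpha> * r $ i \<le> 1" for i
  proof -
    have "\<alpha> * r $ i \<le> \<alpha> * 1" using assms r[of i] by (intro mult_left_mono) auto
    then show "1 - \<alpha> \<le> 1 - \<alpha> * r $ i" by simp
    show "1 - \<alpha> * r $ i \<le> 1" using assms r[of i] by simp
  qed
  have nz: "1 - \<alpha> * r $ i \<noteq> 0" for i using pos(1)[of i] assms by linarith
  have "ln (det (mat 1 - \<alpha> *\<^sub>R R)) = (\<Sum>i\<in>UNIV. ln (1 - \<alpha> * r $ i))"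
    unfolding det_one_minus_scaled(2)[OF RQ B] using nz by (intro ln_prod) auto
  also have "\<bar>\<dots>\<bar> \<le> (\<Sum>i\<in>(UNIV :: 'p set). \<bar>ln (1 - \<alpha>)\<bar>)"
  proof (rule order_trans[OF sum_abs sum_mono])
    fix i
    have "0 < 1 - \<alpha> * r $ i" using pos(1)[of i] assms by linarith
    then have "ln (1 - \<alpha>) \<le> ln (1 - \<alpha> * r $ i)" using pos[of i] assms by (intro ln_mono) auto
    moreover have "ln (1 - \<alpha> * r $ i) \<le> 0"
      using ln_le_minus_one[OF \<open>0 < 1 - \<alpha> * r $ i\<close>] pos(2)[of i] by linarith
    ultimately show "\<bar>ln (1 - \<alpha> * r $ i)\<bar> \<le> \<bar>ln (1 - \<alpha>)\<bar>" by simp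
  qed
  finally show ?thesis by simp
qed

end

section \<open>Comparison of the risks\<close>

lemma (in pair_sigma_finite) integrable_product:
  fixes f :: "'a \<Rightarrow> real" and g :: "'b \<Rightarrow> real"
  assumes f: "integrable M1 f" and g: "integrable M2 g"
  shows "integrable (M1 \<Otimes>\<^sub>M M2) (\<lambda>(x, y). f x * g y)"
proof (rule Fubini_integrable)
  have [measurable]: "f \<in> borel_measurable M1" "g \<in> borel_measurable M2"
    using f g by (auto dest: borel_measurable_integrable)
  show "(\<lambda>(x, y). f x * g y) \<in> borel_measurable (M1 \<Otimes>\<^sub>M M2)" by measurable
  show "integrable M1 (\<lambda>x. LINT y|M2. norm (case (x, y) of (x, y) \<Rightarrow> f x * g y))"
    using f by (simp add: abs_mult)
  show "AE x in M1. integrable M2 (\<lambda>y. case (x, y) of (x, y) \<Rightarrow> f x * g y)"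
    using g by simp
qed

lemma borel_measurable_ridge [measurable (raw)]:
  fixes f :: "'a \<Rightarrow> real^'p^'p" and g :: "'a \<Rightarrow> real^'p^'n"
  assumes [measurable]: "f \<in> borel_measurable M" "g \<in> borel_measurable M"
  shows "(\<lambda>x. ridge (f x) (g x)) \<in> borel_measurable M"
  unfolding ridge_def ridge_inv_def by measurable

lemma borel_measurable_ridge_divergence [measurable]:
  "ridge_divergence n \<in> borel_measurable borel" "ridge_square_divergence n \<in> borel_measurable borel"
  unfolding ridge_divergence_def[abs_def] ridge_square_divergence_def[abs_def] by measurable

lemma norm_le_squared_quadratic: "norm (Y :: 'a::real_normed_vector) \<le> 1 * (1 + (norm Y)\<^sup>2)\<^sup>2"
  using norm_diff_le_quadratic[of Y 0] self_le_power[of "1 + (norm Y)\<^sup>2" 2] by simp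

text \<open>
  The loss of the new estimator is almost everywhere the old loss plus an integrable difference
  \<open>\<Delta>\<close>, and Stein's identities give \<open>E \<Delta> = E risk_kernel / 2 < 0\<close>.
\<close>

lemma expected_loss_decreases:
  fixes \<Theta> :: "real^'p^'m" and \<alpha> \<beta> :: real
  defines "n \<equiv> CARD('n::finite)" and "m \<equiv> CARD('m)"
  assumes \<Sigma>: "pos_def_matrix \<Sigma>" and pn: "CARD('p) \<le> n" and pm: "CARD('p) \<le> m"
    and ab: "0 < \<alpha>" "0 < \<beta>" "\<alpha> < 1"
    and bound: "(real n + real CARD('p) + 1) * \<alpha> + real m * \<alpha> * \<beta> / (2 * (1 - \<alpha>))
           \<le> 2 * (real m - real CARD('p) - 1) * \<beta> + 2 * (real m / real n) * \<beta>"
  defines "M \<equiv> matrix_normal \<Theta> \<Sigma> \<Otimes>\<^sub>M matrix_normal (0 :: real^'p^'n) \<Sigma>"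
  defines "L0 \<equiv> \<lambda>(X, Z :: real^'p^'n). kl_formula X (Sigma_0 n (gram Z)) \<Theta> \<Sigma>"
    and "LG \<equiv> \<lambda>(X, Z :: real^'p^'n). kl_formula (Theta_G \<alpha> \<beta> X (gram Z)) (Sigma_G2 n \<alpha> \<beta> X (gram Z)) \<Theta> \<Sigma>"
  shows "integrable M L0" "integrable M LG" "integral\<^sup>L M LG < integral\<^sup>L M L0"
    and "AE p in M. 0 \<le> L0 p" "AE p in M. 0 \<le> LG p"
proof -
  let ?MX = "matrix_normal \<Theta> \<Sigma>" and ?MZ = "matrix_normal (0 :: real^'p^'n) \<Sigma>"
  let ?I = "matrix_inv \<Sigma>"
  interpret MX: prob_space ?MX by (rule prob_space_matrix_normal[OF \<Sigma>])
  interpret MZ: prob_space ?MZ by (rule prob_space_matrix_normal[OF \<Sigma>])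
  interpret XZ: pair_prob_space ?MX ?MZ ..
  have n0: "0 < n" by (simp add: n_def)
  have sets_M [measurable_cong]: "sets M = sets (borel \<Otimes>\<^sub>M borel)" unfolding M_def by (intro sets_pair_measure_cong) auto
  have AEX: "AE X in ?MX. pos_def_matrix (gram X)" using pm unfolding m_def by (rule AE_gram_pos_def[OF \<Sigma>])
  have AEZ: "AE Z in ?MZ. pos_def_matrix (gram Z)" using pn unfolding n_def by (rule AE_gram_pos_def[OF \<Sigma>])
  have good: "AE p in M. shrinkage_sample \<beta> (fst p) (snd p)"
  proof -
    have "AE X in ?MX. AE Z in ?MZ. pos_def_matrix (transpose (fst (X, Z)) ** fst (X, Z)) \<and> pos_def_matrix (transpose (snd (X, Z)) ** snd (X, Z))"
      using AEX
    proof eventually_elim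
      case (elim X)
      show ?case using AEZ by eventually_elim (use elim in simp)
    qed
    then have "AE p in ?MX \<Otimes>\<^sub>M ?MZ. pos_def_matrix (transpose (fst p) ** fst p) \<and> pos_def_matrix (transpose (snd p) ** snd p)"
    proof (intro XZ.AE_pair_measure)
      show "{p \<in> space (?MX \<Otimes>\<^sub>M ?MZ). pos_def_matrix (transpose (fst p) ** fst p) \<and> pos_def_matrix (transpose (snd p) ** snd p)}
        \<in> sets (?MX \<Otimes>\<^sub>M ?MZ)" by measurable
    qed
    then show ?thesis unfolding M_def by eventually_elim (use ab in \<open>simp add: shrinkage_sample_def\<close>)
  qed
  define Q where "Q = (\<lambda>p :: (real^'p^'m) \<times> (real^'p^'n). shrink_complement \<beta> (fst p) (snd p))"
  have [measurable]: "Q \<in> borel_measurable M" unfolding Q_def shrink_complement_def by measurable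
  have fst_m [measurable]: "fst \<in> borel_measurable M" and snd_m [measurable]: "snd \<in> borel_measurable M" by measurable
  define e0 where "e0 = (\<lambda>p :: (real^'p^'m) \<times> (real^'p^'n). (snd p ** ?I) \<bullet> snd p)"
  define e1 where "e1 = (\<lambda>p. (snd p ** ?I) \<bullet> (snd p ** Q p))"
  define e2 where "e2 = (\<lambda>p. (snd p ** ?I) \<bullet> (snd p ** Q p ** Q p))"
  define b where "b = (\<lambda>p. ((fst p - \<Theta>) ** ?I) \<bullet> (fst p ** (mat 1 - Q p)))"
  define l where "l = (\<lambda>p. ln (det (mat 1 - \<alpha> *\<^sub>R (mat 1 - Q p))))"
  have [measurable]: "e0 \<in> borel_measurable M" "e1 \<in> borel_measurable M" "e2 \<in> borel_measurable M"
    "b \<in> borel_measurable M" "l \<in> borel_measurable M"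
    unfolding e0_def e1_def e2_def b_def l_def by measurable
  have sqZ: "integrable ?MZ (\<lambda>Z. (norm Z)\<^sup>2)"
  proof (rule integrable_matrix_normal_polynomial[OF \<Sigma>, of _ 1])
    fix Y :: "real^'p^'n"
    have "1 + (norm Y)\<^sup>2 \<le> (1 + (norm Y)\<^sup>2)\<^sup>2" by (rule self_le_power) auto
    then have "(norm Y)\<^sup>2 \<le> (1 + (norm Y)\<^sup>2)\<^sup>2" by linarith
    then show "\<bar>(norm Y)\<^sup>2\<bar> \<le> 1 * (1 + (norm Y)\<^sup>2)\<^sup>2" by simp
  qed measurable
  have normZ: "integrable ?MZ norm"
  proof (rule integrable_matrix_normal_polynomial[OF \<Sigma>, of _ 1])
    show "\<bar>norm Y\<bar> \<le> 1 * (1 + (norm Y)\<^sup>2)\<^sup>2" for Y :: "real^'p^'n" using norm_le_squared_quadratic[of Y] by simp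
  qed measurable
  have normX: "integrable ?MX (\<lambda>X. norm (X - \<Theta>))"
  proof (rule Bochner_Integration.integrable_bound)
    have "integrable ?MX norm"
    proof (rule integrable_matrix_normal_polynomial[OF \<Sigma>, of _ 1])
      show "\<bar>norm Y\<bar> \<le> 1 * (1 + (norm Y)\<^sup>2)\<^sup>2" for Y :: "real^'p^'m" using norm_le_squared_quadratic[of Y] by simp
    qed measurable
    then show "integrable ?MX (\<lambda>X. norm X + norm \<Theta>)" by simp
    show "AE X in ?MX. norm (norm (X - \<Theta>)) \<le> norm (norm X + norm \<Theta>)"
      by (intro AE_I2) (simp add: norm_triangle_ineq4)
  qed measurable
  have intZ: "integrable M (\<lambda>p. g (snd p))" if "integrable ?MZ g" for g :: "_ \<Rightarrow> real"
    using XZ.integrable_product[of "\<lambda>_. 1" g] that by (simp add: M_def case_prod_unfold)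
  have intX: "integrable M (\<lambda>p. g (fst p))" if "integrable ?MX g" for g :: "_ \<Rightarrow> real"
    using XZ.integrable_product[of g "\<lambda>_. 1"] that by (simp add: M_def case_prod_unfold)
  have prob_M: "prob_space M" unfolding M_def by (rule XZ.prob_space_axioms)
  interpret M: prob_space M by (rule prob_M)
  have bounded: "integrable M f" if "f \<in> borel_measurable M" "AE p in M. \<bar>f p\<bar> \<le> C" for f :: "_ \<Rightarrow> real" and C
    using that by (intro M.integrable_const_bound[of f C]) auto
  have quadZ: "integrable M (\<lambda>p. norm ?I * (norm (snd p))\<^sup>2)" using intZ[OF sqZ] by simp
  have quad_int: "integrable M (\<lambda>p. (snd p ** ?I) \<bullet> N p)"
    if [measurable]: "N \<in> borel_measurable M" and N: "AE p in M. norm (N p) \<le> norm (snd p)" for N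
  proof (rule Bochner_Integration.integrable_bound[OF quadZ])
    show "AE p in M. norm ((snd p ** ?I) \<bullet> N p) \<le> norm (norm ?I * (norm (snd p))\<^sup>2)"
      using N
    proof eventually_elim
      case (elim p)
      have "\<bar>(snd p ** ?I) \<bullet> N p\<bar> \<le> norm (snd p ** ?I) * norm (N p)" by (rule Cauchy_Schwarz_ineq2)
      also have "\<dots> \<le> (norm (snd p) * norm ?I) * norm (snd p)"
        by (intro mult_mono norm_matrix_mult_le elim) auto
      finally show ?case by (simp add: power2_eq_square mult_ac)
    qed
  qed measurable
  have e0_int: "integrable M e0" unfolding e0_def by (intro quad_int) auto
  have e1_int: "integrable M e1" unfolding e1_def
  proof (rule quad_int)
    show "AE p in M. norm (snd p ** Q p) \<le> norm (snd p)"
      using good unfolding Q_def by eventually_elim (rule shrinkage_sample.norm_Z_Q)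
  qed measurable
  have e2_int: "integrable M e2" unfolding e2_def
  proof (rule quad_int)
    show "AE p in M. norm (snd p ** Q p ** Q p) \<le> norm (snd p)"
      using good unfolding Q_def by eventually_elim (rule shrinkage_sample.norm_Z_QQ)
  qed measurable
  have b_int: "integrable M b"
  proof (rule Bochner_Integration.integrable_bound)
    show "integrable M (\<lambda>p. (norm ?I * sqrt (1 / \<beta>)) * (norm (fst p - \<Theta>) * norm (snd p)))"
      using XZ.integrable_product[OF normX normZ] by (simp add: M_def case_prod_unfold)
    show "AE p in M. norm (b p) \<le> norm ((norm ?I * sqrt (1 / \<beta>)) * (norm (fst p - \<Theta>) * norm (snd p)))"
      using good
    proof eventually_elim
      case (elim p)
      have "\<bar>b p\<bar> \<le> norm ((fst p - \<Theta>) ** ?I) * norm (fst p ** (mat 1 - Q p))" unfolding b_def by (rule Cauchy_Schwarz_ineq2)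
      also have "\<dots> \<le> (norm (fst p - \<Theta>) * norm ?I) * (sqrt (1 / \<beta>) * norm (snd p))"
        unfolding Q_def by (intro mult_mono norm_matrix_mult_le shrinkage_sample.norm_X_R[OF elim]) auto
      also have "\<dots> = (norm ?I * sqrt (1 / \<beta>)) * (norm (fst p - \<Theta>) * norm (snd p))" by (simp only: mult_ac)
      finally show ?case using ab by (simp add: abs_mult)
    qed
  qed measurable
  have l_int: "integrable M l"
  proof (rule bounded)
    show "AE p in M. \<bar>l p\<bar> \<le> real CARD('p) * \<bar>ln (1 - \<alpha>)\<bar>"
      using good unfolding l_def Q_def by eventually_elim (rule shrinkage_sample.ln_det_bound[OF _ ab(1,3)])
  qed measurable
  have D1_int: "integrable M (\<lambda>p. ridge_divergence n (Q p))"
  proof (rule bounded)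
    show "AE p in M. \<bar>ridge_divergence n (Q p)\<bar> \<le> real n * real CARD('p) + 2 * real CARD('p) + 2 * real CARD('p) * real CARD('p)"
      using good unfolding Q_def by eventually_elim (rule shrinkage_sample.ridge_divergence_bounds(1))
  qed measurable
  have D2_int: "integrable M (\<lambda>p. ridge_square_divergence n (Q p))"
  proof (rule bounded)
    show "AE p in M. \<bar>ridge_square_divergence n (Q p)\<bar> \<le> real n * real CARD('p) + 4 * real CARD('p) + 4 * real CARD('p) * real CARD('p)"
      using good unfolding Q_def by eventually_elim (rule shrinkage_sample.ridge_divergence_bounds(3))
  qed measurable
  have Db_int: "integrable M (\<lambda>p. ridge_divergence m (mat 1 - Q p))"
  proof (rule bounded)
    show "AE p in M. \<bar>ridge_divergence m (mat 1 - Q p)\<bar> \<le> real m * real CARD('p) + 2 * real CARD('p) + 2 * real CARD('p) * real CARD('p)"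
      using good unfolding Q_def by eventually_elim (rule shrinkage_sample.ridge_divergence_bounds(2))
  qed measurable
  \<comment> \<open>Stein's identities hold for fixed \<open>X\<close> or fixed \<open>Z\<close>; Fubini's theorem lifts them to the pair.\<close>
  have fubini_Z: "(LINT p|M. f p) = (LINT p|M. g p)"
    if "integrable M f" "integrable M g" "AE X in ?MX. (LINT Z|?MZ. f (X, Z)) = (LINT Z|?MZ. g (X, Z))" for f g :: "_ \<Rightarrow> real"
  proof -
    have [measurable]: "f \<in> borel_measurable (?MX \<Otimes>\<^sub>M ?MZ)" "g \<in> borel_measurable (?MX \<Otimes>\<^sub>M ?MZ)"
      using that by (auto simp: M_def)
    show ?thesis
      using that unfolding M_def by (subst (1 2) XZ.integral_fst'[symmetric]) (auto intro!: integral_cong_AE)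
  qed
  have fubini_X: "(LINT p|M. f p) = (LINT p|M. g p)"
    if "integrable M f" "integrable M g" "AE Z in ?MZ. (LINT X|?MX. f (X, Z)) = (LINT X|?MX. g (X, Z))" for f g :: "_ \<Rightarrow> real"
  proof -
    have [measurable]: "f \<in> borel_measurable (?MX \<Otimes>\<^sub>M ?MZ)" "g \<in> borel_measurable (?MX \<Otimes>\<^sub>M ?MZ)"
      using that by (auto simp: M_def)
    have "(LINT Z|?MZ. LINT X|?MX. f (X, Z)) = (LINT Z|?MZ. LINT X|?MX. g (X, Z))"
      by (intro integral_cong_AE that) measurable
    then show ?thesis
      using XZ.integral_snd[of "\<lambda>x y. f (x, y)"] XZ.integral_snd[of "\<lambda>x y. g (x, y)"] that
      unfolding M_def by simp
  qed
  have E0: "(LINT p|M. e0 p) = real n * real CARD('p)"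
  proof -
    have "(LINT p|M. e0 p) = (LINT p|M. real n * real CARD('p))"
    proof (rule fubini_Z[OF e0_int])
      have "trace (?I ** \<Sigma>) = real CARD('p)"
        by (simp add: matrix_inv_left pos_def_matrix_invertible[OF \<Sigma>] trace_I)
      then have "(LINT Z|?MZ. (Z ** ?I) \<bullet> Z) = real n * real CARD('p)"
        using matrix_normal_second_moment(1)[OF \<Sigma>, of "0 :: real^'p^'n" ?I] by (simp add: n_def)
      then show "AE X in ?MX. (LINT Z|?MZ. e0 (X, Z)) = (LINT Z|?MZ. real n * real CARD('p))"
        by (simp add: e0_def MZ.prob_space[simplified])
    qed simp
    then show ?thesis by (simp add: M.prob_space)
  qed
  have E1: "(LINT p|M. e1 p) = (LINT p|M. ridge_divergence n (Q p))"
  proof (rule fubini_Z[OF e1_int D1_int])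
    show "AE X in ?MX. (LINT Z|?MZ. e1 (X, Z)) = (LINT Z|?MZ. ridge_divergence n (Q (X, Z)))"
      using AEX
    proof eventually_elim
      case (elim X)
      show ?case
        using stein_ridge[OF pos_def_matrix_scaleR[OF elim ab(2)] \<Sigma>, of "0 :: real^'p^'n"]
        by (simp add: e1_def Q_def shrink_complement_def ridge_divergence_def n_def)
    qed
  qed
  have E2: "(LINT p|M. e2 p) = (LINT p|M. ridge_square_divergence n (Q p))"
  proof (rule fubini_Z[OF e2_int D2_int])
    show "AE X in ?MX. (LINT Z|?MZ. e2 (X, Z)) = (LINT Z|?MZ. ridge_square_divergence n (Q (X, Z)))"
      using AEX
    proof eventually_elim
      case (elim X)
      show ?case
        using stein_ridge_square[OF pos_def_matrix_scaleR[OF elim ab(2)] \<Sigma>, of "0 :: real^'p^'n"]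
        by (simp add: e2_def Q_def shrink_complement_def ridge_square_divergence_def n_def)
    qed
  qed
  have Eb: "(LINT p|M. b p) = (LINT p|M. ridge_divergence m (mat 1 - Q p))"
  proof (rule fubini_X[OF b_int Db_int])
    show "AE Z in ?MZ. (LINT X|?MX. b (X, Z)) = (LINT X|?MX. ridge_divergence m (mat 1 - Q (X, Z)))"
      using AEZ
    proof eventually_elim
      case (elim Z)
      let ?P = "(1 / \<beta>) *\<^sub>R gram Z"
      have R: "AE X in ?MX. mat 1 - Q (X, Z) = ridge ?P X"
        using AEX
      proof eventually_elim
        case (elim X)
        interpret shrinkage_sample \<beta> X Z by unfold_locales (use ab elim \<open>pos_def_matrix (gram Z)\<close> in auto)
        show ?case unfolding Q_def ridge_X_eq by simp
      qed
      have [measurable]: "(\<lambda>X. Q (X, Z)) \<in> borel_measurable borel"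
        unfolding Q_def shrink_complement_def by measurable
      have "(LINT X|?MX. b (X, Z)) = (LINT X|?MX. ((X - \<Theta>) ** ?I) \<bullet> (X ** ridge ?P X))"
        unfolding b_def fst_conv
      proof (rule integral_cong_AE)
        show "(\<lambda>X. ((X - \<Theta>) ** ?I) \<bullet> (X ** (mat 1 - Q (X, Z)))) \<in> borel_measurable ?MX"
          "(\<lambda>X. ((X - \<Theta>) ** ?I) \<bullet> (X ** ridge ?P X)) \<in> borel_measurable ?MX" by measurable
        show "AE X in ?MX. ((X - \<Theta>) ** ?I) \<bullet> (X ** (mat 1 - Q (X, Z))) = ((X - \<Theta>) ** ?I) \<bullet> (X ** ridge ?P X)"
          using R by eventually_elim simp
      qed
      also have "\<dots> = (LINT X|?MX. ridge_divergence m (ridge ?P X))"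
        using stein_ridge[OF pos_def_matrix_scaleR[OF elim] \<Sigma>, of "1 / \<beta>" \<Theta>] ab
        by (simp add: ridge_divergence_def m_def)
      also have "\<dots> = (LINT X|?MX. ridge_divergence m (mat 1 - Q (X, Z)))"
      proof (rule integral_cong_AE)
        show "(\<lambda>X. ridge_divergence m (ridge ?P X)) \<in> borel_measurable ?MX"
          "(\<lambda>X. ridge_divergence m (mat 1 - Q (X, Z))) \<in> borel_measurable ?MX" by measurable
        show "AE X in ?MX. ridge_divergence m (ridge ?P X) = ridge_divergence m (mat 1 - Q (X, Z))"
          using R by eventually_elim simp
      qed
      finally show ?case .
    qed
  qed
  define \<Delta> where "\<Delta> = (\<lambda>p. real m / 2 * (- (\<alpha> / n) * (e0 p - e1 p) - l p) - \<alpha> * b p + \<alpha>\<^sup>2 / (2 * \<beta>) * (e1 p - e2 p))"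
  have \<Delta>_int: "integrable M \<Delta>" unfolding \<Delta>_def using e0_int e1_int e2_int b_int l_int by simp
  have ker_int: "integrable M (\<lambda>p. risk_kernel m n \<alpha> \<beta> (Q p))"
    unfolding risk_kernel_def using D1_int D2_int Db_int l_int[unfolded l_def] by simp
  have "(LINT p|M. \<Delta> p) = (LINT p|M. risk_kernel m n \<alpha> \<beta> (Q p)) / 2"
  proof -
    have "(LINT p|M. risk_kernel m n \<alpha> \<beta> (Q p)) =
       real m * (- (\<alpha> / n) * (real n * real CARD('p) - (LINT p|M. ridge_divergence n (Q p))) - (LINT p|M. l p))
       - 2 * \<alpha> * (LINT p|M. ridge_divergence m (mat 1 - Q p))
       + \<alpha>\<^sup>2 / \<beta> * ((LINT p|M. ridge_divergence n (Q p)) - (LINT p|M. ridge_square_divergence n (Q p)))"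
      unfolding risk_kernel_def l_def using D1_int D2_int Db_int l_int[unfolded l_def] by (simp add: M.prob_space)
    moreover have "(LINT p|M. \<Delta> p) = real m / 2 * (- (\<alpha> / n) * ((LINT p|M. e0 p) - (LINT p|M. e1 p)) - (LINT p|M. l p))
       - \<alpha> * (LINT p|M. b p) + \<alpha>\<^sup>2 / (2 * \<beta>) * ((LINT p|M. e1 p) - (LINT p|M. e2 p))"
      unfolding \<Delta>_def using e0_int e1_int e2_int b_int l_int by simp
    moreover have "k / 2 * (u * x - y) - v * z + w / (2 * \<beta>) * d = (k * (u * x - y) - 2 * v * z + w / \<beta> * d) / 2"
      for k u x y v z w d :: real
      by (simp add: diff_divide_distrib add_divide_distrib)
    ultimately show ?thesis unfolding E0 E1 E2 Eb by (simp only:)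
  qed
  moreover have "(LINT p|M. risk_kernel m n \<alpha> \<beta> (Q p)) < (LINT p|M. 0)"
  proof (rule M.integral_less_AE_space[OF ker_int])
    show "AE p in M. risk_kernel m n \<alpha> \<beta> (Q p) < 0"
      using good unfolding Q_def
      by eventually_elim (rule shrinkage_sample.risk_kernel_negative[OF _ pn pm ab(1,3) bound])
    show "emeasure M (space M) \<noteq> 0" by (simp add: M.emeasure_space_1)
  qed simp
  ultimately have neg: "(LINT p|M. \<Delta> p) < 0" by simp
  have split: "AE p in M. LG p = L0 p + \<Delta> p"
    using good
  proof eventually_elim
    case (elim p)
    show ?case
      using shrinkage_sample.kl_formula_difference[OF elim n0 ab(1,3) \<Sigma>, of \<Theta>]
      unfolding LG_def L0_def \<Delta>_def e0_def e1_def e2_def b_def l_def Q_def m_def by (simp add: case_prod_unfold)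
  qed
  have [measurable]: "LG \<in> borel_measurable M" "L0 \<in> borel_measurable M"
    unfolding LG_def L0_def kl_formula_def Theta_G_def Sigma_G2_def Sigma_0_def shrink_factor_def case_prod_unfold
    by measurable
  show L0_int: "integrable M L0"
  proof -
    define c where "c = real CARD('m) / 2 * (real CARD('p) * ln (real n) + ln (det \<Sigma>) - real CARD('p))"
    have "integrable M (\<lambda>p. real CARD('m) / 2 * (inverse (real n) * e0 p - ln (det (transpose (snd p) ** snd p)))
      + ((fst p - \<Theta>) ** ?I) \<bullet> (fst p - \<Theta>) / 2 + c)"
      using e0_int intZ[OF integrable_ln_det_gram[OF \<Sigma> pn[unfolded n_def], of 0]]
        intX[OF matrix_normal_second_moment(2)[OF \<Sigma>, of \<Theta> ?I]] by simp
    then show ?thesis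
    proof (rule integrable_cong_AE_imp)
      show "AE p in M. real CARD('m) / 2 * (inverse (real n) * e0 p - ln (det (transpose (snd p) ** snd p)))
        + ((fst p - \<Theta>) ** ?I) \<bullet> (fst p - \<Theta>) / 2 + c = L0 p"
        using good
      proof eventually_elim
        case (elim p)
        let ?S = "transpose (snd p) ** snd p"
        have S: "pos_def_matrix ?S" using elim by (simp add: shrinkage_sample_def)
        have "Sigma_0 n ?S = mat (inverse (real n)) ** ?S"
          by (simp add: Sigma_0_def matrix_matrix_mult_def mat_def vec_eq_iff if_distrib if_distribR sum.delta' cong: if_cong)
        then have "det (Sigma_0 n ?S) = inverse (real n) ^ CARD('p) * det ?S"
          by (simp add: det_mul det_diagonal mat_def)
        then have ld: "ln (det (Sigma_0 n ?S)) = - (real CARD('p) * ln (real n)) + ln (det ?S)"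
          using pos_def_matrix_det_pos[OF S] n0 by (simp add: ln_mult_pos ln_realpow ln_inverse)
        have tr: "trace (?I ** Sigma_0 n ?S) = inverse (real n) * e0 p"
          unfolding Sigma_0_def e0_def
          by (simp add: matrix_mult_bilinear(8) trace_linear inner_matrix_eq_trace matrix_transpose_mul
              pos_def_matrix_symmetric[OF pos_def_matrix_inverse[OF \<Sigma>]] matrix_mul_assoc)
        show ?case
          by (simp only: L0_def kl_formula_def c_def case_prod_unfold ld tr) (simp add: algebra_simps)
      qed
    qed measurable
  qed
  show "integrable M LG"
  proof (rule integrable_cong_AE_imp[OF Bochner_Integration.integrable_add[OF L0_int \<Delta>_int]])
    show "AE p in M. L0 p + \<Delta> p = LG p" using split by eventually_elim simp
  qed measurable
  have "integral\<^sup>L M LG = (LINT p|M. L0 p + \<Delta> p)"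
    by (rule integral_cong_AE) (use split \<Delta>_int in auto)
  also have "\<dots> = integral\<^sup>L M L0 + (LINT p|M. \<Delta> p)" using L0_int \<Delta>_int by simp
  finally show "integral\<^sup>L M LG < integral\<^sup>L M L0" using neg by simp
  show "AE p in M. 0 \<le> L0 p"
    using good
  proof eventually_elim
    case (elim p)
    show ?case unfolding L0_def
      using kl_formula_nonneg[OF \<Sigma> shrinkage_sample.Sigma_0_pos_def[OF elim n0]] by (simp add: case_prod_unfold)
  qed
  show "AE p in M. 0 \<le> LG p"
    using good
  proof eventually_elim
    case (elim p)
    show ?case unfolding LG_def
      using kl_formula_nonneg[OF \<Sigma> shrinkage_sample.Sigma_G2_pos_def[OF elim n0 ab(1,3)]] by (simp add: case_prod_unfold)
  qed
qed

theorem theorem4p4: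
  fixes \<alpha> \<beta> :: real and n m p :: nat
  assumes n_def: "n = CARD('n::finite)"
    and m_def: "m = CARD('m::finite)"
    and p_def: "p = CARD('p::finite)"
    and "p \<le> n" and "p \<le> m"
    and "0 < \<alpha>" and "0 < \<beta>" and "\<alpha> < 1"
    and "(real n + real p + 1) * \<alpha> + real m * \<alpha> * \<beta> / (2 * (1 - \<alpha>))
           \<le> 2 * (real m - real p - 1) * \<beta> + 2 * (real m / real n) * \<beta>"
  shows "kl_dominates TYPE('n)
           (\<lambda>(X :: real^'p^'m) S. (Theta_G \<alpha> \<beta> X S, Sigma_G2 n \<alpha> \<beta> X S))
           (\<lambda>X S. (X, Sigma_0 n S))"
proof -
  let ?G = "\<lambda>(X :: real^'p^'m) S. (Theta_G \<alpha> \<beta> X S, Sigma_G2 n \<alpha> \<beta> X S)"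
  let ?U = "\<lambda>(X :: real^'p^'m) S. (X, Sigma_0 n S)"
  have n0: "0 < n" by (simp add: n_def)
  have less: "kl_risk TYPE('n) ?G \<Theta> \<Sigma> < kl_risk TYPE('n) ?U \<Theta> \<Sigma>"
    if \<Sigma>: "pos_def_matrix \<Sigma>" for \<Theta> :: "real^'p^'m" and \<Sigma> :: "real^'p^'p"
  proof -
    let ?M = "matrix_normal \<Theta> \<Sigma> \<Otimes>\<^sub>M matrix_normal (0 :: real^'p^'n) \<Sigma>"
    let ?L0 = "\<lambda>(X, Z :: real^'p^'n). kl_formula X (Sigma_0 n (gram Z)) \<Theta> \<Sigma>"
    let ?LG = "\<lambda>(X, Z :: real^'p^'n). kl_formula (Theta_G \<alpha> \<beta> X (gram Z)) (Sigma_G2 n \<alpha> \<beta> X (gram Z)) \<Theta> \<Sigma>"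
    have L: "integrable ?M ?L0" "integrable ?M ?LG" "integral\<^sup>L ?M ?LG < integral\<^sup>L ?M ?L0"
      "AE p in ?M. 0 \<le> ?L0 p" "AE p in ?M. 0 \<le> ?LG p"
      using expected_loss_decreases[where 'n = 'n and 'm = 'm and 'p = 'p, of \<Sigma> \<alpha> \<beta> \<Theta>] \<Sigma> assms by simp_all
    have U: "kl_risk TYPE('n) ?U \<Theta> \<Sigma> = ennreal (integral\<^sup>L ?M ?L0)"
    proof -
      have "kl_risk TYPE('n) ?U \<Theta> \<Sigma> = (\<integral>\<^sup>+(X, Z). ennreal (kl_formula X (Sigma_0 n (gram Z)) \<Theta> \<Sigma>) \<partial>?M)"
      proof (rule kl_risk_eq[OF \<Sigma>])
        show "(\<lambda>(X, S). kl_formula X (Sigma_0 n S) \<Theta> \<Sigma>) \<in> borel_measurable (borel \<Otimes>\<^sub>M borel)"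
          unfolding kl_formula_def Sigma_0_def case_prod_unfold by measurable
        show "kl_loss (X, Sigma_0 n S) \<Theta> \<Sigma> = kl_formula X (Sigma_0 n S) \<Theta> \<Sigma>" if "pos_def_matrix S" for X S
          unfolding Sigma_0_def by (intro kl_loss_eq \<Sigma> pos_def_matrix_scaleR that) (use n0 in simp)
      qed (use assms in auto)
      also have "\<dots> = ennreal (integral\<^sup>L ?M ?L0)"
        using L(1,4) by (subst nn_integral_eq_integral[symmetric]) (auto simp: case_prod_unfold)
      finally show ?thesis .
    qed
    have G: "kl_risk TYPE('n) ?G \<Theta> \<Sigma> = ennreal (integral\<^sup>L ?M ?LG)"
    proof -
      have "kl_risk TYPE('n) ?G \<Theta> \<Sigma> = (\<integral>\<^sup>+(X, Z). ennreal (kl_formula (Theta_G \<alpha> \<beta> X (gram Z)) (Sigma_G2 n \<alpha> \<beta> X (gram Z)) \<Theta> \<Sigma>) \<partial>?M)"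
      proof (rule kl_risk_eq[OF \<Sigma>])
        show "(\<lambda>(X, S). kl_formula (Theta_G \<alpha> \<beta> X S) (Sigma_G2 n \<alpha> \<beta> X S) \<Theta> \<Sigma>) \<in> borel_measurable (borel \<Otimes>\<^sub>M borel)"
          unfolding kl_formula_def Theta_G_def Sigma_G2_def Sigma_0_def shrink_factor_def case_prod_unfold by measurable
        show "kl_loss (Theta_G \<alpha> \<beta> X S, Sigma_G2 n \<alpha> \<beta> X S) \<Theta> \<Sigma> = kl_formula (Theta_G \<alpha> \<beta> X S) (Sigma_G2 n \<alpha> \<beta> X S) \<Theta> \<Sigma>"
          if X: "pos_def_matrix (gram X)" and S: "pos_def_matrix S" for X S
        proof (rule kl_loss_eq[OF \<Sigma>])
          obtain B :: "real^'p^'p" where B: "S = transpose B ** B" by (rule pos_def_matrix_factor[OF S])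
          interpret shrinkage_sample \<beta> X B by unfold_locales (use assms X S B in auto)
          show "pos_def_matrix (Sigma_G2 n \<alpha> \<beta> X S)" unfolding B by (intro Sigma_G2_pos_def n0 assms)
        qed
      qed (use assms in auto)
      also have "\<dots> = ennreal (integral\<^sup>L ?M ?LG)"
        using L(2,5) by (subst nn_integral_eq_integral[symmetric]) (auto simp: case_prod_unfold)
      finally show ?thesis .
    qed
    have "0 \<le> integral\<^sup>L ?M ?LG" using L(5) by (rule integral_nonneg_AE)
    then show ?thesis unfolding U G using L(3) by (simp add: ennreal_less_iff)
  qed
  show ?thesis unfolding kl_dominates_def
    using less less[OF pos_def_matrix_one, of 0] pos_def_matrix_one less_imp_le by blast
qed

end
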